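(* Assume the extremal function $F_n$ is nonconstant and let $\mathsf E_n=F_n^{-1}([-1,1])$ (a finite union of nondegenerate closed arcs of $\overline{\mathbb R}$). Then there is a single-valued analytic function $B_n$ on $\overline{\mathbb C}\setminus\mathsf E_n$ such that $-\log|B_n(z)|=\sum_{\mathbf c}(F_n)_\infty(\mathbf c)\,G_{\mathsf E_n}(z,\mathbf c)$ for $z\in\overline{\mathbb C}\setminus\mathsf E_n$, $\lim_{x\to x_*}B_n(x)\,r(x,x_* )^{d_n}>0$, and $$F_n(z)=\frac12\Big(B_n(z)+\frac1{B_n(z)}\Big),\qquad z\in\overline{\mathbb C}\setminus\mathsf E_n.$$
   Context: Let $\mathsf E\subset\overline{\mathbb R}$ be compact, proper, with infinitely many points. Divisors are finitely supported $D:\overline{\mathbb C}\to\mathbb Z$; for rational $f$, $(f)_\infty$ is its polar divisor ($0$ for constants); $\mathcal L(D)=\{f\text{ rational}:(f)_\infty\le D\}$. For $\mathbf c\in\overline{\mathbb R}$, $r(z,\mathbf c)=1/(\mathbf c-z)$ if $\mathbf c\neq\infty$, $r(z,\infty)=z$. Fix $n\ge1$, an integral divisor $D_n^\infty$ of degree $n$ supported in $\overline{\mathbb R}\setminus\mathsf E$, $x_*\in\overline{\mathbb R}\setminus\mathsf E$, $d_n=D_n^\infty(x_* )$; $F_n$ is the unique maximizer of $\Re\lim_{x\to x_*}F(x)/r(x,x_* )^{d_n}$ over $F\in\mathcal L(D_n^\infty)$ with $\sup_{\mathsf E}|F|\le1$. For a closed nonpolar $\mathsf K\subset\overline{\mathbb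 R}$, $G_{\mathsf K}(z,w)$ denotes the Green function of $\overline{\mathbb C}\setminus\mathsf K$ with pole at $w$. *)

theory Defs
  imports "HOL-Complex_Analysis.Complex_Analysis" "HOL-Computational_Algebra.Polynomial"
begin

text \<open>The Riemann sphere is modelled as complex option, None being the point at infinity.\<close>

definition Rbar :: "complex option set" where
  "Rbar = insert None (Some ` range complex_of_real)"

definition sphere_compact :: "complex option set \<Rightarrow> bool" where
  "sphere_compact S \<longleftrightarrow> closed {z. Some z \<in> S} \<and> (None \<notin> S \<longrightarrow> bounded {z. Some z \<in> S})"

definition inf_chart :: "complex \<Rightarrow> complex option" where
  "inf_chart \<zeta> = (if \<zeta> = 0 then None else Some (1 / \<zeta>))"

definition rat_rep :: "(complex option \<Rightarrow> complex option) \<Rightarrow> complex poly \<Rightarrow> complex poly \<Rightarrow> bool" where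
  "rat_rep f p q \<longleftrightarrow> q \<noteq> 0 \<and> coprime p q \<and>
     (\<forall>z. f (Some z) = (if poly q z = 0 then None else Some (poly p z / poly q z))) \<and>
     f None = (if degree p > degree q then None
               else if degree p < degree q then Some 0
               else Some (lead_coeff p / lead_coeff q))"

definition rational_fun :: "(complex option \<Rightarrow> complex option) \<Rightarrow> bool" where
  "rational_fun f \<longleftrightarrow> (\<exists>p q. rat_rep f p q)"

definition polar_div :: "(complex option \<Rightarrow> complex option) \<Rightarrow> complex option \<Rightarrow> nat" where
  "polar_div f c = (SOME k. \<exists>p q. rat_rep f p q \<and>
      k = (case c of Some a \<Rightarrow> order a q | None \<Rightarrow> degree p - degree q))"

definition Lspace :: "(complex option \<Rightarrow> int) \<Rightarrow> (complex option \<Rightarrow> complex option) set" where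
  "Lspace D = {f. rational_fun f \<and> (\<forall>c. int (polar_div f c) \<le> D c)}"

definition sup_le1 :: "complex option set \<Rightarrow> (complex option \<Rightarrow> complex option) \<Rightarrow> bool" where
  "sup_le1 E f \<longleftrightarrow> (\<forall>x\<in>E. \<exists>w. f x = Some w \<and> cmod w \<le> 1)"

definition rr :: "complex \<Rightarrow> complex option \<Rightarrow> complex" where
  "rr z c = (case c of Some a \<Rightarrow> 1 / (a - z) | None \<Rightarrow> z)"

definition real_filter :: "complex option \<Rightarrow> real filter" where
  "real_filter c = (case c of Some a \<Rightarrow> at (Re a) | None \<Rightarrow> at_infinity)"

definition fin :: "complex option \<Rightarrow> complex" where
  "fin w = (case w of Some v \<Rightarrow> v | None \<Rightarrow> 0)"

definition lead_coef :: "(complex option \<Rightarrow> complex option) \<Rightarrow> complex option \<Rightarrow> nat \<Rightarrow> complex" where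
  "lead_coef F c d = Lim (real_filter c) (\<lambda>x::real. fin (F (Some (of_real x))) / rr (of_real x) c ^ d)"

definition is_extremal :: "complex option set \<Rightarrow> (complex option \<Rightarrow> int) \<Rightarrow> complex option
    \<Rightarrow> (complex option \<Rightarrow> complex option) \<Rightarrow> bool" where
  "is_extremal E D xs F \<longleftrightarrow> F \<in> Lspace D \<and> sup_le1 E F \<and>
     (\<forall>G\<in>Lspace D. sup_le1 E G \<longrightarrow>
        Re (lead_coef G xs (nat (D xs))) \<le> Re (lead_coef F xs (nat (D xs))))"

definition preim_interval :: "(complex option \<Rightarrow> complex option) \<Rightarrow> complex option set" where
  "preim_interval F = {z. \<exists>t::real. -1 \<le> t \<and> t \<le> 1 \<and> F z = Some (complex_of_real t)}"

definition sphere_analytic_on :: "(complex option \<Rightarrow> complex) \<Rightarrow> complex option set \<Rightarrow> bool" where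
  "sphere_analytic_on B S \<longleftrightarrow> open {z. Some z \<in> S} \<and> (\<lambda>z. B (Some z)) holomorphic_on {z. Some z \<in> S} \<and>
     (None \<in> S \<longrightarrow> (\<exists>r>0. (\<forall>\<zeta>\<in>ball 0 r. inf_chart \<zeta> \<in> S) \<and> (\<lambda>\<zeta>. B (inf_chart \<zeta>)) holomorphic_on ball 0 r))"

definition harmonic_in :: "(complex \<Rightarrow> real) \<Rightarrow> complex set \<Rightarrow> bool" where
  "harmonic_in u S \<longleftrightarrow> open S \<and> (\<forall>z\<in>S. \<exists>r>0. ball z r \<subseteq> S \<and>
      (\<exists>f. f holomorphic_on ball z r \<and> (\<forall>w\<in>ball z r. u w = Re (f w))))"

text \<open>Green function of the complement of K with pole at w (boundary values zero at every point of K;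
  this is the Green function for regular K, e.g. finite unions of nondegenerate arcs).
  Values on K and at w are normalised to 0.\<close>
definition green_fun :: "complex option set \<Rightarrow> complex option \<Rightarrow> (complex option \<Rightarrow> real) \<Rightarrow> bool" where
  "green_fun K w g \<longleftrightarrow>
     g w = 0 \<and> (\<forall>z\<in>K. g z = 0) \<and>
     harmonic_in (\<lambda>z. g (Some z)) {z. Some z \<notin> K \<and> Some z \<noteq> w} \<and>
     (None \<notin> K \<and> w \<noteq> None \<longrightarrow>
        (\<exists>r>0. (\<forall>\<zeta>\<in>ball 0 r. inf_chart \<zeta> \<notin> K) \<and> harmonic_in (\<lambda>\<zeta>. g (inf_chart \<zeta>)) (ball 0 r))) \<and>
     (case w of
        Some a \<Rightarrow> (\<exists>r>0. \<exists>h. harmonic_in h (ball a r) \<and>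
                   (\<forall>z\<in>ball a r - {a}. Some z \<notin> K \<longrightarrow> g (Some z) = h z - ln (cmod (z - a))))
      | None \<Rightarrow> (\<exists>r>0. \<exists>h. harmonic_in h (ball 0 r) \<and>
                   (\<forall>\<zeta>\<in>ball 0 r - {0}. inf_chart \<zeta> \<notin> K \<longrightarrow> g (inf_chart \<zeta>) = h \<zeta> - ln (cmod \<zeta>)))) \<and>
     (\<forall>\<xi>\<in>K. case \<xi> of
        Some a \<Rightarrow> ((\<lambda>z. g (Some z)) \<longlongrightarrow> 0) (at a within {z. Some z \<notin> K})
      | None \<Rightarrow> ((\<lambda>z. g (Some z)) \<longlongrightarrow> 0) (inf at_infinity (principal {z. Some z \<notin> K})))"

definition green :: "complex option set \<Rightarrow> complex option \<Rightarrow> complex option \<Rightarrow> real" where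
  "green K w = (THE g. green_fun K w g)"

end

(* Rotating the extremal function and comparing it with a multiple of r(z, x_* )^d shows that its leading
   coefficient at x_* is real and positive; nothing else about extremality enters.  B is the branch with
   values in the unit disc of the inverse Joukowski map, applied to F.  Hence -log|B| is positive and
   harmonic off the poles of F and vanishes at the boundary of the complement of E_n, so the formula for
   it follows from the maximum principle once the individual Green functions are known to exist.  They do
   because -log|B| is a majorant: for each pole c, sweeping out a truncated logarithm gives an increasing
   sequence of subharmonic functions below -log|B|, whose limit again vanishes at the boundary. *)

theory Submission
  imports Defs "HOL-Computational_Algebra.Fundamental_Theorem_Algebra"
begin

section \<open>Harmonic functions and the maximum principle\<close>

text \<open>\<open>green\<close> is a description operator, so its value is known only after
  existence and uniqueness on the sphere have both been proved. A finite point \<open>a\<close> of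
  E_n is moved to infinity; the complement of E_n then lies in a single planar chart
  \<open>U\<close>, and \<open>F\<close> becomes a quotient \<open>P / Q\<close> there.
  \<open>U\<close> may be unbounded and nothing is known about its components. Vanishing at the
  boundary is therefore expressed by compact subsets of \<open>U\<close>, and the maximum principle
  is arranged so as not to involve connectedness. Harmonic means locally the real part of a
  holomorphic function; this makes comparisons multiplicative: \<open>|b| * exp s\<close> is locally
  the modulus of a holomorphic function even at a zero of \<open>b\<close>, where -log|b| is
  infinite, and limits of harmonic functions are taken after exponentiation, where Montel's theorem
  applies. No barrier is constructed: a Green function squeezed between 0 and -log|B| inherits its
  boundary values, and those of -log|B| are read off from confocal ellipses.\<close>

lemma harmonic_in_continuous_on:
  assumes "harmonic_in u S"
  shows "continuous_on S u"
proof (rule continuous_at_imp_continuous_on, rule ballI)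
  fix z assume "z \<in> S"
  then obtain r f where r: "r > 0" "f holomorphic_on ball z r" "\<forall>w\<in>ball z r. u w = Re (f w)"
    using assms unfolding harmonic_in_def by blast
  have "continuous_on (ball z r) (\<lambda>w. Re (f w))"
    by (intro continuous_intros holomorphic_on_imp_continuous_on r)
  then have "continuous_on (ball z r) u"
    using r(3) continuous_on_cong[of "ball z r" "ball z r" u "\<lambda>w. Re (f w)"] by simp
  then show "isCont u z"
    using r(1) by (simp add: continuous_on_eq_continuous_at)
qed

lemma harmonic_in_subset:
  assumes "harmonic_in u S" "open T" "T \<subseteq> S"
  shows "harmonic_in u T"
  unfolding harmonic_in_def
proof (intro conjI ballI assms)
  fix z assume z: "z \<in> T"
  then obtain r f where r: "r > 0" "f holomorphic_on ball z r" "\<forall>w\<in>ball z r. u w = Re (f w)"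
    using assms unfolding harmonic_in_def by blast
  obtain d where d: "d > 0" "ball z d \<subseteq> T"
    using \<open>open T\<close> z open_contains_ball by blast
  show "\<exists>r>0. ball z r \<subseteq> T \<and> (\<exists>f. f holomorphic_on ball z r \<and> (\<forall>w\<in>ball z r. u w = Re (f w)))"
    using r d by (intro exI[of _ "min r d"]) (auto intro!: exI[of _ f] intro: holomorphic_on_subset)
qed

lemma harmonic_in_cong:
  assumes "harmonic_in u S" "\<And>z. z \<in> S \<Longrightarrow> v z = u z"
  shows "harmonic_in v S"
  unfolding harmonic_in_def
proof (intro conjI ballI)
  show "open S" using assms(1) by (simp add: harmonic_in_def)
  fix z assume "z \<in> S"
  then obtain r f where "r > 0" "ball z r \<subseteq> S" "f holomorphic_on ball z r" "\<forall>w\<in>ball z r. u w = Re (f w)"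
    using assms(1) unfolding harmonic_in_def by blast
  with assms(2) show "\<exists>r>0. ball z r \<subseteq> S \<and> (\<exists>f. f holomorphic_on ball z r \<and> (\<forall>w\<in>ball z r. v w = Re (f w)))"
    by (intro exI[of _ r] conjI exI[of _ f]) auto
qed

lemma harmonic_in_Re:
  assumes "open S" "f holomorphic_on S"
  shows "harmonic_in (\<lambda>z. Re (f z)) S"
  unfolding harmonic_in_def
proof (intro conjI ballI assms)
  fix z assume "z \<in> S"
  then obtain r where "r > 0" "ball z r \<subseteq> S"
    using \<open>open S\<close> open_contains_ball by blast
  then show "\<exists>r>0. ball z r \<subseteq> S \<and> (\<exists>g. g holomorphic_on ball z r \<and> (\<forall>w\<in>ball z r. Re (f w) = Re (g w)))"
    using holomorphic_on_subset[OF assms(2)] by blast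
qed

lemma harmonic_in_const: "open S \<Longrightarrow> harmonic_in (\<lambda>z. c) S"
  using harmonic_in_Re[of S "\<lambda>z. of_real c"] by simp

lemma harmonic_in_local:
  assumes "open S" "\<And>z. z \<in> S \<Longrightarrow> \<exists>T. z \<in> T \<and> harmonic_in u T"
  shows "harmonic_in u S"
  unfolding harmonic_in_def
proof (intro conjI ballI assms)
  fix z assume z: "z \<in> S"
  then obtain T where T: "z \<in> T" "harmonic_in u T" using assms by blast
  then have "open (S \<inter> T)"
    using \<open>open S\<close> by (auto simp: harmonic_in_def)
  with T have "harmonic_in u (S \<inter> T)"
    using harmonic_in_subset by blast
  moreover have "z \<in> S \<inter> T" using z T by simp
  ultimately obtain r f where "r > 0" "ball z r \<subseteq> S \<inter> T" "f holomorphic_on ball z r"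
      "\<forall>w\<in>ball z r. u w = Re (f w)"
    unfolding harmonic_in_def by meson
  then show "\<exists>r>0. ball z r \<subseteq> S \<and> (\<exists>f. f holomorphic_on ball z r \<and> (\<forall>w\<in>ball z r. u w = Re (f w)))"
    by (metis Int_subset_iff)
qed

lemma harmonic_in_compose:
  assumes "harmonic_in u S" "open T" "f holomorphic_on T" "f ` T \<subseteq> S"
  shows "harmonic_in (\<lambda>z. u (f z)) T"
proof (rule harmonic_in_local[OF \<open>open T\<close>])
  fix z assume z: "z \<in> T"
  then obtain r g where r: "r > 0" "g holomorphic_on ball (f z) r" "\<forall>w\<in>ball (f z) r. u w = Re (g w)"
    using assms unfolding harmonic_in_def by blast
  define V where "V = T \<inter> f -` ball (f z) r"
  have V: "open V"
    unfolding V_def using assms holomorphic_on_imp_continuous_on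
    by (intro continuous_open_preimage) auto
  have "(g \<circ> f) holomorphic_on V"
    using assms r by (intro holomorphic_on_compose_gen[of f V g "ball (f z) r"])
      (auto simp: V_def intro: holomorphic_on_subset)
  then have "harmonic_in (\<lambda>w. Re ((g \<circ> f) w)) V"
    using V by (rule harmonic_in_Re[rotated])
  then have "harmonic_in (\<lambda>w. u (f w)) V"
    by (rule harmonic_in_cong) (use r in \<open>auto simp: V_def\<close>)
  then show "\<exists>T. z \<in> T \<and> harmonic_in (\<lambda>z. u (f z)) T"
    using z r by (intro exI[of _ V]) (auto simp: V_def)
qed

lemma harmonic_in_add:
  assumes "harmonic_in u S" "harmonic_in v S"
  shows "harmonic_in (\<lambda>z. u z + v z) S"
  unfolding harmonic_in_def
proof (intro conjI ballI)
  show "open S" using assms by (simp add: harmonic_in_def)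
  fix z assume z: "z \<in> S"
  then obtain r f where r: "r > 0" "ball z r \<subseteq> S" "f holomorphic_on ball z r" "\<forall>w\<in>ball z r. u w = Re (f w)"
    using assms unfolding harmonic_in_def by blast
  obtain r' f' where r': "r' > 0" "f' holomorphic_on ball z r'" "\<forall>w\<in>ball z r'. v w = Re (f' w)"
    using z assms unfolding harmonic_in_def by blast
  show "\<exists>r>0. ball z r \<subseteq> S \<and> (\<exists>f. f holomorphic_on ball z r \<and> (\<forall>w\<in>ball z r. u w + v w = Re (f w)))"
    using r r'
    by (intro exI[of _ "min r r'"] conjI exI[of _ "\<lambda>w. f w + f' w"] holomorphic_intros)
       (auto intro: holomorphic_on_subset)
qed

lemma harmonic_in_cmult:
  assumes "harmonic_in u S"
  shows "harmonic_in (\<lambda>z. a * u z) S"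
  unfolding harmonic_in_def
proof (intro conjI ballI)
  show "open S" using assms by (simp add: harmonic_in_def)
  fix z assume z: "z \<in> S"
  then obtain r f where r: "r > 0" "ball z r \<subseteq> S" "f holomorphic_on ball z r" "\<forall>w\<in>ball z r. u w = Re (f w)"
    using assms unfolding harmonic_in_def by blast
  show "\<exists>r>0. ball z r \<subseteq> S \<and> (\<exists>f. f holomorphic_on ball z r \<and> (\<forall>w\<in>ball z r. a * u w = Re (f w)))"
    using r by (intro exI[of _ "r"] conjI exI[of _ "\<lambda>w. of_real a * f w"] holomorphic_intros) auto
qed

lemma harmonic_in_diff:
  assumes "harmonic_in u S" "harmonic_in v S"
  shows "harmonic_in (\<lambda>z. u z - v z) S"
  using harmonic_in_add[OF assms(1) harmonic_in_cmult[OF assms(2), of "-1"]] by simp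

lemma harmonic_in_sum:
  assumes "open S" "\<And>i. i \<in> I \<Longrightarrow> harmonic_in (u i) S"
  shows "harmonic_in (\<lambda>z. \<Sum>i\<in>I. u i z) S"
  using assms(2)
proof (induction I rule: infinite_finite_induct)
  case (insert x F)
  then show ?case by (simp add: harmonic_in_add)
qed (use \<open>open S\<close> in \<open>simp_all add: harmonic_in_const\<close>)

text \<open>On a disc a zero-free holomorphic function has a holomorphic logarithm, and
  \<open>ln |f|\<close> is its real part.\<close>

lemma harmonic_in_ln_norm:
  assumes "open S" "f holomorphic_on S" "\<And>z. z \<in> S \<Longrightarrow> f z \<noteq> 0"
  shows "harmonic_in (\<lambda>z. ln (cmod (f z))) S"
  unfolding harmonic_in_def
proof (intro conjI ballI assms)
  fix z assume z: "z \<in> S"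
  obtain r where r: "r > 0" "ball z r \<subseteq> S"
    using \<open>open S\<close> z open_contains_ball by blast
  obtain g where g: "g holomorphic_on ball z r" "\<And>w. w \<in> ball z r \<Longrightarrow> exp (g w) = f w"
  proof (rule holomorphic_logarithm_exists[of "ball z r" f z])
    show "f holomorphic_on ball z r"
      using assms(2) r(2) by (rule holomorphic_on_subset)
  qed (use r assms(3) in auto)
  have "ln (cmod (f w)) = Re (g w)" if "w \<in> ball z r" for w
    using g(2)[OF that, symmetric] by simp
  then show "\<exists>r>0. ball z r \<subseteq> S \<and> (\<exists>h. h holomorphic_on ball z r \<and> (\<forall>w\<in>ball z r. ln (cmod (f w)) = Re (h w)))"
    using r g by blast
qed

text \<open>The hypothesis on superlevel sets expresses that \<open>limsup v \<le> 1\<close> at the boundary of \<open>U\<close>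
  and at infinity, without any regularity of either.\<close>

lemma maximum_principle_modulus:
  fixes v :: "complex \<Rightarrow> real"
  assumes loc: "\<And>z. z \<in> U \<Longrightarrow> \<exists>r>0. ball z r \<subseteq> U \<and>
      (\<exists>f. f holomorphic_on ball z r \<and> (\<forall>w\<in>ball z r. v w = cmod (f w)))"
    and cpt: "\<And>\<epsilon>. \<epsilon> > 0 \<Longrightarrow> compact {z \<in> U. v z \<ge> 1 + \<epsilon>}"
    and "z \<in> U"
  shows "v z \<le> 1"
proof (rule ccontr)
  assume "\<not> v z \<le> 1"
  define M where "M = {w \<in> U. v w \<ge> v z}"
  have M: "compact M" "z \<in> M"
    using cpt[of "v z - 1"] \<open>\<not> v z \<le> 1\<close> \<open>z \<in> U\<close> by (auto simp: M_def)
  have cont: "continuous_on U v"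
  proof (rule continuous_at_imp_continuous_on, rule ballI)
    fix z assume "z \<in> U"
    then obtain r f where r: "r > 0" "f holomorphic_on ball z r" "\<forall>w\<in>ball z r. v w = cmod (f w)"
      using loc by blast
    have "continuous_on (ball z r) (\<lambda>w. cmod (f w))"
      by (intro continuous_intros holomorphic_on_imp_continuous_on r)
    then have "continuous_on (ball z r) v"
      using r(3) continuous_on_cong[of "ball z r" "ball z r" v "\<lambda>w. cmod (f w)"] by simp
    then show "isCont v z"
      using r(1) by (simp add: continuous_on_eq_continuous_at)
  qed
  have contM: "continuous_on M v"
    by (rule continuous_on_subset[OF cont]) (auto simp: M_def)
  obtain x where x: "x \<in> M" "\<And>y. y \<in> M \<Longrightarrow> v y \<le> v x"
    using continuous_attains_sup[OF M(1) _ contM] M(2) by blast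
  have max: "v y \<le> v x" if "y \<in> U" for y
    using x(2)[of y] x(2)[OF M(2)] that by (cases "v y \<ge> v z") (auto simp: M_def)
  \<comment> \<open>The set of maximum points is compact as a closed part of \<open>M\<close>, and
    open by the local maximum modulus principle. The plane has no nonempty subset that is both;
    connectedness of the plane replaces that of \<open>U\<close>.\<close>
  define T where "T = M \<inter> v -` {v x}"
  have "compact T"
    using continuous_closed_preimage[OF contM compact_imp_closed[OF M(1)], of "{v x}"] M(1)
    unfolding T_def by (metis closed_singleton compact_Int_closed inf.left_idem)
  moreover have "open T"
    unfolding open_contains_ball
  proof
    fix w assume w: "w \<in> T"
    then have "w \<in> U" "v w = v x" by (auto simp: T_def M_def)
    then obtain r f where r: "r > 0" "ball w r \<subseteq> U" "f holomorphic_on ball w r" "\<forall>y\<in>ball w r. v y = cmod (f y)"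
      using loc by blast
    have "f constant_on ball w r"
    proof (rule maximum_modulus_principle[OF r(3)])
      show "cmod (f y) \<le> cmod (f w)" if "y \<in> ball w r" for y
        using r that max[of y] \<open>v w = v x\<close> by (metis centre_in_ball subsetD)
    qed (use r in auto)
    then have "v y = v w" if "y \<in> ball w r" for y
      using r that unfolding constant_on_def by (metis centre_in_ball)
    then have "ball w r \<subseteq> T"
      using r(2) \<open>v w = v x\<close> x(1) by (auto simp: T_def M_def subset_iff)
    then show "\<exists>e>0. ball w e \<subseteq> T" using r by blast
  qed
  moreover have "x \<in> T" using x by (auto simp: T_def)
  ultimately have "T = UNIV"
    using connected_UNIV[unfolded connected_clopen, rule_format, of T]
    by (auto simp: compact_imp_closed)
  with \<open>compact T\<close> show False
    by (metis compact_imp_bounded not_bounded_UNIV)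
qed

text \<open>The superlevel sets are compact here: they are closed in the compact set
  \<open>closure U\<close> and stay away from the frontier.\<close>

lemma maximum_principle_frontier:
  fixes v :: "complex \<Rightarrow> real"
  assumes "bounded U"
    and loc: "\<And>z. z \<in> U \<Longrightarrow> \<exists>r>0. ball z r \<subseteq> U \<and>
      (\<exists>f. f holomorphic_on ball z r \<and> (\<forall>w\<in>ball z r. v w = cmod (f w)))"
    and cont: "continuous_on (closure U) v" and le: "\<And>z. z \<in> frontier U \<Longrightarrow> v z \<le> 1"
    and "z \<in> U"
  shows "v z \<le> 1"
proof (rule maximum_principle_modulus[OF loc _ \<open>z \<in> U\<close>])
  fix e :: real assume "e > 0"
  have "open U"
    using loc unfolding open_contains_ball by blast
  have "{z \<in> U. v z \<ge> 1 + e} = {z \<in> closure U. v z \<ge> 1 + e}"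
    using le \<open>e > 0\<close> \<open>open U\<close> closure_subset[of U]
    by (force simp: frontier_def interior_open)
  moreover have "compact {z \<in> closure U. v z \<ge> 1 + e}"
  proof -
    have "closed {z \<in> closure U. v z \<ge> 1 + e}"
      using continuous_closed_preimage[OF cont closed_closure, of "{1+e..}"]
      by (simp add: vimage_def Int_def)
    then show ?thesis
      using \<open>bounded U\<close> by (metis (no_types, lifting) bounded_closure bounded_subset compact_eq_bounded_closed mem_Collect_eq subsetI)
  qed
  ultimately show "compact {z \<in> U. v z \<ge> 1 + e}" by simp
qed

text \<open>Locally \<open>exp (u - B)\<close> is the modulus of \<open>exp (f - B)\<close>, which
  reduces the claim to the principle for moduli.\<close>

lemma harmonic_maximum_frontier:
  fixes u :: "complex \<Rightarrow> real"
  assumes "bounded U" "harmonic_in u U"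
    and cont: "continuous_on (closure U) u" and le: "\<And>z. z \<in> frontier U \<Longrightarrow> u z \<le> B"
    and "z \<in> U"
  shows "u z \<le> B"
proof -
  have "exp (u z - B) \<le> 1"
  proof (rule maximum_principle_frontier[OF \<open>bounded U\<close> _ _ _ \<open>z \<in> U\<close>])
    fix z assume "z \<in> U"
    then obtain r f where r: "r > 0" "ball z r \<subseteq> U" "f holomorphic_on ball z r" "\<forall>w\<in>ball z r. u w = Re (f w)"
      using assms unfolding harmonic_in_def by blast
    then show "\<exists>r>0. ball z r \<subseteq> U \<and> (\<exists>f. f holomorphic_on ball z r \<and> (\<forall>w\<in>ball z r. exp (u w - B) = cmod (f w)))"
      by (intro exI[of _ r] conjI exI[of _ "\<lambda>z. exp (f z - of_real B)"] holomorphic_intros) auto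
  qed (use cont le in \<open>auto intro!: continuous_intros\<close>)
  then show ?thesis by simp
qed

section \<open>The Dirichlet problem for a disc\<close>

text \<open>The imaginary parts of \<open>f k\<close> are not controlled, so
  \<open>exp (f k)\<close> is used instead. These functions are bounded by \<open>exp C\<close>;
  Montel's theorem gives a limit whose modulus is \<open>exp (u z)\<close>. It has no zeros, hence a
  holomorphic logarithm on the disc. A subsequence is enough because \<open>u\<close> is already the
  pointwise limit.\<close>

lemma harmonic_limit:
  fixes f :: "nat \<Rightarrow> complex \<Rightarrow> complex"
  assumes holo: "\<And>k. f k holomorphic_on ball p r"
    and bound: "\<And>k z. z \<in> ball p r \<Longrightarrow> \<bar>Re (f k z)\<bar> \<le> C"
    and lim: "\<And>z. z \<in> ball p r \<Longrightarrow> (\<lambda>k. Re (f k z)) \<longlonglongrightarrow> u z"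
  shows "\<exists>g. g holomorphic_on ball p r \<and> (\<forall>z\<in>ball p r. u z = Re (g z))"
proof (cases "r > 0")
  case True
  define e where "e k z = exp (f k z)" for k z
  have "\<exists>B. \<forall>h\<in>range e. \<forall>z\<in>K. cmod (h z) \<le> B" if "K \<subseteq> ball p r" for K
  proof (intro exI ballI)
    fix h z assume "h \<in> range e" "z \<in> K"
    then obtain k where k: "h = e k" by auto
    have "Re (f k z) \<le> C" using bound[of z k] that \<open>z \<in> K\<close> by auto
    then show "cmod (h z) \<le> exp C" by (simp add: k e_def)
  qed
  moreover have "h holomorphic_on ball p r" if "h \<in> range e" for h
    using that holo by (auto simp: e_def[abs_def] intro!: holomorphic_intros)
  ultimately obtain h \<sigma> where h: "h holomorphic_on ball p r" "strict_mono (\<sigma> :: nat \<Rightarrow> nat)"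
      "\<And>z. z \<in> ball p r \<Longrightarrow> (\<lambda>n. e (\<sigma> n) z) \<longlonglongrightarrow> h z"
    using Montel[of "ball p r" "range e" e] by (metis open_ball order_refl)
  have nh: "cmod (h z) = exp (u z)" if "z \<in> ball p r" for z
  proof (rule LIMSEQ_unique)
    show "(\<lambda>n. cmod (e (\<sigma> n) z)) \<longlonglongrightarrow> cmod (h z)"
      by (intro tendsto_intros h that)
    have "(\<lambda>n. Re (f (\<sigma> n) z)) \<longlonglongrightarrow> u z"
      using LIMSEQ_subseq_LIMSEQ[OF lim[OF that] h(2)] by (simp add: o_def)
    then show "(\<lambda>n. cmod (e (\<sigma> n) z)) \<longlonglongrightarrow> exp (u z)"
      by (simp add: e_def tendsto_exp)
  qed
  obtain g where g: "g holomorphic_on ball p r" "\<And>z. z \<in> ball p r \<Longrightarrow> exp (g z) = h z"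
  proof (rule holomorphic_logarithm_exists[of "ball p r" h p])
    show "h z \<noteq> 0" if "z \<in> ball p r" for z
      using nh[OF that] by (metis exp_not_eq_zero norm_zero)
  qed (use h True in auto)
  have "u z = Re (g z)" if "z \<in> ball p r" for z
    using nh[OF that] g(2)[OF that, symmetric] by simp
  with g show ?thesis by blast
next
  case False
  then have "ball p r = {}" by (intro ball_empty) simp
  then show ?thesis by (metis empty_iff holomorphic_on_empty)
qed

lemma Re_poly_circle_sum:
  assumes "\<And>i. i \<in> I \<Longrightarrow> \<exists>p. \<forall>z\<in>sphere 0 1. u i z = Re (poly p z)"
  shows "\<exists>p. \<forall>z\<in>sphere 0 1. (\<Sum>i\<in>I. u i z) = Re (poly p z)"
proof -
  from assms obtain p where p: "\<And>i. i \<in> I \<Longrightarrow> \<forall>z\<in>sphere 0 1. u i z = Re (poly (p i) z)"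
    by metis
  then show ?thesis
    by (intro exI[of _ "\<Sum>i\<in>I. p i"]) (auto simp: poly_sum)
qed

text \<open>Since Re x Re y = Re ((x y + x cnj y) / 2) and cnj z = 1 / z on the unit circle, the
  conjugated lower power merely lowers the exponent of the higher one.\<close>

lemma Re_poly_circle_monom_mult:
  "\<exists>p. \<forall>z\<in>sphere 0 1. Re (a * z ^ k) * Re (b * z ^ j) = Re (poly p z)"
proof -
  have *: "\<exists>p. \<forall>z\<in>sphere 0 1. Re (a * z ^ k) * Re (b * z ^ j) = Re (poly p z)"
    if "j \<le> k" for a b :: complex and j k
  proof (intro exI ballI)
    fix z :: complex assume "z \<in> sphere 0 1"
    then have "z * cnj z = 1"
      by (simp add: complex_norm_square[symmetric])
    have "z ^ k * cnj (z ^ j) = z ^ (k - j) * (z * cnj z) ^ j"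
      using that by (simp add: power_mult_distrib mult.assoc[symmetric] flip: power_add)
    with \<open>z * cnj z = 1\<close> have z: "z ^ k * cnj (z ^ j) = z ^ (k - j)" by simp
    have "Re x * Re y = Re ((x * y + x * cnj y) / 2)" for x y
      by (simp add: field_simps)
    also have "(a * z ^ k * (b * z ^ j) + a * z ^ k * cnj (b * z ^ j)) / 2 =
        (a * b / 2) * z ^ (k + j) + (a * cnj b / 2) * (z ^ k * cnj (z ^ j))"
      by (simp add: field_simps power_add)
    finally show "Re (a * z ^ k) * Re (b * z ^ j) =
        Re (poly (monom (a * b / 2) (k + j) + monom (a * cnj b / 2) (k - j)) z)"
      by (simp only: z poly_add poly_monom)
  qed
  show ?thesis
    using *[of j k a b] *[of k j b a] by (cases "j \<le> k") (auto simp: mult.commute)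
qed

text \<open>Links Stone-Weierstrass with harmonic functions: a real polynomial in two variables need
  not be harmonic, but on the circle it agrees with the real part of a complex polynomial, which is
  harmonic in the disc.\<close>

lemma real_polynomial_function_on_circle:
  assumes "real_polynomial_function (g :: complex \<Rightarrow> real)"
  shows "\<exists>p. \<forall>z\<in>sphere 0 1. g z = Re (poly p z)"
  using assms
proof induction
  case (linear f)
  then interpret bounded_linear f .
  \<comment> \<open>The real-linear functional f(1) Re z + f(i) Im z is the real part of (f(1) - i
    f(i)) z.\<close>
  have "f z = Re (poly [:0, Complex (f 1) (- f \<i>):] z)" for z
  proof -
    have "z = Re z *\<^sub>R 1 + Im z *\<^sub>R \<i>"
      by (simp add: complex_eq_iff)
    then have "f z = Re z * f 1 + Im z * f \<i>"
      by (metis add scaleR real_scaleR_def)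
    then show ?thesis by simp
  qed
  then show ?case by blast
next
  case (const c)
  show ?case by (intro exI[of _ "[:of_real c:]"]) simp
next
  case (add f g)
  then obtain p q where "\<forall>z\<in>sphere 0 1. f z = Re (poly p z)" "\<forall>z\<in>sphere 0 1. g z = Re (poly q z)"
    by blast
  then show ?case by (intro exI[of _ "p + q"]) simp
next
  case (mult f g)
  then obtain p q where pq: "\<forall>z\<in>sphere 0 1. f z = Re (poly p z)" "\<forall>z\<in>sphere 0 1. g z = Re (poly q z)"
    by blast
  have "\<exists>s. \<forall>z\<in>sphere 0 1. (\<Sum>i\<le>degree p. \<Sum>j\<le>degree q.
      Re (coeff p i * z ^ i) * Re (coeff q j * z ^ j)) = Re (poly s z)"
    by (intro Re_poly_circle_sum Re_poly_circle_monom_mult)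
  then show ?case
    using pq by (simp add: poly_altdef sum_product)
qed

text \<open>Instead of integrating a Poisson kernel, the boundary function is approximated uniformly
  by real parts of polynomials. The maximum principle carries the Cauchy estimate from the circle to
  the closed disc, and \<open>harmonic_limit\<close> makes the limit harmonic inside.\<close>

lemma dirichlet_unit_disc:
  fixes \<phi> :: "complex \<Rightarrow> real"
  assumes "continuous_on (sphere 0 1) \<phi>"
  obtains h f where "continuous_on (cball 0 1) h" "\<And>z. z \<in> sphere 0 1 \<Longrightarrow> h z = \<phi> z"
    "f holomorphic_on ball 0 1" "\<And>z. z \<in> ball 0 1 \<Longrightarrow> h z = Re (f z)"
proof -
  have "\<exists>p. \<forall>z\<in>sphere 0 1. \<bar>\<phi> z - Re (poly p z)\<bar> < inverse (real (Suc n))" for n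
  proof -
    obtain g where g: "real_polynomial_function g" "\<And>x. x \<in> sphere 0 1 \<Longrightarrow> \<bar>\<phi> x - g x\<bar> < inverse (real (Suc n))"
      using Stone_Weierstrass_real_polynomial_function[OF compact_sphere assms, of "inverse (real (Suc n))"] by auto
    obtain p where "\<forall>z\<in>sphere 0 1. g z = Re (poly p z)"
      using real_polynomial_function_on_circle[OF g(1)] by blast
    with g show ?thesis by (metis (no_types))
  qed
  then obtain p where p: "\<And>n z. z \<in> sphere 0 1 \<Longrightarrow> \<bar>\<phi> z - Re (poly (p n) z)\<bar> < inverse (real (Suc n))"
    by metis
  define u where "u n z = Re (poly (p n) z)" for n z
  have harm: "harmonic_in (u n) (ball 0 1)" for n
    unfolding u_def by (rule harmonic_in_Re) (auto intro: holomorphic_intros)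
  have cont: "continuous_on X (u n)" for n X
    unfolding u_def by (intro continuous_intros)
  have max: "v z \<le> B" if "harmonic_in v (ball 0 1)" "continuous_on (cball 0 1) v"
    "\<And>z. z \<in> sphere 0 1 \<Longrightarrow> v z \<le> B" "z \<in> cball 0 1" for v B and z :: complex
  proof (cases "z \<in> ball 0 1")
    case True
    show ?thesis
      by (rule harmonic_maximum_frontier[OF _ that(1) _ _ True])
         (use that in \<open>auto simp: frontier_def\<close>)
  qed (use that in auto)
  have cauchy: "\<bar>u m z - u n z\<bar> \<le> inverse (real (Suc m)) + inverse (real (Suc n))"
    if "z \<in> cball 0 1" for m n z
  proof -
    have "u m z - u n z \<le> inverse (real (Suc m)) + inverse (real (Suc n))"
      if "z \<in> cball 0 1" for m n z
    proof (rule max[OF _ _ _ that])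
      show "harmonic_in (\<lambda>z. u m z - u n z) (ball 0 1)" by (intro harmonic_in_diff harm)
      show "continuous_on (cball 0 1) (\<lambda>z. u m z - u n z)" by (intro continuous_intros cont)
      show "u m z - u n z \<le> inverse (real (Suc m)) + inverse (real (Suc n))" if "z \<in> sphere 0 1" for z
        using p[OF that, of m] p[OF that, of n] unfolding u_def by linarith
    qed
    from this[OF that, of m n] this[OF that, of n m] show ?thesis by linarith
  qed
  have "uniformly_Cauchy_on (cball 0 1) u"
  proof (rule uniformly_Cauchy_onI)
    fix e :: real assume "e > 0"
    then obtain N where N: "inverse (real (Suc N)) < e / 2"
      using reals_Archimedean[of "e/2"] by auto
    have "dist (u m z) (u n z) < e" if "z \<in> cball 0 1" "m \<ge> N" "n \<ge> N" for m n z
    proof -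
      have *: "inverse (real (Suc m)) \<le> inverse (real (Suc N))" "inverse (real (Suc n)) \<le> inverse (real (Suc N))"
        using that by (auto intro!: le_imp_inverse_le)
      show ?thesis
        unfolding dist_real_def using cauchy[OF that(1), of m n] N * by linarith
    qed
    then show "\<exists>M. \<forall>x\<in>cball 0 1. \<forall>m\<ge>M. \<forall>n\<ge>M. dist (u m x) (u n x) < e" by blast
  qed
  then obtain h where h: "uniform_limit (cball 0 1) u h sequentially"
    using Cauchy_uniformly_convergent uniformly_convergent_on_def by blast
  have conth: "continuous_on (cball 0 1) h"
    by (rule uniform_limit_theorem[OF _ h]) (auto simp: cont)
  have lim: "(\<lambda>n. u n z) \<longlonglongrightarrow> h z" if "z \<in> cball 0 1" for z
    using tendsto_uniform_limitI[OF h that] .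
  have bd: "h z = \<phi> z" if "z \<in> sphere 0 1" for z
  proof (rule LIMSEQ_unique)
    show "(\<lambda>n. u n z) \<longlonglongrightarrow> h z" using lim that by auto
    have "(\<lambda>n. u n z - \<phi> z) \<longlonglongrightarrow> 0"
      by (rule Lim_null_comparison[OF _ LIMSEQ_inverse_real_of_nat])
         (use p[OF that] in \<open>auto simp: u_def abs_minus_commute intro!: always_eventually less_imp_le\<close>)
    then show "(\<lambda>n. u n z) \<longlonglongrightarrow> \<phi> z" by (rule LIM_zero_cancel)
  qed
  \<comment> \<open>Comparison with index 0 gives a bound independent of \<open>n\<close>; each of
    the two error terms is at most 1.\<close>
  have u2: "\<bar>u n z\<bar> \<le> \<bar>u 0 z\<bar> + 2" if "z \<in> cball 0 1" for n z
  proof -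
    have "inverse (real (Suc n)) \<le> 1" by (simp add: inverse_le_1_iff)
    with cauchy[OF that, of n 0] show ?thesis by simp
  qed
  obtain C where C0: "\<And>z. z \<in> cball 0 1 \<Longrightarrow> \<bar>u 0 z\<bar> \<le> C"
    using compact_imp_bounded[OF compact_continuous_image[OF cont compact_cball[of 0 1], of 0]]
    unfolding bounded_iff by (metis imageI real_norm_def)
  have C: "\<bar>u n z\<bar> \<le> C + 2" if "z \<in> cball 0 1" for n z
    using u2[OF that, of n] C0[OF that] by simp
  have "\<exists>g. g holomorphic_on ball 0 1 \<and> (\<forall>z\<in>ball 0 1. h z = Re (g z))"
  proof (rule harmonic_limit[of "\<lambda>n. poly (p n)" 0 1 "C + 2"])
    show "poly (p k) holomorphic_on ball 0 1" for k
      by (intro holomorphic_intros)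
  qed (use C lim in \<open>auto simp: u_def\<close>)
  with conth bd show thesis using that by blast
qed

lemma dirichlet_disc:
  fixes \<phi> :: "complex \<Rightarrow> real"
  assumes "r > 0" "continuous_on (sphere p r) \<phi>"
  obtains h f where "continuous_on (cball p r) h" "\<And>z. z \<in> sphere p r \<Longrightarrow> h z = \<phi> z"
    "f holomorphic_on ball p r" "\<And>z. z \<in> ball p r \<Longrightarrow> h z = Re (f z)"
proof -
  define A where "A z = p + of_real r * z" for z
  define A' where "A' z = (z - p) / of_real r" for z
  have A': "A (A' z) = z" for z using \<open>r > 0\<close> by (simp add: A_def A'_def)
  have norm_A': "cmod (A' z) = dist p z / r" for z
    using \<open>r > 0\<close> by (simp add: A'_def norm_divide dist_norm norm_minus_commute)
  have "continuous_on (sphere 0 1) (\<lambda>z. \<phi> (A z))"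
  proof (rule continuous_on_compose2[OF assms(2)])
    show "A ` sphere 0 1 \<subseteq> sphere p r"
      using \<open>r > 0\<close> by (auto simp: A_def dist_norm norm_mult)
  qed (auto simp: A_def[abs_def] intro!: continuous_intros)
  then obtain h f where hf: "continuous_on (cball 0 1) h" "\<And>z. z \<in> sphere 0 1 \<Longrightarrow> h z = \<phi> (A z)"
    "f holomorphic_on ball 0 1" "\<And>z. z \<in> ball 0 1 \<Longrightarrow> h z = Re (f z)"
    by (rule dirichlet_unit_disc) blast
  show thesis
  proof (rule that[of "\<lambda>z. h (A' z)" "\<lambda>z. f (A' z)"])
    show "continuous_on (cball p r) (\<lambda>z. h (A' z))"
      by (rule continuous_on_compose2[OF hf(1)])
         (use \<open>r > 0\<close> in \<open>auto simp: A'_def[abs_def] norm_divide dist_norm norm_minus_commute intro!: continuous_intros\<close>)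
    have "(f \<circ> A') holomorphic_on ball p r"
      by (rule holomorphic_on_compose_gen[OF _ hf(3)])
         (use \<open>r > 0\<close> in \<open>auto simp: A'_def[abs_def] norm_divide dist_norm norm_minus_commute intro!: holomorphic_intros\<close>)
    then show "(\<lambda>z. f (A' z)) holomorphic_on ball p r" by (simp add: o_def)
    show "h (A' z) = \<phi> z" if "z \<in> sphere p r" for z
      using hf(2)[of "A' z"] that \<open>r > 0\<close> by (simp add: A' norm_A')
    show "h (A' z) = Re (f (A' z))" if "z \<in> ball p r" for z
      using hf(4)[of "A' z"] that \<open>r > 0\<close> by (simp add: norm_A')
  qed
qed

section \<open>Existence of Green functions in the plane\<close>

text \<open>Comparison with harmonic functions on discs replaces the submean inequality, so no
  integral occurs. Continuity is included so that \<open>s\<close> itself can serve as boundary data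
  of a Dirichlet problem.\<close>

definition subharmonic_in :: "(complex \<Rightarrow> real) \<Rightarrow> complex set \<Rightarrow> bool" where
  "subharmonic_in s U \<longleftrightarrow> continuous_on U s \<and>
     (\<forall>p r h. cball p r \<subseteq> U \<longrightarrow> continuous_on (cball p r) h \<longrightarrow> harmonic_in h (ball p r) \<longrightarrow>
        (\<forall>z\<in>sphere p r. s z \<le> h z) \<longrightarrow> (\<forall>z\<in>ball p r. s z \<le> h z))"

lemma subharmonic_inD:
  assumes "subharmonic_in s U" "cball p r \<subseteq> U" "continuous_on (cball p r) h" "harmonic_in h (ball p r)"
    and "\<And>z. z \<in> sphere p r \<Longrightarrow> s z \<le> h z" and "z \<in> ball p r"
  shows "s z \<le> h z"
  using assms unfolding subharmonic_in_def by blast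

text \<open>One sweeping step: on the disc \<open>s\<close> is replaced by the harmonic function
  with the same values on the circle. The substance is that the result is subharmonic on discs that
  overlap the modified one only partly.\<close>

lemma poisson_modification:
  assumes s: "subharmonic_in s U" and r: "r > 0" "cball p r \<subseteq> U"
  obtains s' f where "subharmonic_in s' U" "\<And>z. z \<in> U \<Longrightarrow> s z \<le> s' z"
    "\<And>z. z \<notin> ball p r \<Longrightarrow> s' z = s z" "f holomorphic_on ball p r"
    "\<And>z. z \<in> ball p r \<Longrightarrow> s' z = Re (f z)"
proof -
  have conts: "continuous_on U s" using s by (simp add: subharmonic_in_def)
  have "continuous_on (sphere p r) s"
    by (rule continuous_on_subset[OF conts]) (use r(2) sphere_cball in blast)
  then obtain h f where h: "continuous_on (cball p r) h" "\<And>z. z \<in> sphere p r \<Longrightarrow> h z = s z"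
    "f holomorphic_on ball p r" "\<And>z. z \<in> ball p r \<Longrightarrow> h z = Re (f z)"
    using dirichlet_disc[OF r(1)] by blast
  have harm: "harmonic_in h (ball p r)"
    by (rule harmonic_in_cong[OF harmonic_in_Re[OF open_ball h(3)]]) (rule h(4))
  define s' where "s' z = (if z \<in> cball p r then h z else s z)" for z
  have s'_h: "s' z = h z" if "z \<in> cball p r" for z
    using that by (simp add: s'_def)
  have s'_s: "s' z = s z" if "z \<notin> ball p r" for z
    using that h(2)[of z] by (auto simp: s'_def)
  have le: "s z \<le> s' z" for z
  proof (cases "z \<in> ball p r")
    case True
    have "s z \<le> h z"
      by (rule subharmonic_inD[OF s r(2) h(1) harm _ True]) (simp add: h(2))
    then show ?thesis using True by (simp add: s'_def)
  qed (simp add: s'_s)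
  have U: "U = cball p r \<union> (U - ball p r)"
    using r(2) ball_subset_cball by blast
  have "continuous_on (cball p r \<union> (U - ball p r)) s'"
    unfolding s'_def
  proof (rule continuous_on_cases_local)
    show "closedin (top_of_set (cball p r \<union> (U - ball p r))) (cball p r)"
      by (rule closed_subset) auto
    have "closedin (top_of_set U) (U - ball p r)"
      using closedin_closed_Int[of "- ball p r" U] by (simp add: Diff_eq closed_Compl)
    then show "closedin (top_of_set (cball p r \<union> (U - ball p r))) (U - ball p r)"
      using U by metis
    show "continuous_on (U - ball p r) s" using continuous_on_subset[OF conts] by auto
    show "h z = s z" if "z \<in> cball p r \<and> z \<notin> cball p r \<or> z \<in> U - ball p r \<and> z \<in> cball p r" for z
      using that by (intro h) auto
  qed (rule h)
  then have cont': "continuous_on U s'" using U by metis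
  have "subharmonic_in s' U"
    unfolding subharmonic_in_def
  proof (intro conjI allI impI ballI cont')
    fix p' r' g z
    assume g: "cball p' r' \<subseteq> U" "continuous_on (cball p' r') g" "harmonic_in g (ball p' r')"
      "\<forall>z\<in>sphere p' r'. s' z \<le> g z" and z: "z \<in> ball p' r'"
    \<comment> \<open>As \<open>s <= s'\<close>, the assumption on the test circle applies to
      \<open>s\<close>, whose subharmonicity is already known.\<close>
    have sg: "s w \<le> g w" if "w \<in> ball p' r'" for w
      by (rule subharmonic_inD[OF s g(1-3) _ that]) (use g(4) le order_trans in blast)
    show "s' z \<le> g z"
    proof (cases "z \<in> ball p r")
      case True
      \<comment> \<open>A frontier point of this lens lies either on the test circle, where the
        assumption applies, or on the modified circle inside the test disc, where
        \<open>h = s <= g\<close> by \<open>sg\<close>.\<close>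
      define V where "V = ball p r \<inter> ball p' r'"
      have clV: "closure V \<subseteq> cball p r \<inter> cball p' r'"
        unfolding V_def by (intro closure_minimal closed_Int closed_cball) auto
      have "h z - g z \<le> 0"
      proof (rule harmonic_maximum_frontier)
        show "bounded V" unfolding V_def by auto
        show "harmonic_in (\<lambda>z. h z - g z) V"
          by (intro harmonic_in_diff harmonic_in_subset[OF harm] harmonic_in_subset[OF g(3)])
             (auto simp: V_def)
        show "continuous_on (closure V) (\<lambda>z. h z - g z)"
          by (intro continuous_intros continuous_on_subset[OF h(1)] continuous_on_subset[OF g(2)])
             (use clV in auto)
        show "z \<in> V" using True z by (simp add: V_def)
        fix w assume w: "w \<in> frontier V"
        then have "w \<in> cball p r" "w \<in> cball p' r'" "w \<notin> V"
          using clV by (auto simp: frontier_def V_def interior_open)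
        then consider "w \<in> sphere p' r'" | "w \<in> ball p' r'" "w \<in> sphere p r"
          by (fastforce simp: V_def)
        then show "h w - g w \<le> 0"
        proof cases
          case 1
          then show ?thesis using g(4) s'_h[OF \<open>w \<in> cball p r\<close>] by force
        next
          case 2
          then show ?thesis using sg[of w] h(2)[of w] by simp
        qed
      qed
      then show ?thesis using s'_h[of z] True by simp
    next
      case False
      then show ?thesis using sg[OF z] s'_s by simp
    qed
  qed
  then show thesis
    using that[OF _ _ _ h(3)] le s'_s s'_h h(4) by simp
qed

lemma ln_le_iff_exp:
  fixes x y :: real
  assumes "x > 0"
  shows "ln x \<le> y \<longleftrightarrow> x \<le> exp y"
  by (metis assms exp_le_cancel_iff exp_ln)

text \<open>The constant and the logarithm are compared with \<open>h\<close> separately. For the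
  logarithm the comparison is made with \<open>|z - c| * exp (- h)\<close>, so that \<open>c\<close>
  may lie in the disc.\<close>

lemma subharmonic_in_ln_max:
  assumes "R > 0"
  shows "subharmonic_in (\<lambda>z. ln (max (cmod (z - c)) R)) U"
  unfolding subharmonic_in_def
proof (intro conjI allI impI ballI)
  show "continuous_on U (\<lambda>z. ln (max (cmod (z - c)) R))"
  proof (intro continuous_intros ballI)
    fix z
    have "max (cmod (z - c)) R > 0" using assms by simp
    then show "max (cmod (z - c)) R \<noteq> 0" by simp
  qed
  fix p r h z
  assume h: "continuous_on (cball p r) h" "harmonic_in h (ball p r)"
    "\<forall>z\<in>sphere p r. ln (max (cmod (z - c)) R) \<le> h z" and z: "z \<in> ball p r"
  have "r > 0" using le_less_trans[OF zero_le_dist, of p z r] z by simp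
  then have fr: "frontier (ball p r) = sphere p r" and cl: "closure (ball p r) = cball p r"
    by simp_all
  have h': "max (cmod (w - c)) R \<le> exp (h w)" if "w \<in> sphere p r" for w
    using h(3) that assms by (metis exp_le_cancel_iff exp_ln less_max_iff_disj)
  have "ln R - h z \<le> 0"
  proof (rule harmonic_maximum_frontier[OF bounded_ball _ _ _ z])
    show "harmonic_in (\<lambda>z. ln R - h z) (ball p r)"
      by (intro harmonic_in_diff harmonic_in_const h open_ball)
    show "continuous_on (closure (ball p r)) (\<lambda>z. ln R - h z)"
      unfolding cl by (intro continuous_intros h)
    show "ln R - h w \<le> 0" if "w \<in> frontier (ball p r)" for w
      using h'[of w] that assms unfolding fr by (simp add: ln_le_iff_exp)
  qed
  then have 1: "R \<le> exp (h z)" using assms by (simp add: ln_le_iff_exp)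
  have "cmod (z - c) * exp (- h z) \<le> 1"
  proof (rule maximum_principle_frontier[OF bounded_ball _ _ _ z])
    show "continuous_on (closure (ball p r)) (\<lambda>z. cmod (z - c) * exp (- h z))"
      unfolding cl by (intro continuous_intros h)
    show "cmod (w - c) * exp (- h w) \<le> 1" if "w \<in> frontier (ball p r)" for w
      using h'[of w] that unfolding fr by (simp add: exp_minus field_simps)
    fix w assume "w \<in> ball p r"
    then obtain \<rho> f where f: "\<rho> > 0" "ball w \<rho> \<subseteq> ball p r" "f holomorphic_on ball w \<rho>"
        "\<forall>z\<in>ball w \<rho>. h z = Re (f z)"
      using h(2) unfolding harmonic_in_def by blast
    then show "\<exists>\<rho>>0. ball w \<rho> \<subseteq> ball p r \<and> (\<exists>f. f holomorphic_on ball w \<rho> \<and>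
        (\<forall>z\<in>ball w \<rho>. cmod (z - c) * exp (- h z) = cmod (f z)))"
      by (intro exI[of _ \<rho>] conjI exI[of _ "\<lambda>z. (z - c) * exp (- f z)"] holomorphic_intros)
         (auto simp: norm_mult)
  qed
  then have "cmod (z - c) \<le> exp (h z)" by (simp add: exp_minus field_simps)
  with 1 have "max (cmod (z - c)) R \<le> exp (h z)" by simp
  moreover have "max (cmod (z - c)) R > 0" using assms by simp
  ultimately show "ln (max (cmod (z - c)) R) \<le> h z" by (simp add: ln_le_iff_exp)
qed

text \<open>Starting from the subharmonic minorant \<open>ln (max |z - c| R)\<close>, sweep successively over a countable
  family of discs, each visited infinitely often.  The maximum modulus principle for \<open>b \<cdot> exp f\<close> keeps
  \<open>- ln |b|\<close> a majorant throughout, also across the zeros of \<open>b\<close>.\<close>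

theorem green_function_planar:
  fixes b :: "complex \<Rightarrow> complex"
  assumes U: "open U" and b: "b holomorphic_on U" and c: "c \<in> U"
    and bd: "\<And>z. z \<in> U \<Longrightarrow> cmod (b z) * cmod (z - c) \<le> 1"
    and fin0: "finite {z \<in> U. b z = 0}"
  obtains s where "harmonic_in s U" "\<And>z. z \<in> U \<Longrightarrow> z \<noteq> c \<Longrightarrow> ln (cmod (z - c)) \<le> s z"
    "\<And>z. z \<in> U \<Longrightarrow> cmod (b z) * exp (s z) \<le> 1"
proof -
  obtain R where R: "R > 0" "cball c R \<subseteq> U"
    using U c open_contains_cball by blast
  \<comment> \<open>Truncation at \<open>R\<close> keeps the minorant finite at \<open>c\<close>;
    outside \<open>ball c R\<close> it is \<open>ln |z - c|\<close>.\<close>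
  define s0 where "s0 z = ln (max (cmod (z - c)) R)" for z
  define P where "P s \<longleftrightarrow> subharmonic_in s U \<and> (\<forall>z\<in>U. s0 z \<le> s z) \<and> (\<forall>z\<in>U. cmod (b z) * exp (s z) \<le> 1)" for s
  have contb: "continuous_on U b" using b by (rule holomorphic_on_imp_continuous_on)
  have "P s0"
    unfolding P_def
  proof (intro conjI ballI)
    show "subharmonic_in s0 U" unfolding s0_def using R(1) by (rule subharmonic_in_ln_max)
    fix z assume z: "z \<in> U"
    \<comment> \<open>On the circle \<open>|z - c| = R\<close> the hypothesis \<open>bd\<close>
      reads \<open>|b| <= 1 / R\<close>; maximum modulus extends this to the disc, where
      \<open>exp s0\<close> equals \<open>R\<close>.\<close>
    have "cmod (b z) \<le> 1 / R" if "z \<in> ball c R"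
    proof (rule maximum_modulus_frontier[of b "ball c R"])
      show "b holomorphic_on interior (ball c R)"
        using R(2) by (intro holomorphic_on_subset[OF b]) auto
      show "continuous_on (closure (ball c R)) b"
        using R by (intro continuous_on_subset[OF contb]) auto
      show "cmod (b w) \<le> 1 / R" if "w \<in> frontier (ball c R)" for w
        using bd[of w] that R by (auto simp: frontier_def dist_norm norm_minus_commute field_simps)
    qed (use that in auto)
    moreover have "exp (s0 z) = max (cmod (z - c)) R" using R(1) by (simp add: s0_def)
    ultimately show "cmod (b z) * exp (s0 z) \<le> 1"
    proof (cases "z \<in> ball c R")
      case True
      then have "exp (s0 z) = R"
        using \<open>exp (s0 z) = _\<close> by (simp add: dist_norm norm_minus_commute)
      moreover have "cmod (b z) \<le> 1 / R" using True by fact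
      ultimately show ?thesis using R(1) by (simp add: field_simps)
    next
      case False
      then have "exp (s0 z) = cmod (z - c)"
        using \<open>exp (s0 z) = _\<close> by (simp add: dist_norm norm_minus_commute)
      then show ?thesis using bd[OF z] by simp
    qed
  qed simp
  \<comment> \<open>The circles are to avoid the finitely many zeros of \<open>b\<close>, so that
    \<open>- ln |b|\<close> is a finite upper bound on them even if the disc contains a
    zero.\<close>
  have "\<exists>\<rho>>0. cball p \<rho> \<subseteq> U \<and> (\<forall>z\<in>sphere p \<rho>. b z \<noteq> 0)" if "p \<in> U" for p
  proof -
    obtain d where d: "d > 0" "\<And>x. x \<in> {z \<in> U. b z = 0} \<Longrightarrow> x \<noteq> p \<Longrightarrow> d \<le> dist p x"
      using finite_set_avoid[OF fin0, of p] by blast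
    obtain e where e: "e > 0" "cball p e \<subseteq> U"
      using U \<open>p \<in> U\<close> open_contains_cball by blast
    define \<rho> where "\<rho> = min e (d / 2)"
    have "0 < \<rho>" "\<rho> \<le> e" "\<rho> < d" using d(1) e(1) by (auto simp: \<rho>_def)
    moreover have "cball p \<rho> \<subseteq> U" using e(2) \<open>\<rho> \<le> e\<close> by (auto simp: subset_iff)
    ultimately show ?thesis
      using d(2) by (intro exI[of _ \<rho>]) (force simp: subset_iff)
  qed
  then obtain \<rho> where \<rho>: "\<And>p. p \<in> U \<Longrightarrow> \<rho> p > 0" "\<And>p. p \<in> U \<Longrightarrow> cball p (\<rho> p) \<subseteq> U"
      "\<And>p z. p \<in> U \<Longrightarrow> z \<in> sphere p (\<rho> p) \<Longrightarrow> b z \<noteq> 0"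
    by metis
  obtain \<F> where \<F>: "\<F> \<subseteq> (\<lambda>p. ball p (\<rho> p)) ` U" "countable \<F>" "\<Union>\<F> = (\<Union>p\<in>U. ball p (\<rho> p))"
  proof (rule Lindelof[of "(\<lambda>p. ball p (\<rho> p)) ` U"])
    show "open S" if "S \<in> (\<lambda>p. ball p (\<rho> p)) ` U" for S
      using that by auto
  qed (rule that)
  obtain C where C: "C \<subseteq> U" "countable C" "\<F> = (\<lambda>p. ball p (\<rho> p)) ` C"
    using iffD1[OF countable_subset_image, OF conjI[OF \<F>(2,1)]] by (elim exE conjE)
  have cover: "U \<subseteq> (\<Union>p\<in>C. ball p (\<rho> p))"
  proof
    fix p assume "p \<in> U"
    then have "p \<in> \<Union>\<F>" unfolding \<F>(3) using \<rho>(1) by (intro UN_I[of p]) auto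
    then show "p \<in> (\<Union>p\<in>C. ball p (\<rho> p))" unfolding C(3) .
  qed
  then have "C \<noteq> {}" using c by auto
  \<comment> \<open>Decoding pairs makes the \<open>n\<close>-th centre occur at every index
    \<open>prod_encode (n, j)\<close>.\<close>
  define Q where "Q n = from_nat_into C (fst (prod_decode n))" for n
  have Q: "Q n \<in> U" for n
    using C(1) from_nat_into[OF \<open>C \<noteq> {}\<close>] by (auto simp: Q_def)
  have "\<exists>s. \<forall>n. P (s n) \<and> ((\<forall>z\<in>U. s n z \<le> s (Suc n) z) \<and>
      (\<exists>f. f holomorphic_on ball (Q n) (\<rho> (Q n)) \<and> (\<forall>z\<in>ball (Q n) (\<rho> (Q n)). s (Suc n) z = Re (f z))))"
  proof (rule dependent_nat_choice)
    fix s n assume s: "P s"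
    let ?B = "ball (Q n) (\<rho> (Q n))"
    have sub: "subharmonic_in s U" using s by (simp add: P_def)
    obtain s' f where s': "subharmonic_in s' U" "\<And>z. z \<in> U \<Longrightarrow> s z \<le> s' z"
      "\<And>z. z \<notin> ?B \<Longrightarrow> s' z = s z" and f: "f holomorphic_on ?B" "\<And>z. z \<in> ?B \<Longrightarrow> s' z = Re (f z)"
      by (rule poisson_modification[OF sub \<rho>(1)[OF Q] \<rho>(2)[OF Q]]) blast
    have "cmod (b z) * exp (s' z) \<le> 1" if "z \<in> U" for z
    proof (cases "z \<in> ?B")
      case True
      show ?thesis
      proof (rule maximum_principle_frontier[OF bounded_ball _ _ _ True])
        have "continuous_on (cball (Q n) (\<rho> (Q n))) s'"
          using s'(1) unfolding subharmonic_in_def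
          by (intro continuous_on_subset[OF _ \<rho>(2)[OF Q]]) (elim conjE)
        then show "continuous_on (closure ?B) (\<lambda>z. cmod (b z) * exp (s' z))"
          using \<rho>[OF Q]
          by (auto intro!: continuous_intros continuous_on_subset[OF contb])
        show "cmod (b w) * exp (s' w) \<le> 1" if "w \<in> frontier ?B" for w
        proof -
          have "w \<in> sphere (Q n) (\<rho> (Q n))" using that \<rho>(1)[OF Q, of n] by simp
          then have "w \<notin> ?B" "w \<in> U" using \<rho>(2)[OF Q, of n] by auto
          then show ?thesis using s'(3)[of w] s by (simp add: P_def)
        qed
        fix w assume w: "w \<in> ?B"
        obtain e where e: "e > 0" "ball w e \<subseteq> ?B"
          using openE[OF open_ball w] by blast
        have eU: "ball w e \<subseteq> U"
          using e(2) \<rho>(2)[OF Q, of n] ball_subset_cball[of "Q n" "\<rho> (Q n)"] by blast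
        have s'f: "s' z = Re (f z)" if "z \<in> ball w e" for z
          using f(2) e(2) that by blast
        show "\<exists>r>0. ball w r \<subseteq> ?B \<and> (\<exists>f. f holomorphic_on ball w r \<and>
            (\<forall>z\<in>ball w r. cmod (b z) * exp (s' z) = cmod (f z)))"
          using e(1,2) s'f
          by (intro exI[of _ e] conjI exI[of _ "\<lambda>z. b z * exp (f z)"] holomorphic_intros
                holomorphic_on_subset[OF b eU] holomorphic_on_subset[OF f(1) e(2)])
             (simp_all add: norm_mult)
      qed
    next
      case False
      then show ?thesis using s'(3) s that by (simp add: P_def)
    qed
    with s s'(1,2) have "P s'" unfolding P_def by (meson order_trans)
    with s'(2) f show "\<exists>s'. P s' \<and> (\<forall>z\<in>U. s z \<le> s' z) \<and>
        (\<exists>f. f holomorphic_on ?B \<and> (\<forall>z\<in>?B. s' z = Re (f z)))"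
      by blast
  qed (use \<open>P s0\<close> in blast)
  then obtain s where s: "\<And>n. P (s n)" "\<And>n z. z \<in> U \<Longrightarrow> s n z \<le> s (Suc n) z"
    "\<And>n. \<exists>f. f holomorphic_on ball (Q n) (\<rho> (Q n)) \<and> (\<forall>z\<in>ball (Q n) (\<rho> (Q n)). s (Suc n) z = Re (f z))"
    by metis
  \<comment> \<open>The minimum of \<open>|b|\<close> on the zero-free circle bounds all iterates
    there, and subharmonicity carries this bound into the disc.\<close>
  have upper: "\<exists>M. \<forall>k. \<forall>z\<in>ball p (\<rho> p). s k z \<le> M" if p: "p \<in> U" for p
  proof -
    have "sphere p (\<rho> p) \<noteq> {}" using \<rho>(1)[OF p] by simp
    moreover have "continuous_on (sphere p (\<rho> p)) (\<lambda>z. cmod (b z))"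
      using \<rho>(2)[OF p] by (intro continuous_intros continuous_on_subset[OF contb]) auto
    ultimately obtain w where w: "w \<in> sphere p (\<rho> p)" "\<And>z. z \<in> sphere p (\<rho> p) \<Longrightarrow> cmod (b w) \<le> cmod (b z)"
      using continuous_attains_inf[OF compact_sphere] by blast
    have bw: "cmod (b w) > 0" using \<rho>(3)[OF p w(1)] by simp
    have "s k z \<le> - ln (cmod (b w))" if "z \<in> ball p (\<rho> p)" for k z
    proof (rule subharmonic_inD[OF _ \<rho>(2)[OF p] _ _ _ that])
      show "subharmonic_in (s k) U" using s(1) by (simp add: P_def)
      show "s k x \<le> - ln (cmod (b w))" if x: "x \<in> sphere p (\<rho> p)" for x
      proof -
        have "x \<in> U" using x \<rho>(2)[OF p] by auto
        have "cmod (b w) * exp (s k x) \<le> cmod (b x) * exp (s k x)"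
          using w(2)[OF x] by (intro mult_right_mono) auto
        also have "\<dots> \<le> 1" using s(1) \<open>x \<in> U\<close> by (simp add: P_def)
        finally have "exp (s k x) \<le> exp (- ln (cmod (b w)))"
          using bw by (simp add: exp_minus field_simps)
        then show ?thesis by simp
      qed
    qed (auto intro: harmonic_in_const)
    then show ?thesis by blast
  qed
  define S where "S z = lim (\<lambda>k. s k z)" for z
  have incr: "incseq (\<lambda>k. s k z)" if "z \<in> U" for z
    using s(2)[OF that] by (rule incseq_SucI)
  have lim: "(\<lambda>k. s k z) \<longlonglongrightarrow> S z" if z: "z \<in> U" for z
  proof -
    obtain M where "\<And>k. s k z \<le> M"
      using upper[OF z] \<rho>(1)[OF z] by (metis centre_in_ball)
    then obtain L where "(\<lambda>k. s k z) \<longlonglongrightarrow> L"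
      using incseq_convergent[OF incr[OF z]] by blast
    then show ?thesis unfolding S_def by (simp add: limI)
  qed
  have s0: "ln R \<le> s k z" if "z \<in> U" for k z
  proof -
    have "ln R \<le> s0 z" unfolding s0_def using R(1) by simp
    also have "\<dots> \<le> s k z" using s(1) that by (simp add: P_def)
    finally show ?thesis .
  qed
  show thesis
  proof (rule that[of S])
    show "harmonic_in S U"
    proof (rule harmonic_in_local[OF U])
      fix z assume "z \<in> U"
      then obtain p where p: "p \<in> C" "z \<in> ball p (\<rho> p)" using cover by auto
      have pU: "p \<in> U" using p C by auto
      have BU: "ball p (\<rho> p) \<subseteq> U" using \<rho>(2)[OF pU] by auto
      obtain n where n: "from_nat_into C n = p"
        using from_nat_into_surj[OF C(2) p(1)] by blast
      \<comment> \<open>Right after each visit to this disc the iterate is harmonic on it. Along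
        these indices the sequence has the same limit and consists of real parts of holomorphic
        functions, as \<open>harmonic_limit\<close> demands.\<close>
      define k where "k j = prod_encode (n, j)" for j
      have Qk: "Q (k j) = p" for j by (simp add: Q_def k_def n)
      obtain f where f: "\<And>j. f j holomorphic_on ball p (\<rho> p)"
          "\<And>j w. w \<in> ball p (\<rho> p) \<Longrightarrow> s (Suc (k j)) w = Re (f j w)"
        using s(3)[of "k _", unfolded Qk] by metis
      obtain M where M: "\<And>k w. w \<in> ball p (\<rho> p) \<Longrightarrow> s k w \<le> M"
        using upper[OF pU] by blast
      have "filterlim (\<lambda>j. Suc (k j)) at_top sequentially"
        by (rule filterlim_at_top_mono[OF filterlim_ident])
           (auto simp: k_def intro!: always_eventually le_SucI le_prod_encode_2)
      then have limk: "(\<lambda>j. s (Suc (k j)) w) \<longlonglongrightarrow> S w" if "w \<in> U" for w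
        using filterlim_compose[OF lim[OF that]] by blast
      have "\<exists>g. g holomorphic_on ball p (\<rho> p) \<and> (\<forall>w\<in>ball p (\<rho> p). S w = Re (g w))"
      proof (intro harmonic_limit[of f p "\<rho> p" "max \<bar>M\<bar> \<bar>ln R\<bar>" S, OF f(1)])
        show "\<bar>Re (f j w)\<bar> \<le> max \<bar>M\<bar> \<bar>ln R\<bar>" if "w \<in> ball p (\<rho> p)" for j w
          using M[OF that, of "Suc (k j)"] s0[of w "Suc (k j)"] that BU f(2)[OF that, of j] by auto
        show "(\<lambda>j. Re (f j w)) \<longlonglongrightarrow> S w" if "w \<in> ball p (\<rho> p)" for w
          using limk[of w] f(2)[OF that] that BU by auto
      qed
      then obtain g where g: "g holomorphic_on ball p (\<rho> p)" "\<And>w. w \<in> ball p (\<rho> p) \<Longrightarrow> S w = Re (g w)"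
        by blast
      have "harmonic_in S (ball p (\<rho> p))"
        by (rule harmonic_in_cong[OF harmonic_in_Re[OF open_ball g(1)] g(2)])
      with p(2) show "\<exists>T. z \<in> T \<and> harmonic_in S T" by blast
    qed
    show "ln (cmod (z - c)) \<le> S z" if z: "z \<in> U" "z \<noteq> c" for z
    proof -
      have "ln (cmod (z - c)) \<le> s0 z" unfolding s0_def using z by (intro ln_mono) auto
      also have "s0 z \<le> s 0 z" using s(1) z by (simp add: P_def)
      also have "s 0 z \<le> S z" using incseq_le[OF incr lim] z by simp
      finally show ?thesis .
    qed
    show "cmod (b z) * exp (S z) \<le> 1" if z: "z \<in> U" for z
    proof (rule LIMSEQ_le_const2)
      show "(\<lambda>k. cmod (b z) * exp (s k z)) \<longlonglongrightarrow> cmod (b z) * exp (S z)"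
        by (intro tendsto_intros lim z)
      show "\<exists>N. \<forall>k\<ge>N. cmod (b z) * exp (s k z) \<le> 1" using s(1) z by (auto simp: P_def)
    qed
  qed
qed

section \<open>Green functions on the sphere\<close>

text \<open>Convergence to 0 along complements of compact subsets of \<open>U\<close>; if
  \<open>U\<close> is unbounded, infinity counts as part of the boundary.\<close>

definition vanishes_at_boundary :: "(complex \<Rightarrow> real) \<Rightarrow> complex set \<Rightarrow> bool" where
  "vanishes_at_boundary u U \<longleftrightarrow>
     (\<forall>\<epsilon>>0. \<exists>C. compact C \<and> C \<subseteq> U \<and> (\<forall>z\<in>U - C. \<bar>u z\<bar> < \<epsilon>))"

text \<open>The compact exceptional set \<open>C0\<close> takes up the poles, where the estimate may
  fail or only a default value is available.\<close>

lemma vanishes_at_boundary_le: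
  assumes "vanishes_at_boundary u U" "compact C0" "C0 \<subseteq> U"
    and "\<And>z. z \<in> U - C0 \<Longrightarrow> \<bar>v z\<bar> \<le> k * \<bar>u z\<bar>" "k \<ge> 0"
  shows "vanishes_at_boundary v U"
  unfolding vanishes_at_boundary_def
proof (intro allI impI)
  fix \<epsilon> :: real assume \<epsilon>: "\<epsilon> > 0"
  \<comment> \<open>Division by \<open>k + 1\<close> because \<open>k\<close> may be 0.\<close>
  then have "\<epsilon> / (k + 1) > 0" using assms(5) by simp
  then obtain C where C: "compact C" "C \<subseteq> U" "\<And>z. z \<in> U - C \<Longrightarrow> \<bar>u z\<bar> < \<epsilon> / (k + 1)"
    using assms(1) unfolding vanishes_at_boundary_def by meson
  have "\<bar>v z\<bar> < \<epsilon>" if "z \<in> U - (C \<union> C0)" for z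
  proof -
    have "\<bar>v z\<bar> \<le> k * \<bar>u z\<bar>" using assms(4) that by simp
    also have "\<dots> \<le> (k + 1) * \<bar>u z\<bar>" by (simp add: mult_right_mono)
    also have "\<dots> < (k + 1) * (\<epsilon> / (k + 1))"
      using C(3)[of z] that assms(5) by (intro mult_strict_left_mono) auto
    also have "\<dots> = \<epsilon>" using assms(5) by simp
    finally show ?thesis .
  qed
  then show "\<exists>C. compact C \<and> C \<subseteq> U \<and> (\<forall>z\<in>U - C. \<bar>v z\<bar> < \<epsilon>)"
    using C assms(2,3) by (intro exI[of _ "C \<union> C0"]) auto
qed

lemma vanishes_at_boundary_diff:
  assumes "vanishes_at_boundary u U" "vanishes_at_boundary v U"
  shows "vanishes_at_boundary (\<lambda>z. u z - v z) U"
  unfolding vanishes_at_boundary_def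
proof (intro allI impI)
  fix \<epsilon> :: real assume "\<epsilon> > 0"
  then have \<epsilon>: "\<epsilon> / 2 > 0" by simp
  obtain C where C: "compact C" "C \<subseteq> U" "\<And>z. z \<in> U - C \<Longrightarrow> \<bar>u z\<bar> < \<epsilon> / 2"
    using assms(1) \<epsilon> unfolding vanishes_at_boundary_def by meson
  obtain C' where C': "compact C'" "C' \<subseteq> U" "\<And>z. z \<in> U - C' \<Longrightarrow> \<bar>v z\<bar> < \<epsilon> / 2"
    using assms(2) \<epsilon> unfolding vanishes_at_boundary_def by meson
  have "\<bar>u z - v z\<bar> < \<epsilon>" if "z \<in> U - (C \<union> C')" for z
    using C(3)[of z] C'(3)[of z] that by auto
  then show "\<exists>C. compact C \<and> C \<subseteq> U \<and> (\<forall>z\<in>U - C. \<bar>u z - v z\<bar> < \<epsilon>)"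
    using C(1,2) C'(1,2) by (intro exI[of _ "C \<union> C'"]) auto
qed

text \<open>Beyond a compact subset of \<open>U\<close> one has
  \<open>exp u < 1 + \<epsilon>\<close>; hence the superlevel sets of \<open>exp u\<close> are
  compact, which is what the maximum principle for moduli asks for.\<close>

lemma harmonic_vanishing_nonpos:
  assumes "harmonic_in u U" "vanishes_at_boundary u U" "z \<in> U"
  shows "u z \<le> 0"
proof -
  have "exp (u z) \<le> 1"
  proof (rule maximum_principle_modulus[OF _ _ \<open>z \<in> U\<close>])
    fix w assume "w \<in> U"
    then obtain r f where "r > 0" "ball w r \<subseteq> U" "f holomorphic_on ball w r" "\<forall>z\<in>ball w r. u z = Re (f z)"
      using assms(1) unfolding harmonic_in_def by meson
    then show "\<exists>r>0. ball w r \<subseteq> U \<and> (\<exists>f. f holomorphic_on ball w r \<and> (\<forall>z\<in>ball w r. exp (u z) = cmod (f z)))"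
      by (intro exI[of _ r] conjI exI[of _ "\<lambda>z. exp (f z)"] holomorphic_intros) auto
  next
    fix \<epsilon> :: real assume "\<epsilon> > 0"
    then have "ln (1 + \<epsilon>) > 0" by simp
    then obtain C where C: "compact C" "C \<subseteq> U" "\<And>z. z \<in> U - C \<Longrightarrow> \<bar>u z\<bar> < ln (1 + \<epsilon>)"
      using assms(2) unfolding vanishes_at_boundary_def by meson
    have "z \<in> C" if "z \<in> U" "exp (u z) \<ge> 1 + \<epsilon>" for z
    proof (rule ccontr)
      assume "z \<notin> C"
      then have "u z < ln (1 + \<epsilon>)" using C(3)[of z] that(1) by auto
      then have "exp (u z) < exp (ln (1 + \<epsilon>))" by simp
      then show False using that(2) \<open>\<epsilon> > 0\<close> by simp
    qed
    then have eq: "{z \<in> U. exp (u z) \<ge> 1 + \<epsilon>} = C \<inter> (C \<inter> (\<lambda>z. exp (u z)) -` {1 + \<epsilon>..})"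
      using C(2) by auto
    have "continuous_on C (\<lambda>z. exp (u z))"
      using continuous_on_subset[OF harmonic_in_continuous_on[OF assms(1)] C(2)]
      by (intro continuous_intros)
    then have "closed (C \<inter> (\<lambda>z. exp (u z)) -` {1 + \<epsilon>..})"
      using compact_imp_closed[OF C(1)] closed_atLeast by (rule continuous_closed_preimage)
    then show "compact {z \<in> U. exp (u z) \<ge> 1 + \<epsilon>}"
      unfolding eq by (rule compact_Int_closed[OF C(1)])
  qed
  then show ?thesis by simp
qed

lemma harmonic_vanishing_eq_0:
  assumes "harmonic_in u U" "vanishes_at_boundary u U" "z \<in> U"
  shows "u z = 0"
proof -
  have "harmonic_in (\<lambda>z. - 1 * u z) U"
    using assms(1) by (rule harmonic_in_cmult)
  moreover have "vanishes_at_boundary (\<lambda>z. - 1 * u z) U"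
    using assms(2) by (simp add: vanishes_at_boundary_def)
  ultimately have "- 1 * u z \<le> 0" using assms(3) by (rule harmonic_vanishing_nonpos)
  with harmonic_vanishing_nonpos[OF assms] show ?thesis by simp
qed

section \<open>Planar Green functions and their uniqueness\<close>

definition log_pole :: "(complex \<Rightarrow> real) \<Rightarrow> complex \<Rightarrow> complex set \<Rightarrow> bool" where
  "log_pole G c U \<longleftrightarrow> (\<exists>r>0. \<exists>h. harmonic_in h (ball c r) \<and>
     (\<forall>z\<in>ball c r - {c}. z \<in> U \<longrightarrow> G z = h z - ln (cmod (z - c))))"

lemma log_poleI:
  assumes "open T" "c \<in> T" "harmonic_in h T"
    and "\<And>z. z \<in> T \<Longrightarrow> z \<in> U \<Longrightarrow> z \<noteq> c \<Longrightarrow> G z = h z - ln (cmod (z - c))"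
  shows "log_pole G c U"
proof -
  obtain r where r: "r > 0" "ball c r \<subseteq> T" using assms(1,2) by (rule openE)
  have "harmonic_in h (ball c r)" using harmonic_in_subset[OF assms(3) open_ball r(2)] .
  then show ?thesis
    unfolding log_pole_def using r assms(4) by (intro exI[of _ r] conjI exI[of _ h]) auto
qed

text \<open>The value at \<open>c\<close> is left free, so uniqueness can only hold away from
  \<open>c\<close>.\<close>

definition green_planar :: "complex set \<Rightarrow> complex \<Rightarrow> (complex \<Rightarrow> real) \<Rightarrow> bool" where
  "green_planar U c G \<longleftrightarrow> harmonic_in G (U - {c}) \<and> log_pole G c U \<and> vanishes_at_boundary G U"

text \<open>The logarithms cancel in the difference, which therefore extends harmonically across
  \<open>c\<close> with value \<open>h1 c - h2 c\<close>. It vanishes at the boundary and hence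
  everywhere.\<close>

lemma green_planar_unique:
  assumes U: "open U" "c \<in> U" and G: "green_planar U c G1" "green_planar U c G2"
    and z: "z \<in> U" "z \<noteq> c"
  shows "G1 z = G2 z"
proof -
  obtain r1 h1 where h1: "r1 > 0" "harmonic_in h1 (ball c r1)"
    "\<And>z. z \<in> ball c r1 \<Longrightarrow> z \<noteq> c \<Longrightarrow> z \<in> U \<Longrightarrow> G1 z = h1 z - ln (cmod (z - c))"
    using G(1) unfolding green_planar_def log_pole_def by blast
  obtain r2 h2 where h2: "r2 > 0" "harmonic_in h2 (ball c r2)"
    "\<And>z. z \<in> ball c r2 \<Longrightarrow> z \<noteq> c \<Longrightarrow> z \<in> U \<Longrightarrow> G2 z = h2 z - ln (cmod (z - c))"
    using G(2) unfolding green_planar_def log_pole_def by blast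
  define d where "d w = (if w = c then h1 c - h2 c else G1 w - G2 w)" for w
  have "harmonic_in d U"
  proof (rule harmonic_in_local[OF U(1)])
    fix w assume w: "w \<in> U"
    show "\<exists>T. w \<in> T \<and> harmonic_in d T"
    proof (cases "w = c")
      case True
      define T where "T = ball c r1 \<inter> ball c r2 \<inter> U"
      have "open T" "w \<in> T" using U h1(1) h2(1) True by (auto simp: T_def)
      have "harmonic_in (\<lambda>z. h1 z - h2 z) T"
        using \<open>open T\<close> by (intro harmonic_in_diff harmonic_in_subset[OF h1(2)] harmonic_in_subset[OF h2(2)])
          (auto simp: T_def)
      then have "harmonic_in d T"
        by (rule harmonic_in_cong) (auto simp: T_def d_def h1(3) h2(3))
      with \<open>w \<in> T\<close> show ?thesis by blast
    next
      case False
      have "harmonic_in (\<lambda>z. G1 z - G2 z) (U - {c})"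
        using G by (intro harmonic_in_diff) (auto simp: green_planar_def)
      then have "harmonic_in d (U - {c})"
        by (rule harmonic_in_cong) (simp add: d_def)
      with w False show ?thesis by (intro exI[of _ "U - {c}"]) simp
    qed
  qed
  moreover have "vanishes_at_boundary d U"
  proof (rule vanishes_at_boundary_le[of "\<lambda>z. G1 z - G2 z" U "{c}" d 1])
    show "vanishes_at_boundary (\<lambda>z. G1 z - G2 z) U"
      using G by (intro vanishes_at_boundary_diff) (auto simp: green_planar_def)
  qed (use U in \<open>auto simp: d_def\<close>)
  ultimately have "d z = 0" using z(1) by (rule harmonic_vanishing_eq_0)
  then show ?thesis using z(2) by (simp add: d_def)
qed

text \<open>Centring the chart \<open>w \<mapsto> a + 1 / w\<close> at a point \<open>a\<close> of the compact set makes it a single chart for the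
  complement; the point at infinity of the sphere is \<open>w = 0\<close>.\<close>

definition sphere_chart :: "complex \<Rightarrow> complex \<Rightarrow> complex option" where
  "sphere_chart a w = (if w = 0 then None else Some (a + 1 / w))"

definition sphere_coord :: "complex \<Rightarrow> complex option \<Rightarrow> complex" where
  "sphere_coord a p = (case p of None \<Rightarrow> 0 | Some z \<Rightarrow> 1 / (z - a))"

lemma sphere_coord_chart [simp]: "sphere_coord a (sphere_chart a w) = w"
  by (simp add: sphere_coord_def sphere_chart_def)

lemma sphere_chart_coord: "p \<noteq> Some a \<Longrightarrow> sphere_chart a (sphere_coord a p) = p"
  by (auto simp: sphere_coord_def sphere_chart_def split: option.splits)

lemma sphere_chart_neq [simp]: "sphere_chart a w \<noteq> Some a"
  by (simp add: sphere_chart_def)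

lemma sphere_chart_eq_iff [simp]: "sphere_chart a w = sphere_chart a w' \<longleftrightarrow> w = w'"
  by (metis sphere_coord_chart)

lemma sphere_chart_image_iff: "p \<in> sphere_chart a ` U \<longleftrightarrow> p \<noteq> Some a \<and> sphere_coord a p \<in> U"
  by (metis image_iff sphere_chart_coord sphere_chart_neq sphere_coord_chart)

text \<open>The transition map between the two charts at infinity: solve
  \<open>1 / \<zeta> = a + 1 / w\<close> for \<open>w\<close>.\<close>

lemma inf_chart_eq_sphere_chart:
  "1 - a * \<zeta> \<noteq> 0 \<Longrightarrow> inf_chart \<zeta> = sphere_chart a (\<zeta> / (1 - a * \<zeta>))"
  by (auto simp: inf_chart_def sphere_chart_def field_simps)

lemma sphere_chart_eq_inf_chart:
  "1 + a * w \<noteq> 0 \<Longrightarrow> sphere_chart a w = inf_chart (w / (1 + a * w))"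
  by (auto simp: inf_chart_def sphere_chart_def field_simps)

section \<open>Transfer of Green functions between the sphere and the plane\<close>

lemma open_preimage_holomorphic:
  assumes "f holomorphic_on T" "open T" "open S"
  shows "open {z \<in> T. f z \<in> S}"
  using continuous_open_preimage[OF holomorphic_on_imp_continuous_on[OF assms(1)] assms(2,3)]
  by (simp add: vimage_def Int_def)

lemma harmonic_in_preimage:
  assumes "harmonic_in u S" "f holomorphic_on T" "open T"
  shows "harmonic_in (\<lambda>z. u (f z)) {z \<in> T. f z \<in> S}"
proof (rule harmonic_in_compose[OF assms(1)])
  have "open S" using assms(1) by (simp add: harmonic_in_def)
  with assms show "open {z \<in> T. f z \<in> S}" by (intro open_preimage_holomorphic)
  show "f holomorphic_on {z \<in> T. f z \<in> S}"
    using assms(2) by (rule holomorphic_on_subset) auto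
qed auto

text \<open>A change of chart multiplies the local coordinate at the pole by a zero-free holomorphic
  factor; the logarithm of its modulus is harmonic and is absorbed into \<open>h\<close>. The
  pointwise boundary limits become the uniform condition \<open>vanishes_at_boundary\<close> by
  compactness.\<close>

lemma green_fun_imp_planar:
  assumes U: "open U" "c \<in> U"
    and K: "K = - sphere_chart a ` U" and g: "green_fun K (sphere_chart a c) g"
  shows "green_planar U c (\<lambda>w. g (sphere_chart a w))"
proof -
  let ?\<psi> = "sphere_chart a"
  have \<psi>K: "?\<psi> w \<notin> K \<longleftrightarrow> w \<in> U" for w by (auto simp: K)
  have aK: "Some a \<in> K" by (auto simp: K sphere_chart_image_iff)
  have harm: "harmonic_in (\<lambda>z. g (Some z)) {z. Some z \<notin> K \<and> Some z \<noteq> ?\<psi> c}"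
    and harm_inf: "None \<notin> K \<Longrightarrow> ?\<psi> c \<noteq> None \<Longrightarrow> \<exists>r>0. harmonic_in (\<lambda>\<zeta>. g (inf_chart \<zeta>)) (ball 0 r)"
    and pole: "case ?\<psi> c of
        Some a \<Rightarrow> (\<exists>r>0. \<exists>h. harmonic_in h (ball a r) \<and>
                   (\<forall>z\<in>ball a r - {a}. Some z \<notin> K \<longrightarrow> g (Some z) = h z - ln (cmod (z - a))))
      | None \<Rightarrow> (\<exists>r>0. \<exists>h. harmonic_in h (ball 0 r) \<and>
                   (\<forall>\<zeta>\<in>ball 0 r - {0}. inf_chart \<zeta> \<notin> K \<longrightarrow> g (inf_chart \<zeta>) = h \<zeta> - ln (cmod \<zeta>)))"
    and lim: "\<And>z. Some z \<in> K \<Longrightarrow> ((\<lambda>z. g (Some z)) \<longlongrightarrow> 0) (at z within {z. Some z \<notin> K})"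
    and lim_inf: "None \<in> K \<Longrightarrow> ((\<lambda>z. g (Some z)) \<longlongrightarrow> 0) (inf at_infinity (principal {z. Some z \<notin> K}))"
    using g unfolding green_fun_def by (auto split: option.splits)
  have opn: "open {w::complex. 1 + a * w \<noteq> 0}"
    by (intro open_Collect_neq continuous_intros)
  have holo0: "(\<lambda>w. a + 1 / w) holomorphic_on - {0}"
    by (intro holomorphic_intros) auto
  have holo1: "(\<lambda>w. w / (1 + a * w)) holomorphic_on {w. 1 + a * w \<noteq> 0}"
    by (intro holomorphic_intros) auto
  have "harmonic_in (\<lambda>w. g (?\<psi> w)) (U - {c})"
  proof (rule harmonic_in_local)
    show "open (U - {c})" using U by auto
    fix w assume w: "w \<in> U - {c}"
    show "\<exists>T. w \<in> T \<and> harmonic_in (\<lambda>w. g (?\<psi> w)) T"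
    proof (cases "w = 0")
      case True
      then have "None \<notin> K" "?\<psi> c \<noteq> None"
        using w \<psi>K[of 0] by (auto simp: sphere_chart_def)
      then obtain r where r: "r > 0" "harmonic_in (\<lambda>\<zeta>. g (inf_chart \<zeta>)) (ball 0 r)"
        using harm_inf by blast
      let ?T = "{w \<in> {w. 1 + a * w \<noteq> 0}. w / (1 + a * w) \<in> ball 0 r}"
      have "harmonic_in (\<lambda>w. g (inf_chart (w / (1 + a * w)))) ?T"
        using r(2) holo1 opn by (rule harmonic_in_preimage)
      then have "harmonic_in (\<lambda>w. g (?\<psi> w)) ?T"
        by (rule harmonic_in_cong) (simp add: sphere_chart_eq_inf_chart)
      moreover have "w \<in> ?T" using True r(1) by simp
      ultimately show ?thesis by (intro exI[of _ ?T] conjI)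
    next
      case False
      let ?T = "{w \<in> - {0}. a + 1 / w \<in> {z. Some z \<notin> K \<and> Some z \<noteq> ?\<psi> c}}"
      have "harmonic_in (\<lambda>w. g (Some (a + 1 / w))) ?T"
        using harm holo0 by (rule harmonic_in_preimage) auto
      then have "harmonic_in (\<lambda>w. g (?\<psi> w)) ?T"
        by (rule harmonic_in_cong) (simp add: sphere_chart_def)
      moreover have "?\<psi> w \<notin> K" "?\<psi> w \<noteq> ?\<psi> c" using w \<psi>K by auto
      then have "w \<in> ?T" using False by (simp add: sphere_chart_def)
      ultimately show ?thesis by (intro exI[of _ ?T] conjI)
    qed
  qed
  moreover have "log_pole (\<lambda>w. g (?\<psi> w)) c U"
  proof (cases "c = 0")
    case True
    then obtain r h where h: "r > 0" "harmonic_in h (ball 0 r)"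
      "\<And>\<zeta>. \<zeta> \<in> ball 0 r \<Longrightarrow> \<zeta> \<noteq> 0 \<Longrightarrow> inf_chart \<zeta> \<notin> K \<Longrightarrow> g (inf_chart \<zeta>) = h \<zeta> - ln (cmod \<zeta>)"
      using pole by (auto simp: sphere_chart_def)
    let ?T = "{w \<in> {w. 1 + a * w \<noteq> 0}. w / (1 + a * w) \<in> ball 0 r}"
    show ?thesis
    proof (rule log_poleI)
      show T: "open ?T" by (rule open_preimage_holomorphic[OF holo1 opn open_ball])
      show "c \<in> ?T" using True h(1) by simp
      show "harmonic_in (\<lambda>w. h (w / (1 + a * w)) + ln (cmod (1 + a * w))) ?T"
        by (intro harmonic_in_add harmonic_in_ln_norm T harmonic_in_preimage[OF h(2) holo1 opn] holomorphic_intros)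
           auto
      fix w assume w: "w \<in> ?T" "w \<in> U" "w \<noteq> c"
      then have "w \<noteq> 0" "1 + a * w \<noteq> 0" using True by auto
      have eq: "?\<psi> w = inf_chart (w / (1 + a * w))"
        using w by (simp add: sphere_chart_eq_inf_chart)
      have "g (inf_chart (w / (1 + a * w))) = h (w / (1 + a * w)) - ln (cmod (w / (1 + a * w)))"
        by (rule h(3)) (use w \<open>w \<noteq> 0\<close> \<psi>K[of w] eq in auto)
      also have "ln (cmod (w / (1 + a * w))) = ln (cmod w) - ln (cmod (1 + a * w))"
        using \<open>w \<noteq> 0\<close> \<open>1 + a * w \<noteq> 0\<close> by (simp add: norm_divide ln_div)
      finally show "g (?\<psi> w) = h (w / (1 + a * w)) + ln (cmod (1 + a * w)) - ln (cmod (w - c))"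
        using True eq by simp
    qed
  next
    case False
    then obtain r h where h: "r > 0" "harmonic_in h (ball (a + 1 / c) r)"
      "\<And>z. z \<in> ball (a + 1 / c) r \<Longrightarrow> z \<noteq> a + 1 / c \<Longrightarrow> Some z \<notin> K \<Longrightarrow> g (Some z) = h z - ln (cmod (z - (a + 1 / c)))"
      using pole by (auto simp: sphere_chart_def)
    let ?T = "{w \<in> - {0}. a + 1 / w \<in> ball (a + 1 / c) r}"
    show ?thesis
    proof (rule log_poleI)
      show T: "open ?T" by (rule open_preimage_holomorphic[OF holo0 _ open_ball]) auto
      show "c \<in> ?T" using False h(1) by simp
      show "harmonic_in (\<lambda>w. h (a + 1 / w) + ln (cmod (w * c))) ?T"
        using False
        by (intro harmonic_in_add harmonic_in_ln_norm T harmonic_in_preimage[OF h(2) holo0] holomorphic_intros)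
           auto
      fix w assume w: "w \<in> ?T" "w \<in> U" "w \<noteq> c"
      then have "w \<noteq> 0" by auto
      have eq: "?\<psi> w = Some (a + 1 / w)" using \<open>w \<noteq> 0\<close> by (simp add: sphere_chart_def)
      have "g (Some (a + 1 / w)) = h (a + 1 / w) - ln (cmod (a + 1 / w - (a + 1 / c)))"
        by (rule h(3)) (use w False \<open>w \<noteq> 0\<close> \<psi>K[of w] eq in auto)
      also have "a + 1 / w - (a + 1 / c) = (c - w) / (w * c)"
        using \<open>w \<noteq> 0\<close> False by (simp add: field_simps)
      also have "ln (cmod ((c - w) / (w * c))) = ln (cmod (w - c)) - ln (cmod (w * c))"
        using \<open>w \<noteq> 0\<close> False w(3) by (simp add: norm_divide ln_div norm_minus_commute)
      finally show "g (?\<psi> w) = h (a + 1 / w) + ln (cmod (w * c)) - ln (cmod (w - c))"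
        using eq by simp
    qed
  qed
  moreover have "vanishes_at_boundary (\<lambda>w. g (?\<psi> w)) U"
    unfolding vanishes_at_boundary_def
  proof (intro allI impI)
    fix \<epsilon> :: real assume \<epsilon>: "\<epsilon> > 0"
    \<comment> \<open>Every \<open>p\<close> outside \<open>U\<close> represents a point of
      \<open>K\<close>, with \<open>None\<close> at \<open>p = 0\<close>; the limit condition at
      that point supplies the neighbourhood.\<close>
    have "\<exists>\<delta>>0. \<forall>w\<in>U \<inter> ball p \<delta>. \<bar>g (?\<psi> w)\<bar> < \<epsilon>" if p: "p \<notin> U" for p
    proof (cases "p = 0")
      case True
      have "None \<in> K" using p True \<psi>K[of 0] by (simp add: sphere_chart_def)
      then have "\<forall>\<^sub>F z in inf at_infinity (principal {z. Some z \<notin> K}). dist (g (Some z)) 0 < \<epsilon>"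
        using lim_inf \<epsilon> by (blast dest: tendstoD)
      then obtain B where B: "\<And>z. cmod z \<ge> B \<Longrightarrow> Some z \<notin> K \<Longrightarrow> \<bar>g (Some z)\<bar> < \<epsilon>"
        by (auto simp: eventually_inf_principal eventually_at_infinity)
      \<comment> \<open>With this radius \<open>|1 / w|\<close> exceeds
        \<open>|B| + |a| + 1\<close>, so that \<open>|a + 1 / w| >= B\<close> survives the shift by
        \<open>a\<close>.\<close>
      define \<delta> where "\<delta> = 1 / (\<bar>B\<bar> + cmod a + 1)"
      have "\<delta> > 0" by (simp add: \<delta>_def add_nonneg_pos)
      moreover have "\<bar>g (?\<psi> w)\<bar> < \<epsilon>" if w: "w \<in> U" "w \<in> ball p \<delta>" for w
      proof -
        have "w \<noteq> 0" using w p True by auto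
        have m: "\<bar>B\<bar> + cmod a + 1 > 0" by (simp add: add_nonneg_pos)
        have "cmod w < 1 / (\<bar>B\<bar> + cmod a + 1)" using w True by (simp add: \<delta>_def)
        then have "cmod w * (\<bar>B\<bar> + cmod a + 1) < 1"
          unfolding pos_less_divide_eq[OF m] .
        then have "\<bar>B\<bar> + cmod a + 1 < 1 / cmod w"
          using \<open>w \<noteq> 0\<close> by (subst pos_less_divide_eq) (simp_all add: mult.commute)
        moreover have "cmod (1 / w) \<le> cmod (a + 1 / w) + cmod a"
          using norm_triangle_ineq4[of "a + 1 / w" a] by simp
        ultimately have "B \<le> cmod (a + 1 / w)" by (simp add: norm_divide)
        with B[of "a + 1 / w"] \<psi>K[of w] w(1) \<open>w \<noteq> 0\<close> show ?thesis
          by (simp add: sphere_chart_def)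
      qed
      ultimately show ?thesis by auto
    next
      case False
      have "Some (a + 1 / p) \<in> K" using p False \<psi>K[of p] by (simp add: sphere_chart_def)
      then have "\<forall>\<^sub>F z in at (a + 1 / p) within {z. Some z \<notin> K}. dist (g (Some z)) 0 < \<epsilon>"
        using lim \<epsilon> by (blast dest: tendstoD)
      then obtain d where d: "d > 0"
        "\<And>z. Some z \<notin> K \<Longrightarrow> z \<noteq> a + 1 / p \<Longrightarrow> dist z (a + 1 / p) < d \<Longrightarrow> \<bar>g (Some z)\<bar> < \<epsilon>"
        by (auto simp: eventually_at)
      have "isCont (\<lambda>w. a + 1 / w) p" using False by (intro continuous_intros)
      then obtain \<delta> where \<delta>: "\<delta> > 0" "\<And>w. dist w p < \<delta> \<Longrightarrow> dist (a + 1 / w) (a + 1 / p) < d"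
        using d(1) unfolding continuous_at_eps_delta by blast
      \<comment> \<open>The bound \<open>cmod p\<close> keeps \<open>w\<close> away from 0, where
        the chart formula changes.\<close>
      have "\<bar>g (?\<psi> w)\<bar> < \<epsilon>" if w: "w \<in> U" "dist w p < min \<delta> (cmod p)" for w
      proof -
        have "w \<noteq> 0" "w \<noteq> p" using w p by auto
        then show ?thesis
          using d(2)[of "a + 1 / w"] \<delta>(2)[of w] w \<psi>K[of w] False
          by (auto simp: sphere_chart_def)
      qed
      then show ?thesis
        using False \<delta>(1) by (intro exI[of _ "min \<delta> (cmod p)"]) (auto simp: dist_commute)
    qed
    then obtain \<delta> where \<delta>: "\<And>p. p \<notin> U \<Longrightarrow> \<delta> p > 0"
      "\<And>p w. p \<notin> U \<Longrightarrow> w \<in> U \<Longrightarrow> w \<in> ball p (\<delta> p) \<Longrightarrow> \<bar>g (?\<psi> w)\<bar> < \<epsilon>"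
      by (metis IntI)
    have "\<forall>\<^sub>F z in at a within {z. Some z \<notin> K}. dist (g (Some z)) 0 < \<epsilon>"
      using lim[OF aK] \<epsilon> by (blast dest: tendstoD)
    then obtain d where d: "d > 0"
      "\<And>z. Some z \<notin> K \<Longrightarrow> z \<noteq> a \<Longrightarrow> dist z a < d \<Longrightarrow> \<bar>g (Some z)\<bar> < \<epsilon>"
      by (auto simp: eventually_at)
    have far: "\<bar>g (?\<psi> w)\<bar> < \<epsilon>" if w: "w \<in> U" "cmod w > 1 / d" for w
    proof -
      have "1 / d > 0" using d(1) by simp
      then have "w \<noteq> 0" using w(2) by auto
      moreover have "cmod (1 / w) < d"
        using w(2) d(1) \<open>w \<noteq> 0\<close> by (simp add: norm_divide field_simps)
      ultimately show ?thesis
        using d(2)[of "a + 1 / w"] \<psi>K[of w] w(1) by (simp add: sphere_chart_def dist_norm)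
    qed
    \<comment> \<open>A closed disc minus open balls around all points outside \<open>U\<close> is
      compact and lies in \<open>U\<close>. The radius \<open>1 / d\<close> corresponds to the
      punctured disc of radius \<open>d\<close> about \<open>a\<close>.\<close>
    define C where "C = cball 0 (1 / d) - (\<Union>p\<in>- U. ball p (\<delta> p))"
    have "compact C" unfolding C_def by (intro compact_diff compact_cball) auto
    moreover have "C \<subseteq> U"
    proof
      fix x assume "x \<in> C"
      show "x \<in> U"
      proof (rule ccontr)
        assume "x \<notin> U"
        then have "x \<in> ball x (\<delta> x)" using \<delta>(1) by simp
        then show False using \<open>x \<in> C\<close> \<open>x \<notin> U\<close> unfolding C_def by blast
      qed
    qed
    moreover have "\<bar>g (?\<psi> w)\<bar> < \<epsilon>" if "w \<in> U - C" for w
      using that far[of w] \<delta>(2) by (auto simp: C_def not_le)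
    ultimately show "\<exists>C. compact C \<and> C \<subseteq> U \<and> (\<forall>w\<in>U - C. \<bar>g (?\<psi> w)\<bar> < \<epsilon>)" by blast
  qed
  ultimately show ?thesis by (simp add: green_planar_def)
qed

text \<open>\<open>s\<close> is the regular part of \<open>G\<close> at the pole; in either chart of
  \<open>green_fun\<close> it changes by the log-modulus of a zero-free factor. The zeros on
  \<open>K\<close> and at the pole are the normalisation that makes the function on the whole sphere
  unique.\<close>

lemma green_planar_imp_fun:
  assumes U: "open U" "c \<in> U" and K: "K = - sphere_chart a ` U"
    and s: "harmonic_in s U" and G: "\<And>w. w \<in> U \<Longrightarrow> w \<noteq> c \<Longrightarrow> G w = s w - ln (cmod (w - c))"
    and van: "vanishes_at_boundary G U"
  shows "green_fun K (sphere_chart a c)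
     (\<lambda>p. if p \<in> K \<or> p = sphere_chart a c then 0 else G (sphere_coord a p))" (is "green_fun K ?p ?g")
proof -
  let ?\<psi> = "sphere_chart a"
  have K_iff: "p \<notin> K \<longleftrightarrow> p \<noteq> Some a \<and> sphere_coord a p \<in> U" for p
    by (simp add: K sphere_chart_image_iff)
  have neq: "sphere_coord a p \<noteq> c" if "p \<notin> K" "p \<noteq> ?p" for p
    using that K_iff sphere_chart_coord by metis
  have gG: "?g p = G (sphere_coord a p)" if "p \<notin> K" "p \<noteq> ?p" for p
    using that by simp
  have gs: "?g p = s (sphere_coord a p) - ln (cmod (sphere_coord a p - c))" if "p \<notin> K" "p \<noteq> ?p" for p
    using that neq[OF that] K_iff[of p] G[of "sphere_coord a p"] by auto
  have U': "open (U - {c})" using U by auto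
  have harmG: "harmonic_in G (U - {c})"
  proof (rule harmonic_in_cong)
    show "harmonic_in (\<lambda>w. s w - ln (cmod (w - c))) (U - {c})"
      by (intro harmonic_in_diff harmonic_in_subset[OF s U'] harmonic_in_ln_norm U' holomorphic_intros) auto
  qed (use G in auto)
  have holo0: "(\<lambda>z. 1 / (z - a)) holomorphic_on - {a}"
    by (intro holomorphic_intros) auto
  have opn: "open {\<zeta>::complex. 1 - a * \<zeta> \<noteq> 0}"
    by (intro open_Collect_neq continuous_intros)
  have holo1: "(\<lambda>\<zeta>. \<zeta> / (1 - a * \<zeta>)) holomorphic_on {\<zeta>. 1 - a * \<zeta> \<noteq> 0}"
    by (intro holomorphic_intros) auto
  have inf: "sphere_coord a (inf_chart \<zeta>) = \<zeta> / (1 - a * \<zeta>)" "inf_chart \<zeta> \<noteq> Some a" if "1 - a * \<zeta> \<noteq> 0" for \<zeta>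
    using inf_chart_eq_sphere_chart[OF that] by simp_all
  have harm: "harmonic_in (\<lambda>z. ?g (Some z)) {z. Some z \<notin> K \<and> Some z \<noteq> ?p}"
  proof -
    have "harmonic_in (\<lambda>z. G (1 / (z - a))) {z \<in> - {a}. 1 / (z - a) \<in> U - {c}}"
      using harmG holo0 by (rule harmonic_in_preimage) auto
    moreover have "{z \<in> - {a}. 1 / (z - a) \<in> U - {c}} = {z. Some z \<notin> K \<and> Some z \<noteq> ?p}"
    proof -
      have "z \<noteq> a \<and> 1 / (z - a) \<in> U - {c} \<longleftrightarrow> Some z \<notin> K \<and> Some z \<noteq> ?p" for z
      proof -
        have "Some z = ?p \<longleftrightarrow> 1 / (z - a) = c" if "z \<noteq> a"
          using sphere_chart_coord[of "Some z" a] sphere_chart_eq_iff[of a "1 / (z - a)" c] that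
          by (simp add: sphere_coord_def)
        then show ?thesis using K_iff[of "Some z"] by (auto simp: sphere_coord_def)
      qed
      then show ?thesis by auto
    qed
    ultimately have "harmonic_in (\<lambda>z. G (1 / (z - a))) {z. Some z \<notin> K \<and> Some z \<noteq> ?p}" by simp
    then show ?thesis
      by (rule harmonic_in_cong) (simp add: sphere_coord_def)
  qed
  have harm_inf: "\<exists>r>0. (\<forall>\<zeta>\<in>ball 0 r. inf_chart \<zeta> \<notin> K) \<and> harmonic_in (\<lambda>\<zeta>. ?g (inf_chart \<zeta>)) (ball 0 r)"
    if "None \<notin> K" "?p \<noteq> None"
  proof -
    let ?T = "{\<zeta> \<in> {\<zeta>. 1 - a * \<zeta> \<noteq> 0}. \<zeta> / (1 - a * \<zeta>) \<in> U - {c}}"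
    have T: "open ?T" by (rule open_preimage_holomorphic[OF holo1 opn U'])
    have "0 \<in> ?T"
      using that K_iff[of None] neq[of None] by (auto simp: sphere_coord_def)
    then obtain r where r: "r > 0" "ball 0 r \<subseteq> ?T" by (rule openE[OF T])
    have mem: "inf_chart \<zeta> \<notin> K \<and> inf_chart \<zeta> \<noteq> ?p" if "\<zeta> \<in> ?T" for \<zeta>
      using that inf[of \<zeta>] K_iff[of "inf_chart \<zeta>"] by auto
    have "harmonic_in (\<lambda>\<zeta>. G (\<zeta> / (1 - a * \<zeta>))) ?T"
      using harmG holo1 opn by (rule harmonic_in_preimage)
    then have "harmonic_in (\<lambda>\<zeta>. G (\<zeta> / (1 - a * \<zeta>))) (ball 0 r)"
      by (rule harmonic_in_subset[OF _ open_ball r(2)])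
    then have "harmonic_in (\<lambda>\<zeta>. ?g (inf_chart \<zeta>)) (ball 0 r)"
    proof (rule harmonic_in_cong)
      fix \<zeta> :: complex assume "\<zeta> \<in> ball 0 r"
      then have "\<zeta> \<in> ?T" using r(2) by blast
      then show "?g (inf_chart \<zeta>) = G (\<zeta> / (1 - a * \<zeta>))"
        using gG mem inf(1)[of \<zeta>] by simp
    qed
    moreover have "\<forall>\<zeta>\<in>ball 0 r. inf_chart \<zeta> \<notin> K" using mem r(2) by blast
    ultimately show ?thesis using r(1) by blast
  qed
  have pole: "case ?p of
        Some a \<Rightarrow> (\<exists>r>0. \<exists>h. harmonic_in h (ball a r) \<and>
                   (\<forall>z\<in>ball a r - {a}. Some z \<notin> K \<longrightarrow> ?g (Some z) = h z - ln (cmod (z - a))))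
      | None \<Rightarrow> (\<exists>r>0. \<exists>h. harmonic_in h (ball 0 r) \<and>
                   (\<forall>\<zeta>\<in>ball 0 r - {0}. inf_chart \<zeta> \<notin> K \<longrightarrow> ?g (inf_chart \<zeta>) = h \<zeta> - ln (cmod \<zeta>)))"
  proof (cases "c = 0")
    case True
    then have p: "?p = None" by (simp add: sphere_chart_def)
    let ?T = "{\<zeta> \<in> {\<zeta>. 1 - a * \<zeta> \<noteq> 0}. \<zeta> / (1 - a * \<zeta>) \<in> U}"
    have T: "open ?T" by (rule open_preimage_holomorphic[OF holo1 opn U(1)])
    have "0 \<in> ?T" using U True by auto
    then obtain r where r: "r > 0" "ball 0 r \<subseteq> ?T" by (rule openE[OF T])
    define h where "h \<zeta> = s (\<zeta> / (1 - a * \<zeta>)) + ln (cmod (1 - a * \<zeta>))" for \<zeta>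
    have "harmonic_in h ?T"
      unfolding h_def
      by (intro harmonic_in_add harmonic_in_ln_norm T harmonic_in_preimage[OF s holo1 opn] holomorphic_intros)
         auto
    then have "harmonic_in h (ball 0 r)"
      by (rule harmonic_in_subset[OF _ open_ball r(2)])
    moreover have "?g (inf_chart \<zeta>) = h \<zeta> - ln (cmod \<zeta>)"
      if "\<zeta> \<in> ball 0 r" "\<zeta> \<noteq> 0" "inf_chart \<zeta> \<notin> K" for \<zeta>
    proof -
      have nz: "1 - a * \<zeta> \<noteq> 0" using that(1) r(2) by auto
      have "inf_chart \<zeta> \<noteq> ?p" using that(2) p by (simp add: inf_chart_def)
      then have "?g (inf_chart \<zeta>) = s (\<zeta> / (1 - a * \<zeta>)) - ln (cmod (\<zeta> / (1 - a * \<zeta>)))"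
        using gs[OF that(3)] inf(1)[OF nz] True by simp
      also have "ln (cmod (\<zeta> / (1 - a * \<zeta>))) = ln (cmod \<zeta>) - ln (cmod (1 - a * \<zeta>))"
        using nz that(2) by (simp add: norm_divide ln_div)
      finally show ?thesis by (simp add: h_def)
    qed
    ultimately show ?thesis unfolding p option.case using r(1) by blast
  next
    case False
    then have p: "?p = Some (a + 1 / c)" by (simp add: sphere_chart_def)
    let ?T = "{z \<in> - {a}. 1 / (z - a) \<in> U}"
    have T: "open ?T" by (rule open_preimage_holomorphic[OF holo0 _ U(1)]) auto
    have "a + 1 / c \<in> ?T" using U False by auto
    then obtain r where r: "r > 0" "ball (a + 1 / c) r \<subseteq> ?T" by (rule openE[OF T])
    define h where "h z = s (1 / (z - a)) + ln (cmod ((z - a) / c))" for z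
    have "harmonic_in h ?T"
      unfolding h_def using False
      by (intro harmonic_in_add harmonic_in_ln_norm T harmonic_in_preimage[OF s holo0] holomorphic_intros)
         auto
    then have "harmonic_in h (ball (a + 1 / c) r)"
      by (rule harmonic_in_subset[OF _ open_ball r(2)])
    moreover have "?g (Some z) = h z - ln (cmod (z - (a + 1 / c)))"
      if "z \<in> ball (a + 1 / c) r" "z \<noteq> a + 1 / c" "Some z \<notin> K" for z
    proof -
      have nz: "z \<noteq> a" using that(1) r(2) by auto
      have "Some z \<noteq> ?p" using that(2) p by simp
      then have "?g (Some z) = s (1 / (z - a)) - ln (cmod (1 / (z - a) - c))"
        using gs[OF that(3)] by (simp add: sphere_coord_def)
      also have "1 / (z - a) - c = (a + 1 / c - z) / ((z - a) / c)"
        using nz False by (simp add: field_simps)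
      also have "ln (cmod \<dots>) = ln (cmod (z - (a + 1 / c))) - ln (cmod ((z - a) / c))"
        using nz that(2) False
        by (subst norm_divide, subst ln_div) (auto simp: norm_minus_commute)
      finally show ?thesis by (simp add: h_def)
    qed
    ultimately show ?thesis unfolding p option.case using r(1) by blast
  qed
  have small: "\<bar>?g p\<bar> < \<epsilon>" if "\<epsilon> > 0" "\<And>w. w \<in> U - C \<Longrightarrow> \<bar>G w\<bar> < \<epsilon>" "sphere_coord a p \<notin> C" for p \<epsilon> C
    using that K_iff[of p] by auto
  have lim: "((\<lambda>z. ?g (Some z)) \<longlongrightarrow> 0) (at z0 within {z. Some z \<notin> K})" if z0: "Some z0 \<in> K" for z0
  proof (rule tendstoI)
    fix \<epsilon> :: real assume \<epsilon>: "\<epsilon> > 0"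
    then obtain C where C: "compact C" "C \<subseteq> U" "\<And>w. w \<in> U - C \<Longrightarrow> \<bar>G w\<bar> < \<epsilon>"
      using van unfolding vanishes_at_boundary_def by meson
    \<comment> \<open>The coordinate \<open>1 / (z - a)\<close> tends to infinity if
      \<open>z0 = a\<close> and to a point outside \<open>U\<close> otherwise; near
      \<open>z0\<close> it misses the compact set \<open>C\<close> in both cases.\<close>
    have "\<forall>\<^sub>F z in at z0. 1 / (z - a) \<notin> C"
    proof (cases "z0 = a")
      case True
      have lim: "filterlim (\<lambda>z. 1 / (z - a)) at_infinity (at z0)"
        unfolding True by (intro filterlim_divide_at_infinity[of _ 1] tendsto_const)
          (auto simp: filterlim_at intro!: tendsto_eq_intros eventually_at_topological[THEN iffD2])
      obtain B where "\<And>w. w \<in> C \<Longrightarrow> cmod w \<le> B"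
        using compact_imp_bounded[OF C(1)] unfolding bounded_iff by blast
      then have "\<forall>\<^sub>F w in at_infinity. w \<notin> C"
        unfolding eventually_at_infinity by (intro exI[of _ "B + 1"]) force
      then show ?thesis using lim by (rule eventually_compose_filterlim)
    next
      case False
      have "1 / (z0 - a) \<notin> U" using z0 K_iff[of "Some z0"] False by (simp add: sphere_coord_def)
      then have "1 / (z0 - a) \<in> - C" using C(2) by blast
      moreover have "((\<lambda>z. 1 / (z - a)) \<longlongrightarrow> 1 / (z0 - a)) (at z0)"
        using False by (intro tendsto_intros) auto
      moreover have "open (- C)" using C(1) by (simp add: compact_imp_closed open_Compl)
      ultimately have "\<forall>\<^sub>F z in at z0. 1 / (z - a) \<in> - C"
        by (intro topological_tendstoD)
      then show ?thesis by simp
    qed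
    then have "\<forall>\<^sub>F z in at z0 within {z. Some z \<notin> K}. 1 / (z - a) \<notin> C"
      by (rule filter_leD[OF at_le, rotated]) simp
    then show "\<forall>\<^sub>F z in at z0 within {z. Some z \<notin> K}. dist (?g (Some z)) 0 < \<epsilon>"
    proof eventually_elim
      case (elim z)
      then show ?case using small[of \<epsilon> C "Some z", OF \<epsilon> C(3)] by (simp add: sphere_coord_def)
    qed
  qed
  have lim_inf: "((\<lambda>z. ?g (Some z)) \<longlongrightarrow> 0) (inf at_infinity (principal {z. Some z \<notin> K}))" if "None \<in> K"
  proof (rule tendstoI)
    fix \<epsilon> :: real assume \<epsilon>: "\<epsilon> > 0"
    then obtain C where C: "compact C" "C \<subseteq> U" "\<And>w. w \<in> U - C \<Longrightarrow> \<bar>G w\<bar> < \<epsilon>"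
      using van unfolding vanishes_at_boundary_def by meson
    have "0 \<in> - C" using that K_iff[of None] C(2) by (auto simp: sphere_coord_def)
    moreover have "open (- C)" using C(1) by (simp add: compact_imp_closed open_Compl)
    moreover have "filterlim (\<lambda>z. - a + z) at_infinity (at_infinity :: complex filter)"
      by (intro tendsto_add_filterlim_at_infinity[OF tendsto_const] filterlim_ident)
    then have "((\<lambda>z. 1 / (z - a)) \<longlongrightarrow> 0) at_infinity"
      using tendsto_divide_0[OF tendsto_const[of 1]] by simp
    ultimately have "\<forall>\<^sub>F z in at_infinity. 1 / (z - a) \<in> - C"
      by (intro topological_tendstoD)
    then have "\<forall>\<^sub>F z in inf at_infinity (principal {z. Some z \<notin> K}). 1 / (z - a) \<notin> C"
      by (auto simp: eventually_inf_principal elim: eventually_mono)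
    then show "\<forall>\<^sub>F z in inf at_infinity (principal {z. Some z \<notin> K}). dist (?g (Some z)) 0 < \<epsilon>"
    proof eventually_elim
      case (elim z)
      then show ?case using small[of \<epsilon> C "Some z", OF \<epsilon> C(3)] by (simp add: sphere_coord_def)
    qed
  qed
  show ?thesis
    unfolding green_fun_def
  proof (intro conjI)
    show "?g ?p = 0" by simp
    show "\<forall>z\<in>K. ?g z = 0" by simp
    show "\<forall>\<xi>\<in>K. case \<xi> of
        Some a \<Rightarrow> ((\<lambda>z. ?g (Some z)) \<longlongrightarrow> 0) (at a within {z. Some z \<notin> K})
      | None \<Rightarrow> ((\<lambda>z. ?g (Some z)) \<longlongrightarrow> 0) (inf at_infinity (principal {z. Some z \<notin> K}))"
    proof
      fix \<xi> assume \<xi>: "\<xi> \<in> K"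
      show "case \<xi> of
        Some a \<Rightarrow> ((\<lambda>z. ?g (Some z)) \<longlongrightarrow> 0) (at a within {z. Some z \<notin> K})
      | None \<Rightarrow> ((\<lambda>z. ?g (Some z)) \<longlongrightarrow> 0) (inf at_infinity (principal {z. Some z \<notin> K}))"
      proof (cases \<xi>)
        case None
        then show ?thesis using lim_inf \<xi> unfolding None option.case by blast
      next
        case (Some z0)
        then show ?thesis using lim[of z0] \<xi> unfolding Some option.case by blast
      qed
    qed
    show "None \<notin> K \<and> ?p \<noteq> None \<longrightarrow> (\<exists>r>0. (\<forall>\<zeta>\<in>ball 0 r. inf_chart \<zeta> \<notin> K) \<and>
        harmonic_in (\<lambda>\<zeta>. ?g (inf_chart \<zeta>)) (ball 0 r))"
      using harm_inf by blast
  qed (rule harm pole)+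
qed

text \<open>Dividing \<open>b\<close> by \<open>z - c\<close> removes one zero at \<open>c\<close>,
  which makes \<open>green_function_planar\<close> applicable. The resulting
  \<open>s - ln |w - c|\<close> is squeezed between 0 and \<open>- ln |b|\<close>, hence vanishes at
  the boundary, and uniqueness identifies it with the described function
  \<open>green\<close>.\<close>

theorem green_on_sphere:
  assumes U: "open U" and b: "b holomorphic_on U" and b1: "\<And>z. z \<in> U \<Longrightarrow> cmod (b z) < 1"
    and van: "vanishes_at_boundary (\<lambda>z. if b z = 0 then 0 else ln (cmod (b z))) U"
    and fin: "finite {z \<in> U. b z = 0}" and c: "c \<in> U" "b c = 0"
  obtains s where "harmonic_in s U"
    "\<And>w. w \<in> U \<Longrightarrow> w \<noteq> c \<Longrightarrow>
       green (- sphere_chart a ` U) (sphere_chart a c) (sphere_chart a w) = s w - ln (cmod (w - c))"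
    "\<And>w. w \<in> U \<Longrightarrow> w \<noteq> c \<Longrightarrow> ln (cmod (w - c)) \<le> s w"
    "\<And>w. w \<in> U \<Longrightarrow> b w \<noteq> 0 \<Longrightarrow> s w - ln (cmod (w - c)) \<le> - ln (cmod (b w))"
proof -
  define b' where "b' z = (if z = c then deriv b c else (b z - b c) / (z - c))" for z
  have "b' holomorphic_on U"
    unfolding b'_def using b U by (rule pole_lemma_open)
  moreover have b'_le: "cmod (b' z) * cmod (z - c) \<le> 1" if "z \<in> U" for z
    using b1[OF that] by (auto simp: b'_def c norm_divide)
  moreover have "finite {z \<in> U. b' z = 0}"
    by (rule finite_subset[of _ "insert c {z \<in> U. b z = 0}"]) (use fin in \<open>auto simp: b'_def c\<close>)
  ultimately obtain s where s: "harmonic_in s U" "\<And>z. z \<in> U \<Longrightarrow> z \<noteq> c \<Longrightarrow> ln (cmod (z - c)) \<le> s z"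
    "\<And>z. z \<in> U \<Longrightarrow> cmod (b' z) * exp (s z) \<le> 1"
    using green_function_planar[OF U _ c(1), of b'] by blast
  have upper: "s w - ln (cmod (w - c)) \<le> - ln (cmod (b w))" if w: "w \<in> U" "b w \<noteq> 0" for w
  proof -
    have wc: "w \<noteq> c" using w c by auto
    then have "cmod (b w) * exp (s w) \<le> cmod (w - c)"
      using s(3)[OF w(1)] by (simp add: b'_def c norm_divide field_simps)
    then have "ln (cmod (b w) * exp (s w)) \<le> ln (cmod (w - c))"
      using w by (intro ln_mono) auto
    then show ?thesis using w by (simp add: ln_mult)
  qed
  define G where "G w = (if w = c then 0 else s w - ln (cmod (w - c)))" for w
  have vanG: "vanishes_at_boundary G U"
  proof (rule vanishes_at_boundary_le[OF van, of "{z \<in> U. b z = 0}" G 1])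
    show "compact {z \<in> U. b z = 0}" using fin by (rule finite_imp_compact)
    fix z assume "z \<in> U - {z \<in> U. b z = 0}"
    then have z: "z \<in> U" "b z \<noteq> 0" "z \<noteq> c" using c by auto
    show "\<bar>G z\<bar> \<le> 1 * \<bar>if b z = 0 then 0 else ln (cmod (b z))\<bar>"
      using s(2)[OF z(1,3)] upper[OF z(1,2)] z by (simp add: G_def)
  qed auto
  let ?K = "- sphere_chart a ` U" and ?p = "sphere_chart a c"
  let ?g = "\<lambda>p. if p \<in> ?K \<or> p = ?p then 0 else G (sphere_coord a p)"
  have g: "green_fun ?K ?p ?g"
    by (rule green_planar_imp_fun[OF U c(1) refl s(1) _ vanG]) (simp add: G_def)
  have "green ?K ?p = ?g"
    unfolding green_def
  proof (rule the_equality)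
    show "green_fun ?K ?p ?g" by (rule g)
    show "g' = ?g" if g': "green_fun ?K ?p g'" for g'
    proof
      fix p
      consider "p \<in> ?K" | "p = ?p" | w where "p = sphere_chart a w" "w \<in> U" "w \<noteq> c" by auto
      then show "g' p = ?g p"
      proof cases
        case 3
        have "g' (sphere_chart a w) = ?g (sphere_chart a w)"
          by (rule green_planar_unique[OF U c(1) green_fun_imp_planar[OF U c(1) refl g']
                green_fun_imp_planar[OF U c(1) refl g] 3(2,3)])
        then show ?thesis using 3 by simp
      qed (use g' in \<open>auto simp: green_fun_def\<close>)
    qed
  qed
  then show thesis
    using that[OF s(1) _ s(2) upper] by (auto simp: G_def)
qed

section \<open>Rational functions and their leading coefficients\<close>

lemma coprime_no_common_root:
  assumes "coprime p (q :: complex poly)" "poly q z = 0"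
  shows "poly p z \<noteq> 0"
proof
  assume "poly p z = 0"
  with assms(2) have "[:- z, 1:] dvd p" "[:- z, 1:] dvd q" by (simp_all add: poly_eq_0_iff_dvd)
  with assms(1) have "is_unit [:- z, 1:]" by (rule coprime_common_divisor)
  then show False by (simp add: is_unit_iff_degree)
qed

lemma rat_repD:
  assumes "rat_rep f p q"
  shows "q \<noteq> 0" "coprime p q" "f (Some z) = (if poly q z = 0 then None else Some (poly p z / poly q z))"
    "f None = (if degree p > degree q then None
               else if degree p < degree q then Some 0
               else Some (lead_coeff p / lead_coeff q))"
  using assms unfolding rat_rep_def by auto

lemma fin_rat_rep:
  assumes "rat_rep f p q"
  shows "fin (f (Some z)) = poly p z / poly q z"
  using rat_repD(3)[OF assms, of z] by (simp add: fin_def)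

text \<open>Makes the choice in \<open>polar_div\<close> independent of the representation. Both
  quotients agree off finitely many points, so \<open>p * q' = p' * q\<close>. By coprimality a
  point is not a zero of both numerator and denominator, so the orders of the denominators agree,
  and counting roots gives their degrees.\<close>

lemma rat_rep_unique:
  assumes f: "rat_rep f p q" and f': "rat_rep f p' q'"
  shows "order a q = order a q'" "degree p - degree q = degree p' - degree q'"
proof -
  note r = rat_repD[OF f] and r' = rat_repD[OF f']
  have "poly (p * q' - p' * q) z = 0" if "z \<notin> {z. poly (q * q') z = 0}" for z
    using that r(3)[of z] r'(3)[of z] by (simp add: field_simps)
  then have "UNIV \<subseteq> {z. poly (q * q') z = 0} \<union> {z. poly (p * q' - p' * q) z = 0}" by blast
  moreover have "finite {z. poly (q * q') z = 0}" using r(1) r'(1) by (intro poly_roots_finite) simp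
  ultimately have "infinite {z. poly (p * q' - p' * q) z = 0}"
    using infinite_UNIV_char_0[where 'a = complex] by (meson finite_UnI finite_subset)
  then have eq: "p * q' = p' * q" using poly_roots_finite[of "p * q' - p' * q"] by auto
  have ord: "order a q = order a q'" for a
  proof (cases "p = 0")
    case True
    then have "p' = 0" using eq r(1) by simp
    with True have "poly q a \<noteq> 0" "poly q' a \<noteq> 0"
      using coprime_no_common_root[OF r(2)] coprime_no_common_root[OF r'(2)] by fastforce+
    then show ?thesis by (simp add: order_0I)
  next
    case False
    then have "p' \<noteq> 0" using eq r'(1) by auto
    then have sum: "order a p + order a q' = order a p' + order a q"
      using order_mult[of p q' a] order_mult[of p' q a] eq False r(1) r'(1) by simp
    have "order a p = 0 \<or> order a q = 0" "order a p' = 0 \<or> order a q' = 0"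
      using coprime_no_common_root[OF r(2), of a] coprime_no_common_root[OF r'(2), of a]
      by (auto simp: order_root)
    with sum show ?thesis by arith
  qed
  then show "order a q = order a q'" .
  have roots: "{z. poly q z = 0} = {z. poly q' z = 0}"
    using ord r(1) r'(1) by (simp add: order_root)
  have "degree q = degree (\<Prod>z|poly q z = 0. [:- z, 1:] ^ order z q)"
    using arg_cong[OF complex_poly_decompose[of q], of degree] r(1) by simp
  also have "\<dots> = degree (\<Prod>z|poly q' z = 0. [:- z, 1:] ^ order z q')"
    by (simp only: roots ord)
  also have "\<dots> = degree q'"
    using arg_cong[OF complex_poly_decompose[of q'], of degree] r'(1) by simp
  finally have deg: "degree q = degree q'" .
  show "degree p - degree q = degree p' - degree q'"
  proof (cases "p = 0")
    case True
    then have "p' = 0" using eq r(1) by simp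
    then show ?thesis using True by simp
  next
    case False
    then have "p' \<noteq> 0" using eq r'(1) by auto
    then have "degree p + degree q' = degree p' + degree q"
      using eq False r(1) r'(1) by (metis degree_mult_eq)
    then show ?thesis using deg by simp
  qed
qed

lemma polar_div_eq:
  assumes "rat_rep f p q"
  shows "polar_div f c = (case c of Some a \<Rightarrow> order a q | None \<Rightarrow> degree p - degree q)"
  unfolding polar_div_def
proof (rule some_equality)
  show "\<exists>p' q'. rat_rep f p' q' \<and> (case c of None \<Rightarrow> degree p - degree q | Some a \<Rightarrow> order a q) =
      (case c of None \<Rightarrow> degree p' - degree q' | Some a \<Rightarrow> order a q')"
    using assms by blast
next
  fix k assume "\<exists>p' q'. rat_rep f p' q' \<and> k = (case c of None \<Rightarrow> degree p' - degree q' | Some a \<Rightarrow> order a q')"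
  then obtain p' q' where "rat_rep f p' q'" "k = (case c of None \<Rightarrow> degree p' - degree q' | Some a \<Rightarrow> order a q')"
    by blast
  then show "k = (case c of None \<Rightarrow> degree p - degree q | Some a \<Rightarrow> order a q)"
    using rat_rep_unique[OF assms] by (cases c) auto
qed

lemma polar_div_eq_0_iff:
  assumes "rat_rep f p q"
  shows "polar_div f c = 0 \<longleftrightarrow> f c \<noteq> None"
  using rat_repD[OF assms] order_root[of q]
  by (cases c) (auto simp: polar_div_eq[OF assms])

lemma coprime_smult_left: "u \<noteq> 0 \<Longrightarrow> coprime p q \<Longrightarrow> coprime (smult u p) (q :: complex poly)"
  unfolding coprime_def by (metis dvd_smult_cancel)

definition rat_fun :: "complex poly \<Rightarrow> complex poly \<Rightarrow> complex option \<Rightarrow> complex option" where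
  "rat_fun p q c = (case c of
     Some z \<Rightarrow> if poly q z = 0 then None else Some (poly p z / poly q z)
   | None \<Rightarrow> if degree p > degree q then None
       else if degree p < degree q then Some 0
       else Some (lead_coeff p / lead_coeff q))"

lemma rat_rep_rat_fun: "q \<noteq> 0 \<Longrightarrow> coprime p q \<Longrightarrow> rat_rep (rat_fun p q) p q"
  by (simp add: rat_rep_def rat_fun_def)

text \<open>The reciprocal polynomial relative to a bound \<open>N\<close> that may exceed the
  degree, so that numerator and denominator can be reversed with the same exponent.\<close>

definition rev_poly :: "nat \<Rightarrow> complex poly \<Rightarrow> complex poly" where
  "rev_poly N p = (\<Sum>i\<le>N. monom (coeff p i) (N - i))"

lemma poly_rev_poly:
  assumes "degree p \<le> N" "w \<noteq> 0"
  shows "poly (rev_poly N p) w = w ^ N * poly p (1 / w)"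
proof -
  have "poly p (1 / w) = (\<Sum>i\<le>N. coeff p i * (1 / w) ^ i)"
    unfolding poly_altdef by (rule sum.mono_neutral_left) (use assms(1) coeff_eq_0[of p] in auto)
  moreover have "w ^ N * (coeff p i * (1 / w) ^ i) = coeff p i * w ^ (N - i)" if "i \<le> N" for i
    using that assms(2) by (simp add: power_diff power_one_over field_simps)
  then have "(\<Sum>i\<le>N. w ^ N * (coeff p i * (1 / w) ^ i)) = (\<Sum>i\<le>N. coeff p i * w ^ (N - i))"
    by (intro sum.cong) auto
  ultimately show ?thesis
    by (simp only: rev_poly_def poly_sum poly_monom sum_distrib_left)
qed

lemma poly_rev_poly_0: "poly (rev_poly N p) 0 = coeff p N"
proof -
  have "poly (rev_poly N p) 0 = (\<Sum>i\<le>N. if i = N then coeff p i else 0)"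
    unfolding rev_poly_def poly_sum poly_monom by (intro sum.cong) auto
  then show ?thesis by simp
qed

lemma poly_over_power_tendsto:
  fixes p :: "complex poly"
  assumes "degree p \<le> N"
  shows "((\<lambda>z. poly p z / z ^ N) \<longlongrightarrow> coeff p N) at_infinity"
proof -
  have "((\<lambda>z. 1 / z) \<longlongrightarrow> 0) (at_infinity :: complex filter)"
    by (rule tendsto_divide_0[OF tendsto_const filterlim_ident])
  then have "((\<lambda>z. poly (rev_poly N p) (1 / z)) \<longlongrightarrow> poly (rev_poly N p) 0) at_infinity"
    by (intro tendsto_intros)
  moreover have "\<forall>\<^sub>F z in at_infinity. poly (rev_poly N p) (1 / z) = poly p z / z ^ N"
    using eventually_not_equal_at_infinity[of 0]
  proof eventually_elim
    case (elim z)
    then show ?case using poly_rev_poly[OF assms, of "1 / z"] by (simp add: power_one_over field_simps)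
  qed
  ultimately show ?thesis
    by (simp add: poly_rev_poly_0 tendsto_cong)
qed

text \<open>Complex counterpart of \<open>real_filter\<close>: limits are proved for all complex
  approaches and then restricted to the real line.\<close>

definition sphere_filter :: "complex option \<Rightarrow> complex filter" where
  "sphere_filter c = (case c of Some a \<Rightarrow> at a | None \<Rightarrow> at_infinity)"

lemma filterlim_of_real_sphere:
  assumes "c \<in> Rbar"
  shows "filterlim complex_of_real (sphere_filter c) (real_filter c)"
proof (cases c)
  case None
  have "filterlim (\<lambda>x::real. norm (complex_of_real x)) at_top at_infinity"
    using filterlim_norm_at_top by (simp add: real_norm_def[symmetric] del: real_norm_def)
  then have "filterlim complex_of_real at_infinity at_infinity"
    by (rule filterlim_norm_at_top_imp_at_infinity)
  then show ?thesis by (simp add: None sphere_filter_def real_filter_def)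
next
  case (Some a)
  then obtain x where x: "a = of_real x" using assms by (auto simp: Rbar_def)
  have "filterlim complex_of_real (at (of_real x)) (at x)"
    unfolding filterlim_at by (auto intro!: tendsto_intros simp: eventually_at_filter)
  then show ?thesis by (simp add: Some x sphere_filter_def real_filter_def)
qed

lemma real_filter_neq_bot: "real_filter c \<noteq> bot"
  using trivial_limit_at_infinity[where 'a = real]
  by (cases c) (simp_all add: real_filter_def)

lemma lead_coef_eqI:
  assumes "c \<in> Rbar" "((\<lambda>z. fin (F (Some z)) / rr z c ^ d) \<longlongrightarrow> l) (sphere_filter c)"
  shows "lead_coef F c d = l"
  unfolding lead_coef_def
  by (rule tendsto_Lim[OF real_filter_neq_bot])
     (rule filterlim_compose[OF assms(2) filterlim_of_real_sphere[OF assms(1)]])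

text \<open>The pole of \<open>F\<close> at \<open>c\<close> has order at most \<open>d\<close>,
  which the \<open>d\<close>-th power of \<open>rr\<close> compensates.\<close>

lemma leading_limit_exists:
  assumes F: "rat_rep F p q" and d: "polar_div F c \<le> d"
  shows "\<exists>l. ((\<lambda>z. fin (F (Some z)) / rr z c ^ d) \<longlongrightarrow> l) (sphere_filter c)"
proof (cases c)
  case None
  then have "degree p \<le> degree q + d" using d by (simp add: polar_div_eq[OF F])
  then have "((\<lambda>z. (poly p z / z ^ (degree q + d)) / (poly q z / z ^ degree q)) \<longlongrightarrow>
      coeff p (degree q + d) / lead_coeff q) at_infinity"
    using rat_repD(1)[OF F] by (intro tendsto_divide poly_over_power_tendsto) auto
  moreover have "\<forall>\<^sub>F z in at_infinity. (poly p z / z ^ (degree q + d)) / (poly q z / z ^ degree q) =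
      fin (F (Some z)) / rr z c ^ d"
    using eventually_not_equal_at_infinity[of 0]
    by eventually_elim (simp add: None rr_def fin_rat_rep[OF F] power_add field_simps)
  ultimately show ?thesis
    by (auto simp: None sphere_filter_def dest: tendsto_cong[THEN iffD1])
next
  case (Some a)
  obtain q1 where q1: "q = [:- a, 1:] ^ order a q * q1" "\<not> [:- a, 1:] dvd q1"
    using order_decomp[OF rat_repD(1)[OF F], of a] by blast
  define k where "k = order a q"
  have "k \<le> d" using d by (simp add: Some polar_div_eq[OF F] k_def)
  have nz: "poly q1 a \<noteq> 0" using q1(2) by (simp add: poly_eq_0_iff_dvd)
  have q: "poly q z = (z - a) ^ k * poly q1 z" for z
    by (subst q1(1)) (simp add: k_def)
  \<comment> \<open>\<open>rr\<close> is built from \<open>a - z\<close> but \<open>order\<close>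
    refers to \<open>z - a\<close>; this accounts for the sign \<open>(-1) ^ k\<close>.\<close>
  have "((\<lambda>z. poly p z * (a - z) ^ (d - k) * (-1) ^ k / poly q1 z) \<longlongrightarrow>
      poly p a * (a - a) ^ (d - k) * (-1) ^ k / poly q1 a) (at a)"
    using nz by (intro tendsto_intros) auto
  moreover have "\<forall>\<^sub>F z in at a. poly p z * (a - z) ^ (d - k) * (-1) ^ k / poly q1 z =
      fin (F (Some z)) / rr z c ^ d"
  proof -
    have "\<forall>\<^sub>F z in at a. z \<noteq> a" by (simp add: eventually_at_filter)
    then show ?thesis
    proof eventually_elim
      case (elim z)
      have "(a - z) ^ d = (a - z) ^ (d - k) * (a - z) ^ k"
        using \<open>k \<le> d\<close> by (simp flip: power_add)
      also have "(a - z) ^ k = (-1) ^ k * (z - a) ^ k"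
        by (simp flip: power_mult_distrib)
      finally show ?case
        using elim by (simp add: Some rr_def fin_rat_rep[OF F] q power_one_over)
    qed
  qed
  ultimately show ?thesis
    by (auto simp: Some sphere_filter_def dest: tendsto_cong[THEN iffD1])
qed

section \<open>The leading coefficient of the extremal function\<close>

lemma Lspace_iff:
  assumes "rat_rep f p q"
  shows "f \<in> Lspace D \<longleftrightarrow> (\<forall>c. int (polar_div f c) \<le> D c)"
  using assms by (auto simp: Lspace_def rational_fun_def)

text \<open>The addition \<open>l >= 1\<close> for \<open>D c = 0\<close> concerns a point that is
  no pole: there \<open>l\<close> is the limit of \<open>F\<close> itself and has to avoid the cut
  of the inverse Joukowski map, up to its endpoint 1.\<close>

lemma extremal_leading_limit:
  assumes E: "sphere_compact E" "c \<notin> E" "c \<in> Rbar" and D: "\<forall>c. D c \<ge> 0"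
    and F: "is_extremal E D c F" "rat_rep F p q"
  obtains l :: real where "l > 0" "D c = 0 \<Longrightarrow> l \<ge> 1"
    "((\<lambda>z. fin (F (Some z)) / rr z c ^ nat (D c)) \<longlongrightarrow> of_real l) (sphere_filter c)"
proof -
  define d where "d = nat (D c)"
  have FL: "F \<in> Lspace D" and Fsup: "sup_le1 E F"
    and max: "\<And>G. G \<in> Lspace D \<Longrightarrow> sup_le1 E G \<Longrightarrow> Re (lead_coef G c d) \<le> Re (lead_coef F c d)"
    using F(1) by (auto simp: is_extremal_def d_def)
  have polF: "int (polar_div F c) \<le> D c" for c using FL Lspace_iff[OF F(2)] by simp
  have "polar_div F c \<le> d" using polF[of c] by (simp add: d_def)
  then obtain l where l: "((\<lambda>z. fin (F (Some z)) / rr z c ^ d) \<longlongrightarrow> l) (sphere_filter c)"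
    using leading_limit_exists[OF F(2)] by blast
  have lF: "lead_coef F c d = l" by (rule lead_coef_eqI[OF E(3) l])
  have rot: "Re (u * l) \<le> Re l" if u: "cmod u = 1" for u
  proof -
    have "u \<noteq> 0" using u by auto
    define G where "G x = map_option (\<lambda>w. u * w) (F x)" for x
    have G: "rat_rep G (smult u p) q"
      using rat_repD[OF F(2)] \<open>u \<noteq> 0\<close> by (auto simp: rat_rep_def G_def coprime_smult_left)
    have "polar_div G c = polar_div F c" for c
      using \<open>u \<noteq> 0\<close> by (simp add: polar_div_eq[OF G] polar_div_eq[OF F(2)] split: option.split)
    then have "G \<in> Lspace D" using polF by (simp add: Lspace_iff[OF G])
    moreover have "sup_le1 E G"
      unfolding sup_le1_def
    proof
      fix x assume "x \<in> E"
      then obtain w where "F x = Some w" "cmod w \<le> 1" using Fsup unfolding sup_le1_def by blast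
      then show "\<exists>w. G x = Some w \<and> cmod w \<le> 1" using u by (simp add: G_def norm_mult)
    qed
    moreover have "lead_coef G c d = u * l"
    proof (rule lead_coef_eqI[OF E(3)])
      have "fin (G (Some z)) = u * fin (F (Some z))" for z
        by (simp add: fin_rat_rep[OF G] fin_rat_rep[OF F(2)])
      then show "((\<lambda>z. fin (G (Some z)) / rr z c ^ d) \<longlongrightarrow> u * l) (sphere_filter c)"
        using tendsto_mult_left[OF l, of u] by simp
    qed
    ultimately show ?thesis using max lF by metis
  qed
  \<comment> \<open>Rotation by \<open>cnj l / |l|\<close> turns \<open>l\<close> into
    \<open>|l|\<close>, so extremality gives \<open>|l| <= Re l\<close>.\<close>
  have norm_le: "cmod l \<le> Re l"
  proof (cases "l = 0")
    case False
    have "cnj l / of_real (cmod l) * l = of_real (cmod l)"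
      using False by (simp add: complex_norm_square[symmetric] mult.commute power2_eq_square field_simps)
    moreover have "cmod (cnj l / of_real (cmod l)) = 1" using False by (simp add: norm_divide)
    ultimately show ?thesis using rot[of "cnj l / of_real (cmod l)"] by simp
  qed simp
  then have lR: "l = of_real (Re l)"
  proof -
    have "(cmod l)\<^sup>2 \<le> (Re l)\<^sup>2" using norm_le by (intro power_mono) auto
    then have "Im l = 0" by (simp add: cmod_power2)
    then show ?thesis by (simp add: complex_eq_iff)
  qed
  \<comment> \<open>\<open>N / M\<close> represents the \<open>d\<close>-th power of
    \<open>rr\<close> as a reduced fraction.\<close>
  define N where "N = (case c of None \<Rightarrow> [:0, 1:] ^ d | Some a \<Rightarrow> (1 :: complex poly))"
  define M where "M = (case c of None \<Rightarrow> (1 :: complex poly) | Some a \<Rightarrow> [:a, -1:] ^ d)"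
  have M: "M \<noteq> 0" "N \<noteq> 0" by (auto simp: M_def N_def split: option.splits)
  have cop: "coprime N M" by (auto simp: M_def N_def split: option.splits)
  \<comment> \<open>\<open>K\<close> bounds this competitor on \<open>E\<close>, which stays away
    from \<open>c\<close>. For \<open>d = 0\<close> the competitor is the constant 1; the exact
    value \<open>K = 1\<close> then yields \<open>l >= 1\<close>.\<close>
  have "\<exists>K\<ge>1. (d = 0 \<longrightarrow> K = 1) \<and> (\<forall>x\<in>E. \<exists>w. rat_fun N M x = Some w \<and> cmod w \<le> K)"
  proof (cases c)
    case None
    then have "bounded {z. Some z \<in> E}" using E by (simp add: sphere_compact_def)
    then obtain B where B: "\<And>z. Some z \<in> E \<Longrightarrow> cmod z \<le> B" unfolding bounded_iff by auto
    have "\<exists>w. rat_fun N M x = Some w \<and> cmod w \<le> max 1 B ^ d" if x: "x \<in> E" for x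
    proof -
      obtain z where z: "x = Some z" using x E(2) None by (cases x) auto
      have "cmod z \<le> max 1 B" using B x z by fastforce
      then have "cmod z ^ d \<le> max 1 B ^ d" by (intro power_mono) auto
      then show ?thesis by (simp add: z rat_fun_def N_def M_def None norm_power)
    qed
    then show ?thesis by (intro exI[of _ "max 1 B ^ d"]) (auto intro: one_le_power)
  next
    case (Some a)
    have "a \<in> - {z. Some z \<in> E}" "open (- {z. Some z \<in> E})"
      using E Some by (auto simp: sphere_compact_def)
    then obtain r where r: "r > 0" "ball a r \<subseteq> - {z. Some z \<in> E}" by (metis openE)
    have "\<exists>w. rat_fun N M x = Some w \<and> cmod w \<le> max 1 (1 / r) ^ d" if x: "x \<in> E" for x
    proof (cases x)
      case None
      have "1 \<le> max 1 (1 / r) ^ d" by (rule one_le_power) simp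
      then show ?thesis
        by (auto simp: None rat_fun_def N_def M_def Some degree_power_eq)
    next
      case (Some z)
      then have "z \<notin> ball a r" using r(2) x by auto
      then have z: "cmod (a - z) \<ge> r" "z \<noteq> a" using r(1) by (auto simp: dist_norm)
      then have "1 / cmod (a - z) \<le> 1 / r" using r(1) by (intro divide_left_mono) auto
      then have "(1 / cmod (a - z)) ^ d \<le> max 1 (1 / r) ^ d"
        by (intro power_mono) auto
      then show ?thesis
        using z(2) by (simp add: Some rat_fun_def N_def M_def \<open>c = Some a\<close> norm_divide norm_power power_one_over)
    qed
    then show ?thesis by (intro exI[of _ "max 1 (1 / r) ^ d"]) (auto intro: one_le_power)
  qed
  then obtain K where K: "K \<ge> 1" "d = 0 \<Longrightarrow> K = 1"
    "\<And>x. x \<in> E \<Longrightarrow> \<exists>w. rat_fun N M x = Some w \<and> cmod w \<le> K" by metis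
  define G where "G x = map_option (\<lambda>w. of_real (1 / K) * w) (rat_fun N M x)" for x
  have "complex_of_real (1 / K) \<noteq> 0" using K(1) by simp
  then have G: "rat_rep G (smult (of_real (1 / K)) N) M"
    using rat_repD[OF rat_rep_rat_fun[OF M(1) cop]] by (auto simp: rat_rep_def G_def coprime_smult_left)
  have "int (polar_div G x) \<le> D x" for x
  proof -
    have "order z M = (if c = Some z then d else 0)" for z
    proof (cases c)
      case (Some a)
      have "[:a, -1:] = smult (-1) [:- a, 1:]" by simp
      then have "M = smult ((-1) ^ d) ([:- a, 1:] ^ d)"
        by (simp only: M_def Some option.case smult_power)
      then have M_eq: "order z M = order z ([:- a, 1:] ^ d)"
        by (simp add: order_smult)
      show ?thesis
      proof (cases "z = a")
        case True
        then show ?thesis using M_eq order_power_n_n[of a d] by (simp add: Some)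
      next
        case False
        then have "poly ([:- a, 1:] ^ d) z \<noteq> 0" by (simp add: poly_power)
        then show ?thesis using M_eq False by (simp add: Some order_0I)
      qed
    qed (simp add: M_def)
    moreover have "degree N - degree M = (if c = None then d else 0)"
      by (auto simp: N_def M_def degree_power_eq split: option.splits)
    ultimately have "polar_div G x = (if x = c then d else 0)"
      using \<open>complex_of_real (1 / K) \<noteq> 0\<close> by (auto simp: polar_div_eq[OF G] split: option.splits)
    then show ?thesis using D by (simp add: d_def)
  qed
  then have "G \<in> Lspace D" by (simp add: Lspace_iff[OF G])
  moreover have "sup_le1 E G"
    unfolding sup_le1_def
  proof
    fix x assume "x \<in> E"
    then obtain w where "rat_fun N M x = Some w" "cmod w \<le> K" using K(3) by blast
    then show "\<exists>w. G x = Some w \<and> cmod w \<le> 1" using K(1) by (simp add: G_def norm_divide)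
  qed
  moreover have "lead_coef G c d = of_real (1 / K)"
  proof (rule lead_coef_eqI[OF E(3)])
    have "\<forall>\<^sub>F z in sphere_filter c. of_real (1 / K) = fin (G (Some z)) / rr z c ^ d"
    proof (cases c)
      case None
      show ?thesis
        unfolding None sphere_filter_def option.case using eventually_not_equal_at_infinity[of 0]
        by eventually_elim (simp add: fin_rat_rep[OF G] N_def M_def rr_def None)
    next
      case (Some a)
      have "\<forall>\<^sub>F z in at a. z \<noteq> a" by (simp add: eventually_at_filter)
      then show ?thesis
        unfolding Some sphere_filter_def option.case
        by eventually_elim (simp add: fin_rat_rep[OF G] N_def M_def rr_def Some power_one_over)
    qed
    then show "((\<lambda>z. fin (G (Some z)) / rr z c ^ d) \<longlongrightarrow> of_real (1 / K)) (sphere_filter c)"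
      by (rule tendsto_eventually[OF eventually_mono]) simp
  qed
  ultimately have ge: "1 / K \<le> Re l" using max[of G] lF by simp
  moreover have "1 / K > 0" using K(1) by simp
  ultimately have "Re l > 0" by linarith
  moreover have "Re l \<ge> 1" if "D c = 0"
    using ge K(2) that by (simp add: d_def)
  moreover have "((\<lambda>z. fin (F (Some z)) / rr z c ^ nat (D c)) \<longlongrightarrow> of_real (Re l)) (sphere_filter c)"
    using l lR by (simp add: d_def)
  ultimately show thesis by (rule that)
qed

section \<open>The inverse Joukowski map\<close>

text \<open>The inverse Joukowski map with values in the closed unit disc: if \<open>w = (v + 1 / v) / 2\<close>, then
  \<open>(w - 1) / (w + 1)\<close> is the square of \<open>(1 - v) / (1 + v)\<close>.  On \<open>[-1, 1]\<close> the choice of \<open>v\<close> is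
  immaterial; at \<open>w = -1\<close> division by zero makes it \<open>1\<close>.\<close>

definition joukowski_inv :: "complex option \<Rightarrow> complex" where
  "joukowski_inv x = (case x of None \<Rightarrow> 0
     | Some w \<Rightarrow> (1 - csqrt ((w - 1) / (w + 1))) / (1 + csqrt ((w - 1) / (w + 1))))"

lemma Re_csqrt_nonneg: "0 \<le> Re (csqrt z)"
  using csqrt_principal[of z] by auto

lemma one_plus_csqrt_neq_0: "1 + csqrt z \<noteq> 0"
proof
  assume "1 + csqrt z = 0"
  then have "csqrt z = -1" by (simp add: add_eq_0_iff)
  then show False using Re_csqrt_nonneg[of z] by (simp only:) simp
qed

text \<open>Off the cut the principal root lies in the open right half-plane, which the Cayley
  transform maps into the unit disc.\<close>

lemma norm_cayley_csqrt_less_1: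
  assumes "z \<notin> \<real>\<^sub>\<le>\<^sub>0"
  shows "cmod ((1 - csqrt z) / (1 + csqrt z)) < 1"
proof -
  obtain \<sigma> where \<sigma>: "\<sigma> = csqrt z" by blast
  have "\<sigma>\<^sup>2 = z" by (simp add: \<sigma>)
  have "Re \<sigma> \<noteq> 0"
  proof
    assume "Re \<sigma> = 0"
    then have "Re z \<le> 0" "Im z = 0" by (simp_all flip: \<open>\<sigma>\<^sup>2 = z\<close> add: power2_eq_square)
    then show False using assms by (simp add: complex_nonpos_Reals_iff)
  qed
  then have "0 < Re \<sigma>" using Re_csqrt_nonneg[of z] unfolding \<sigma> by linarith
  then have "(cmod (1 - \<sigma>))\<^sup>2 < (cmod (1 + \<sigma>))\<^sup>2"
    unfolding cmod_power2 by (simp add: power2_eq_square algebra_simps)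
  then have "cmod (1 - \<sigma>) < cmod (1 + \<sigma>)"
    by (rule power_less_imp_less_base) simp
  moreover have "1 + \<sigma> \<noteq> 0" unfolding \<sigma> by (rule one_plus_csqrt_neq_0)
  ultimately show ?thesis unfolding \<sigma>[symmetric] by (simp add: norm_divide)
qed

text \<open>With \<sigma> the root of (w - 1) / (w + 1), the claim is 2 + 2 \<sigma>^2 = 2 w (1 -
  \<sigma>^2). The default value at \<open>w = -1\<close> would give \<open>2 = -2\<close>.\<close>

lemma joukowski_inv_Some:
  assumes "w \<noteq> -1"
  shows "joukowski_inv (Some w) \<noteq> 0"
    and "joukowski_inv (Some w) + 1 / joukowski_inv (Some w) = 2 * w"
proof -
  define \<sigma> where "\<sigma> = csqrt ((w - 1) / (w + 1))"
  have w1: "w + 1 \<noteq> 0" using assms by (simp add: add_eq_0_iff2)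
  have \<sigma>2: "\<sigma>\<^sup>2 = (w - 1) / (w + 1)" by (simp add: \<sigma>_def)
  then have e: "\<sigma>\<^sup>2 * (w + 1) = w - 1" using w1 by simp
  have "\<sigma> \<noteq> 1" using e by auto
  moreover have "1 + \<sigma> \<noteq> 0" unfolding \<sigma>_def by (rule one_plus_csqrt_neq_0)
  moreover have v: "joukowski_inv (Some w) = (1 - \<sigma>) / (1 + \<sigma>)"
    by (simp add: joukowski_inv_def \<sigma>_def)
  ultimately show "joukowski_inv (Some w) \<noteq> 0" by simp
  have "(1 - \<sigma>) / (1 + \<sigma>) + 1 / ((1 - \<sigma>) / (1 + \<sigma>)) = ((1 - \<sigma>)\<^sup>2 + (1 + \<sigma>)\<^sup>2) / ((1 + \<sigma>) * (1 - \<sigma>))"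
    using \<open>\<sigma> \<noteq> 1\<close> \<open>1 + \<sigma> \<noteq> 0\<close> by (simp add: add_frac_eq power2_eq_square)
  also have "\<dots> = 2 * w"
  proof -
    have "(1 - \<sigma>)\<^sup>2 + (1 + \<sigma>)\<^sup>2 = 2 * w * ((1 + \<sigma>) * (1 - \<sigma>))"
      using e by algebra
    then show ?thesis using \<open>\<sigma> \<noteq> 1\<close> \<open>1 + \<sigma> \<noteq> 0\<close> by (simp add: nonzero_divide_eq_eq)
  qed
  finally show "joukowski_inv (Some w) + 1 / joukowski_inv (Some w) = 2 * w" by (simp add: v)
qed

text \<open>The confocal ellipses with foci \<open>1\<close> and \<open>-1\<close> are the images of circles under the Joukowski map.\<close>

lemma joukowski_ellipse:
  fixes v w :: complex
  assumes "v \<noteq> 0" "v + 1 / v = 2 * w"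
  shows "cmod v + 1 / cmod v = cmod (w - 1) + cmod (w + 1)"
proof -
  have e: "v\<^sup>2 + 1 = 2 * w * v" using assms by (simp add: field_simps power2_eq_square)
  have "(v - 1)\<^sup>2 = 2 * v * (w - 1)" "(v + 1)\<^sup>2 = 2 * v * (w + 1)"
    using e by (simp_all add: power2_eq_square algebra_simps)
  then have "(cmod (v - 1))\<^sup>2 = 2 * cmod v * cmod (w - 1)" "(cmod (v + 1))\<^sup>2 = 2 * cmod v * cmod (w + 1)"
    by (simp_all add: norm_power[symmetric] norm_mult)
  moreover have "(cmod (v - 1))\<^sup>2 + (cmod (v + 1))\<^sup>2 = 2 * (cmod v)\<^sup>2 + 2"
    unfolding cmod_power2 by (simp add: power2_eq_square algebra_simps)
  ultimately have "(cmod v)\<^sup>2 + 1 = cmod v * (cmod (w - 1) + cmod (w + 1))"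
    by (simp add: algebra_simps)
  then show ?thesis using assms(1) by (simp add: field_simps power2_eq_square)
qed

text \<open>This Moebius map sends 1 to 0 and -1 to infinity, hence the segment onto the closed
  negative half-line. It places the branch cut of \<open>csqrt\<close> exactly on E_n.\<close>

lemma cayley_nonpos_Reals_iff:
  fixes w :: complex
  assumes "w \<noteq> -1"
  shows "(w - 1) / (w + 1) \<in> \<real>\<^sub>\<le>\<^sub>0 \<longleftrightarrow> (\<exists>t::real. -1 \<le> t \<and> t \<le> 1 \<and> w = of_real t)"
proof
  have w1: "w + 1 \<noteq> 0" using assms by (simp add: add_eq_0_iff2)
  assume "(w - 1) / (w + 1) \<in> \<real>\<^sub>\<le>\<^sub>0"
  then obtain x :: real where x: "(w - 1) / (w + 1) = of_real x" "x \<le> 0"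
    by (auto elim: nonpos_Reals_cases)
  have "w - 1 = of_real x * (w + 1)" by (rule iffD1[OF nonzero_divide_eq_eq[OF w1] x(1)])
  then have "w * of_real (1 - x) = of_real (1 + x)" by (simp add: algebra_simps)
  then have "w = of_real ((1 + x) / (1 - x))"
    using x(2) by (simp add: nonzero_eq_divide_eq del: of_real_diff of_real_add)
  moreover have "-1 \<le> (1 + x) / (1 - x)" "(1 + x) / (1 - x) \<le> 1"
    using x(2) by (simp_all add: field_simps)
  ultimately show "\<exists>t::real. -1 \<le> t \<and> t \<le> 1 \<and> w = of_real t" by blast
next
  assume "\<exists>t::real. -1 \<le> t \<and> t \<le> 1 \<and> w = of_real t"
  then obtain t :: real where t: "-1 \<le> t" "t \<le> 1" "w = of_real t" by blast
  have "(w - 1) / (w + 1) = of_real ((t - 1) / (t + 1))" by (simp add: t(3))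
  moreover have "(t - 1) / (t + 1) \<le> 0" using t by (intro divide_nonpos_nonneg) auto
  ultimately show "(w - 1) / (w + 1) \<in> \<real>\<^sub>\<le>\<^sub>0" by (simp only: nonpos_Reals_of_real_iff)
qed

section \<open>Rational functions in the chart\<close>

lemma poly_eqI_cofinite:
  fixes p q :: "complex poly"
  assumes "finite A" "\<And>z. z \<notin> A \<Longrightarrow> poly p z = poly q z"
  shows "p = q"
proof -
  have "UNIV \<subseteq> A \<union> {z. poly (p - q) z = 0}" using assms(2) by auto
  then have "infinite {z. poly (p - q) z = 0}"
    using assms(1) infinite_UNIV_char_0[where 'a = complex] by (meson finite_UnI finite_subset)
  then show ?thesis using poly_roots_finite[of "p - q"] by auto
qed

lemma sum_order_roots:
  fixes q :: "complex poly"
  assumes "q \<noteq> 0"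
  shows "(\<Sum>z | poly q z = 0. order z q) = degree q"
proof -
  have "degree q = degree (\<Prod>z|poly q z = 0. [:- z, 1:] ^ order z q)"
    using arg_cong[OF complex_poly_decompose[of q], of degree] assms by simp
  also have "\<dots> = (\<Sum>z | poly q z = 0. order z q)"
    by (subst degree_prod_sum_eq) (auto simp: degree_power_eq)
  finally show ?thesis by simp
qed

text \<open>Translation by \<open>a\<close> and reversal with the common bound \<open>N\<close> turn
  \<open>F (a + 1 / w)\<close> into \<open>P / Q\<close>, with infinity at \<open>w = 0\<close>. The
  zeros of \<open>Q\<close> are the poles of \<open>F\<close> with their multiplicities, so
  \<open>Q\<close> factors over the polar divisor.\<close>

lemma rational_chart_rep:
  assumes F: "rat_rep F p q" and Fa: "F (Some a) = Some t"
  obtains P Q C where "C \<noteq> 0" "Q \<noteq> 0"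
    "\<And>w. F (sphere_chart a w) = (if poly Q w = 0 then None else Some (poly P w / poly Q w))"
    "\<And>w. poly Q w = 0 \<Longrightarrow> poly P w \<noteq> 0"
    "((\<lambda>w. poly P w / poly Q w) \<longlongrightarrow> t) at_infinity" "\<forall>\<^sub>F w in at_infinity. poly Q w \<noteq> 0"
    "finite {c. polar_div F c \<noteq> 0}"
    "\<And>w. poly Q w = C * (\<Prod>c | polar_div F c \<noteq> 0. (w - sphere_coord a c) ^ polar_div F c)"
proof -
  note r = rat_repD[OF F]
  have qa: "poly q a \<noteq> 0" and t: "t = poly p a / poly q a"
    using Fa r(3)[of a] by (auto split: if_splits)
  define N where "N = max (degree p) (degree q)"
  define sh where "sh f = pcompose f [:a, 1:]" for f :: "complex poly"
  have sh: "degree (sh f) = degree f" "coeff (sh f) (degree f) = lead_coeff f"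
      "poly (sh f) w = poly f (a + w)" for f w
    using lead_coeff_comp[of "[:a, 1:]" f]
    by (simp_all add: sh_def degree_pcompose poly_pcompose)
  define P where "P = rev_poly N (sh p)"
  define Q where "Q = rev_poly N (sh q)"
  have P: "poly P w = w ^ N * poly p (a + 1 / w)" and Q: "poly Q w = w ^ N * poly q (a + 1 / w)" if "w \<noteq> 0" for w
    using that by (simp_all add: P_def Q_def poly_rev_poly sh N_def)
  have P0: "poly P 0 = coeff (sh p) N" and Q0: "poly Q 0 = coeff (sh q) N"
    by (simp_all add: P_def Q_def poly_rev_poly_0)
  have lim: "((\<lambda>w. 1 / w) \<longlongrightarrow> 0) (at_infinity :: complex filter)"
    by (rule tendsto_divide_0[OF tendsto_const filterlim_ident])
  have limp: "((\<lambda>w. poly f (a + 1 / w)) \<longlongrightarrow> poly f a) at_infinity" for f :: "complex poly"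
    using tendsto_poly[OF tendsto_add[OF tendsto_const lim], of f a] by simp
  have ev0: "\<forall>\<^sub>F w in at_infinity. w \<noteq> (0::complex)"
    by (rule eventually_not_equal_at_infinity)
  have evQ: "\<forall>\<^sub>F w in at_infinity. poly Q w \<noteq> 0"
    using tendsto_imp_eventually_ne[OF limp[of q] qa] ev0 by eventually_elim (simp add: Q)
  have limPQ: "((\<lambda>w. poly P w / poly Q w) \<longlongrightarrow> t) at_infinity"
  proof (rule Lim_transform_eventually)
    show "((\<lambda>w. poly p (a + 1 / w) / poly q (a + 1 / w)) \<longlongrightarrow> t) at_infinity"
      unfolding t by (intro tendsto_divide limp qa)
    show "\<forall>\<^sub>F w in at_infinity. poly p (a + 1 / w) / poly q (a + 1 / w) = poly P w / poly Q w"
      using ev0 by eventually_elim (simp add: P Q)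
  qed
  have None_cases: "degree p > degree q \<and> poly Q 0 = 0 \<and> poly P 0 \<noteq> 0 \<or>
      degree p < degree q \<and> poly Q 0 \<noteq> 0 \<and> poly P 0 = 0 \<or>
      degree p = degree q \<and> poly Q 0 = lead_coeff q \<and> poly P 0 = lead_coeff p"
  proof (cases "degree p" "degree q" rule: linorder_cases)
    case less
    then have "N = degree q" by (simp add: N_def)
    then show ?thesis
      using less r(1) sh(1)[of p] sh(1,2)[of q] by (simp add: P0 Q0 coeff_eq_0)
  next
    case equal
    then have "N = degree q" by (simp add: N_def)
    then show ?thesis using equal sh(1,2)[of p] sh(1,2)[of q] by (simp add: P0 Q0)
  next
    case greater
    then have "N = degree p" "p \<noteq> 0" by (auto simp: N_def)
    then show ?thesis
      using greater sh(1,2)[of p] sh(1)[of q] by (simp add: P0 Q0 coeff_eq_0)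
  qed
  have FPQ: "F (sphere_chart a w) = (if poly Q w = 0 then None else Some (poly P w / poly Q w))" for w
  proof (cases "w = 0")
    case True
    have "F None = (if poly Q 0 = 0 then None else Some (poly P 0 / poly Q 0))"
      using None_cases
    proof (elim disjE conjE)
      assume "degree p > degree q" "poly Q 0 = 0"
      then show ?thesis by (simp add: r(4))
    next
      assume "degree p < degree q" "poly Q 0 \<noteq> 0" "poly P 0 = 0"
      then show ?thesis by (simp add: r(4))
    next
      assume "degree p = degree q" "poly Q 0 = lead_coeff q" "poly P 0 = lead_coeff p"
      moreover have "lead_coeff q \<noteq> 0" using r(1) by simp
      ultimately show ?thesis unfolding r(4) by (simp only: less_irrefl if_False)
    qed
    then show ?thesis using True by (simp add: sphere_chart_def)
  next
    case False
    then show ?thesis using r(3) by (simp add: sphere_chart_def P Q)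
  qed
  have PQ0: "poly P w \<noteq> 0" if "poly Q w = 0" for w
  proof (cases "w = 0")
    case True
    with that have "poly Q 0 = 0" by simp
    moreover have "lead_coeff q \<noteq> 0" using r(1) by simp
    ultimately show ?thesis using None_cases unfolding True by argo
  next
    case False
    then show ?thesis using that coprime_no_common_root[OF r(2)] by (simp add: P Q)
  qed
  have Qnz: "Q \<noteq> 0"
    using evQ trivial_limit_at_infinity[where 'a = complex] by (auto simp: eventually_const_iff)
  define Z where "Z = {z. poly q z = 0}"
  have Z: "finite Z" using r(1) by (simp add: Z_def poly_roots_finite)
  define S where "S = {c. polar_div F c \<noteq> 0}"
  have S_eq: "S = Some ` Z \<union> (if degree p > degree q then {None} else {})"
  proof -
    have "c \<in> S \<longleftrightarrow> c \<in> Some ` Z \<union> (if degree p > degree q then {None} else {})" for c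
      using r(1) by (cases c) (auto simp: S_def Z_def polar_div_eq[OF F] order_root)
    then show ?thesis by blast
  qed
  have finS: "finite S" using Z by (simp add: S_eq)
  have prodS: "(\<Prod>c\<in>S. (w - sphere_coord a c) ^ polar_div F c) =
      (\<Prod>z\<in>Z. (w - 1 / (z - a)) ^ order z q) * w ^ (degree p - degree q)" for w
  proof -
    have "(\<Prod>c\<in>Some ` Z. (w - sphere_coord a c) ^ polar_div F c) = (\<Prod>z\<in>Z. (w - 1 / (z - a)) ^ order z q)"
      by (subst prod.reindex) (auto simp: sphere_coord_def polar_div_eq[OF F])
    then show ?thesis
      unfolding S_eq using Z
      by (auto simp: sphere_coord_def polar_div_eq[OF F] prod.insert_if mult.commute)
  qed
  \<comment> \<open>Collects the factors \<open>a - z\<close> from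
    \<open>a + 1 / w - z = (a - z) * (w - 1 / (z - a)) / w\<close>.\<close>
  define C where "C = lead_coeff q * (\<Prod>z\<in>Z. (a - z) ^ order z q)"
  have "C \<noteq> 0" using qa r(1) Z by (auto simp: C_def Z_def)
  have decomp: "poly q x = lead_coeff q * (\<Prod>z\<in>Z. (x - z) ^ order z q)" for x
    by (subst complex_poly_decompose[of q, symmetric]) (simp add: poly_prod poly_power Z_def)
  have prodQ: "poly Q w = C * (\<Prod>c\<in>S. (w - sphere_coord a c) ^ polar_div F c)" if "w \<noteq> 0" for w
  proof -
    have "(a + 1 / w - z) ^ order z q = (a - z) ^ order z q * (w - 1 / (z - a)) ^ order z q / w ^ order z q"
      if "z \<in> Z" for z
    proof -
      have "z \<noteq> a" using that qa by (auto simp: Z_def)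
      then have "a + 1 / w - z = (a - z) * (w - 1 / (z - a)) / w"
        using \<open>w \<noteq> 0\<close> by (simp add: divide_simps) (simp add: algebra_simps)
      then show ?thesis by (simp add: power_divide power_mult_distrib)
    qed
    then have "(\<Prod>z\<in>Z. (a + 1 / w - z) ^ order z q) =
        (\<Prod>z\<in>Z. (a - z) ^ order z q) * (\<Prod>z\<in>Z. (w - 1 / (z - a)) ^ order z q) / (\<Prod>z\<in>Z. w ^ order z q)"
      by (simp add: prod_dividef prod.distrib)
    also have "(\<Prod>z\<in>Z. w ^ order z q) = w ^ degree q"
      using sum_order_roots[OF r(1)] by (simp add: power_sum[symmetric] Z_def)
    finally have "poly q (a + 1 / w) = C * (\<Prod>z\<in>Z. (w - 1 / (z - a)) ^ order z q) / w ^ degree q"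
      by (simp add: decomp C_def)
    \<comment> \<open>The truncated difference of degrees is the pole order at infinity, and it is 0
      if there is no pole.\<close>
    moreover have "w ^ N = w ^ (degree p - degree q) * w ^ degree q"
      by (simp add: N_def max_def flip: power_add)
    ultimately show ?thesis using \<open>w \<noteq> 0\<close> by (simp add: Q prodS)
  qed
  \<comment> \<open>The factorisation has been computed for nonzero \<open>w\<close>; as an identity
    of polynomials it extends to \<open>w = 0\<close>.\<close>
  define R where "R = smult C (\<Prod>c\<in>S. [:- sphere_coord a c, 1:] ^ polar_div F c)"
  have R: "poly R w = C * (\<Prod>c\<in>S. (w - sphere_coord a c) ^ polar_div F c)" for w
    by (simp add: R_def poly_prod poly_power)
  have "Q = R"
    by (rule poly_eqI_cofinite[of "{0}"]) (auto simp: R prodQ)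
  then have "poly Q w = C * (\<Prod>c\<in>S. (w - sphere_coord a c) ^ polar_div F c)" for w
    using R by simp
  then show thesis
    using that[OF \<open>C \<noteq> 0\<close> Qnz FPQ PQ0 limPQ evQ] finS by (simp add: S_def)
qed

lemma joukowski_inv_tendsto:
  assumes "w \<noteq> -1" "(w - 1) / (w + 1) \<in> \<real>\<^sub>\<le>\<^sub>0 \<Longrightarrow> w = 1" "(f \<longlongrightarrow> w) net"
  shows "((\<lambda>x. joukowski_inv (Some (f x))) \<longlongrightarrow> joukowski_inv (Some w)) net"
proof -
  let ?m = "\<lambda>w::complex. (w - 1) / (w + 1)"
  have "w + 1 \<noteq> 0" using assms(1) by (simp add: add_eq_0_iff2)
  then have m: "((\<lambda>x. ?m (f x)) \<longlongrightarrow> ?m w) net"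
    by (intro tendsto_intros assms)
  have "((\<lambda>x. csqrt (?m (f x))) \<longlongrightarrow> csqrt (?m w)) net"
  proof (cases "?m w \<in> \<real>\<^sub>\<le>\<^sub>0")
    case True
    then have w: "w = 1" by (rule assms(2))
    have "((\<lambda>x. sqrt (cmod (?m (f x)))) \<longlongrightarrow> sqrt (cmod (?m w))) net"
      by (intro tendsto_intros m)
    then have "((\<lambda>x. cmod (csqrt (?m (f x)))) \<longlongrightarrow> 0) net" by (simp add: w)
    then have "((\<lambda>x. csqrt (?m (f x))) \<longlongrightarrow> 0) net" by (rule tendsto_norm_zero_cancel)
    then show ?thesis by (simp add: w)
  next
    case False
    then show ?thesis using m by (intro isCont_tendsto_compose[of "?m w" csqrt]) (auto simp: continuous_at_csqrt)
  qed
  then show ?thesis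
    unfolding joukowski_inv_def option.case by (intro tendsto_intros one_plus_csqrt_neq_0)
qed

text \<open>The values \<open>v\<close> of the inverse tend to 0, and \<open>v + 1 / v = 2 f\<close>
  rewrites \<open>f v\<close> as \<open>(v^2 + 1) / 2\<close>.\<close>

lemma joukowski_inv_at_infinity:
  assumes "filterlim f at_infinity net"
  shows "((\<lambda>x. f x * joukowski_inv (Some (f x))) \<longlongrightarrow> 1 / 2) net"
proof -
  let ?v = "\<lambda>x. joukowski_inv (Some (f x))"
  have inv: "((\<lambda>x. 1 / f x) \<longlongrightarrow> 0) net"
    by (rule tendsto_divide_0[OF tendsto_const assms])
  have nz: "\<forall>\<^sub>F x in net. f x \<notin> {0, -1}"
  proof -
    have "\<forall>\<^sub>F z in at_infinity. z \<notin> {0, -1 :: complex}"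
      using eventually_not_equal_at_infinity[of 0] eventually_not_equal_at_infinity[of "-1"]
      by eventually_elim simp
    then show ?thesis using assms by (rule eventually_compose_filterlim)
  qed
  have "((\<lambda>x. (1 - 1 / f x) / (1 + 1 / f x)) \<longlongrightarrow> (1 - 0) / (1 + 0)) net"
    by (intro tendsto_intros inv) auto
  moreover have "\<forall>\<^sub>F x in net. (1 - 1 / f x) / (1 + 1 / f x) = (f x - 1) / (f x + 1)"
    using nz
  proof eventually_elim
    case (elim x)
    then have "1 - 1 / f x = (f x - 1) / f x" "1 + 1 / f x = (f x + 1) / f x"
      by (simp_all add: diff_divide_distrib add_divide_distrib)
    then show ?case using elim by simp
  qed
  ultimately have "((\<lambda>x. (f x - 1) / (f x + 1)) \<longlongrightarrow> 1) net"
    by (simp add: tendsto_cong)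
  then have "((\<lambda>x. csqrt ((f x - 1) / (f x + 1))) \<longlongrightarrow> csqrt 1) net"
    by (intro isCont_tendsto_compose[of 1 csqrt]) (auto simp: continuous_at_csqrt)
  then have "((\<lambda>x. (1 - csqrt ((f x - 1) / (f x + 1))) / (1 + csqrt ((f x - 1) / (f x + 1)))) \<longlongrightarrow>
      (1 - csqrt 1) / (1 + csqrt 1)) net"
    by (intro tendsto_intros one_plus_csqrt_neq_0)
  then have v: "(?v \<longlongrightarrow> 0) net" by (simp add: joukowski_inv_def)
  have "((\<lambda>x. ((?v x)\<^sup>2 + 1) / 2) \<longlongrightarrow> (0\<^sup>2 + 1) / 2) net"
    by (intro tendsto_intros v) auto
  moreover have "\<forall>\<^sub>F x in net. ((?v x)\<^sup>2 + 1) / 2 = f x * ?v x"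
    using nz
  proof eventually_elim
    case (elim x)
    then have "?v x \<noteq> 0" "?v x + 1 / ?v x = 2 * f x" using joukowski_inv_Some[of "f x"] by auto
    then show ?case by (simp add: field_simps power2_eq_square)
  qed
  ultimately show ?thesis by (simp add: tendsto_cong)
qed

text \<open>Supplies a finite point of E_n. If \<open>p\<close> and \<open>p - q\<close> were both
  constant, so would be \<open>F\<close>; hence one of the values 0 and 1 is attained in the
  plane.\<close>

lemma nonconstant_real_value:
  assumes F: "rat_rep F p q" and nc: "\<not> (\<exists>w. \<forall>z. F z = w)"
  obtains a t where "F (Some a) = Some (of_real t)" "-1 \<le> t" "t \<le> (1::real)"
proof -
  note r = rat_repD[OF F]
  have attained: "\<exists>a. F (Some a) = Some u" if "degree (p - smult u q) > 0" for u
  proof -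
    have "\<not> constant (poly (p - smult u q))" using that by (simp only: constant_degree)
    then obtain a where "poly (p - smult u q) a = 0"
      using fundamental_theorem_of_algebra by blast
    then have a: "poly p a = u * poly q a" by simp
    then have "poly q a \<noteq> 0" using coprime_no_common_root[OF r(2), of a] by auto
    then show ?thesis using r(3)[of a] a by auto
  qed
  have "degree p > 0 \<or> degree q > 0"
  proof (rule ccontr)
    assume "\<not> (degree p > 0 \<or> degree q > 0)"
    then obtain a b where "p = [:a:]" "q = [:b:]" by (metis degree_0_id not_gr_zero degree_eq_zeroE)
    then have "F z = Some (a / b)" for z using r(1,3,4) by (cases z) auto
    with nc show False by blast
  qed
  then have "degree (p - smult 0 q) > 0 \<or> degree (p - smult 1 q) > 0"
  proof (cases "degree p > 0")
    case False
    then show ?thesis using \<open>degree p > 0 \<or> degree q > 0\<close> degree_add_eq_right[of p "- q"] by simp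
  qed simp
  then show thesis
    using attained[of 0] attained[of 1] that[of _ 0] that[of _ 1] by auto
qed

text \<open>The formula for \<open>- ln |B|\<close> is stated off the poles: at a pole both sides
  would be formal values, \<open>ln 0\<close> and the normalised value of \<open>green\<close> at
  its own pole.\<close>

theorem theorem2p10:
  fixes E :: "complex option set" and D :: "complex option \<Rightarrow> int" and xs :: "complex option"
    and n :: nat and F :: "complex option \<Rightarrow> complex option"
  assumes "E \<subseteq> Rbar" and "sphere_compact E" and "E \<noteq> Rbar" and "infinite E"
    and "n \<ge> 1"
    and "finite {c. D c \<noteq> 0}" and "\<forall>c. D c \<ge> 0" and "(\<Sum>c\<in>{c. D c \<noteq> 0}. D c) = int n"
    and "{c. D c \<noteq> 0} \<subseteq> Rbar - E"
    and "xs \<in> Rbar - E"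
    and "is_extremal E D xs F"
    and "\<not> (\<exists>w. \<forall>z. F z = w)"
  shows "\<exists>B. sphere_analytic_on B (- preim_interval F) \<and>
     (\<forall>z\<in>- preim_interval F. polar_div F z = 0 \<longrightarrow>
        - ln (cmod (B z)) = (\<Sum>c\<in>{c. polar_div F c \<noteq> 0}.
                               real (polar_div F c) * green (preim_interval F) c z)) \<and>
     (\<exists>L>0. ((\<lambda>x::real. B (Some (of_real x)) * rr (of_real x) xs ^ nat (D xs))
              \<longlongrightarrow> complex_of_real L) (real_filter xs)) \<and>
     (\<forall>z\<in>- preim_interval F. F z = (if B z = 0 then None else Some ((B z + 1 / B z) / 2)))"
proof -
  obtain p q where F: "rat_rep F p q"
    using assms(11) by (auto simp: is_extremal_def Lspace_def rational_fun_def)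
  obtain a t where t: "F (Some a) = Some (of_real t)" "-1 \<le> t" "t \<le> (1::real)"
    using nonconstant_real_value[OF F assms(12)] by blast
  define K where "K = preim_interval F"
  have K_iff: "p \<in> K \<longleftrightarrow> (\<exists>t::real. -1 \<le> t \<and> t \<le> 1 \<and> F p = Some (of_real t))" for p
    by (simp add: K_def preim_interval_def)
  have aK: "Some a \<in> K" using t K_iff by blast
  obtain P Q C where C: "C \<noteq> 0" "Q \<noteq> 0"
    and FPQ: "\<And>w. F (sphere_chart a w) = (if poly Q w = 0 then None else Some (poly P w / poly Q w))"
    and PQ0: "\<And>w. poly Q w = 0 \<Longrightarrow> poly P w \<noteq> 0"
    and limPQ: "((\<lambda>w. poly P w / poly Q w) \<longlongrightarrow> of_real t) at_infinity"
    and evQ: "\<forall>\<^sub>F w in at_infinity. poly Q w \<noteq> 0"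
    and fin: "finite {c. polar_div F c \<noteq> 0}"
    and prodQ: "\<And>w. poly Q w = C * (\<Prod>c | polar_div F c \<noteq> 0. (w - sphere_coord a c) ^ polar_div F c)"
    by (rule rational_chart_rep[OF F t(1)], rule that, assumption+)
  define U where "U = {w. sphere_chart a w \<notin> K}"
  have K_eq: "- sphere_chart a ` U = K"
  proof -
    have "p \<in> sphere_chart a ` U \<longleftrightarrow> p \<notin> K" for p
      using aK sphere_chart_coord[of p a]
      by (cases "p = Some a") (simp_all add: sphere_chart_image_iff U_def)
    then show ?thesis by blast
  qed

  \<comment> \<open>The function \<open>B\<close> off E_n\<close>
  define B where "B z = joukowski_inv (F z)" for z
  have B_None: "F z = None \<Longrightarrow> B z = 0" for z by (simp add: B_def joukowski_inv_def)
  have not_m1: "v \<noteq> -1" if "F z = Some v" "z \<notin> K" for z v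
  proof
    assume "v = -1"
    then show False using that K_iff[of z] by (auto dest: spec[of _ "-1"])
  qed
  have B_Some: "B z \<noteq> 0" "B z + 1 / B z = 2 * v" if "F z = Some v" "z \<notin> K" for z v
    using joukowski_inv_Some[OF not_m1[OF that]] by (simp_all add: B_def that)
  have B_lt_1: "cmod (B z) < 1" if "z \<notin> K" for z
  proof (cases "F z")
    case (Some v)
    then have "(v - 1) / (v + 1) \<notin> \<real>\<^sub>\<le>\<^sub>0"
      using that K_iff[of z] cayley_nonpos_Reals_iff[OF not_m1[OF Some that]] by auto
    then show ?thesis
      using norm_cayley_csqrt_less_1 by (simp add: B_def Some joukowski_inv_def)
  qed (simp add: B_None)

  \<comment> \<open>Holomorphy of \<open>B\<close> in the chart\<close>
  define b where "b w = B (sphere_chart a w)" for w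
  \<comment> \<open>The Cayley transform of \<open>P / Q\<close> with denominators cleared: it is
    defined at the poles of \<open>F\<close> as well, where it equals 1.\<close>
  define M where "M w = (poly P w - poly Q w) / (poly P w + poly Q w)" for w
  have M: "M w = (if poly Q w = 0 then 1 else (poly P w / poly Q w - 1) / (poly P w / poly Q w + 1))"
    if "poly P w + poly Q w \<noteq> 0" for w
    using that by (auto simp: M_def divide_simps)
  \<comment> \<open>\<open>P + Q = 0\<close> means \<open>F = -1\<close>, a value taken only on
    \<open>K\<close>. Thus \<open>U\<close> is the preimage of the cut plane under \<open>M\<close>;
    openness of \<open>U\<close> and holomorphy of \<open>b\<close> both follow.\<close>
  have U_eq: "U = {w \<in> {w. poly P w + poly Q w \<noteq> 0}. M w \<in> - \<real>\<^sub>\<le>\<^sub>0}"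
  proof -
    have "w \<in> U \<longleftrightarrow> poly P w + poly Q w \<noteq> 0 \<and> M w \<notin> \<real>\<^sub>\<le>\<^sub>0" for w
    proof (cases "poly Q w = 0")
      case True
      then show ?thesis using PQ0[of w] M[of w] FPQ[of w] by (simp add: U_def K_iff)
    next
      case False
      define v where "v = poly P w / poly Q w"
      have Fv: "F (sphere_chart a w) = Some v" using FPQ[of w] False by (simp add: v_def)
      have "poly P w + poly Q w = 0 \<longleftrightarrow> v = -1"
        using False by (simp add: v_def nonzero_divide_eq_eq add_eq_0_iff2)
      moreover have "w \<notin> U" if "v = -1"
        using that Fv K_iff[of "sphere_chart a w"] not_m1 unfolding U_def by blast
      moreover have "w \<in> U \<longleftrightarrow> M w \<notin> \<real>\<^sub>\<le>\<^sub>0" if "v \<noteq> -1"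
        using that False cayley_nonpos_Reals_iff[OF that] M[of w] Fv \<open>_ \<longleftrightarrow> v = -1\<close>
        by (simp add: U_def K_iff flip: v_def)
      ultimately show ?thesis by blast
    qed
    then show ?thesis by auto
  qed
  have opn: "open {w. poly P w + poly Q w \<noteq> 0}"
    by (intro open_Collect_neq continuous_intros)
  have holM: "M holomorphic_on {w. poly P w + poly Q w \<noteq> 0}"
    unfolding M_def by (intro holomorphic_intros) auto
  have opU: "open U"
    unfolding U_eq by (rule open_preimage_holomorphic[OF holM opn]) (simp add: open_Compl)
  have b_eq: "b w = (1 - csqrt (M w)) / (1 + csqrt (M w))" if "w \<in> U" for w
    using that M[of w] FPQ[of w] by (auto simp: b_def B_def joukowski_inv_def U_eq)
  have holb: "b holomorphic_on U"
  proof (rule holomorphic_transform)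
    show "(\<lambda>w. (1 - csqrt (M w)) / (1 + csqrt (M w))) holomorphic_on U"
      by (intro holomorphic_intros holomorphic_on_csqrt' holomorphic_on_subset[OF holM] one_plus_csqrt_neq_0)
         (auto simp: U_eq)
  qed (simp add: b_eq)
  have b_lt_1: "cmod (b w) < 1" if "w \<in> U" for w
    using B_lt_1 that by (simp add: b_def U_def)
  have b0_iff: "b w = 0 \<longleftrightarrow> poly Q w = 0" if "w \<in> U" for w
  proof (cases "poly Q w = 0")
    case True
    then show ?thesis using B_None[of "sphere_chart a w"] FPQ[of w] by (simp add: b_def)
  next
    case False
    then have "F (sphere_chart a w) = Some (poly P w / poly Q w)" using FPQ[of w] by simp
    then show ?thesis using B_Some(1) that False by (simp add: b_def U_def)
  qed
  have b_v: "b w + 1 / b w = 2 * (poly P w / poly Q w)" if "w \<in> U" "poly Q w \<noteq> 0" for w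
    using B_Some(2)[of "sphere_chart a w"] FPQ[of w] that by (simp add: b_def U_def)
  \<comment> \<open>The Joukowski relation cleared of denominators. It persists at the zeros of
    \<open>Q\<close> and, by \<open>den\<close>, writes \<open>b\<close> as \<open>Q\<close> over a
    zero-free function.\<close>
  have rel: "b w * (2 * poly P w - b w * poly Q w) = poly Q w" if "w \<in> U" for w
  proof (cases "poly Q w = 0")
    case False
    then have "b w \<noteq> 0" using b0_iff that by simp
    then show ?thesis using b_v[OF that False] False by (simp add: field_simps)
  qed (use b0_iff that in simp)
  have den: "2 * poly P w - b w * poly Q w \<noteq> 0" if "w \<in> U" for w
    using rel[OF that] PQ0[of w] by (cases "poly Q w = 0") auto
  have finb: "finite {w \<in> U. b w = 0}"
    by (rule finite_subset[OF _ poly_roots_finite[OF C(2)]]) (use b0_iff in auto)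

  \<comment> \<open>Vanishing of log|b| at the boundary of \<open>U\<close>\<close>
  define lb where "lb w = (if b w = 0 then 0 else ln (cmod (b w)))" for w
  have van: "vanishes_at_boundary lb U"
    unfolding vanishes_at_boundary_def
  proof (intro allI impI)
    fix \<epsilon> :: real assume \<epsilon>: "\<epsilon> > 0"
    define \<eta> where "\<eta> = exp (- \<epsilon>)"
    have \<eta>: "0 < \<eta>" "\<eta> < 1" using \<epsilon> by (auto simp: \<eta>_def)
    define \<kappa> where "\<kappa> = \<eta> + 1 / \<eta>"
    have "(1 - \<eta>)\<^sup>2 > 0" using \<eta> by simp
    then have \<kappa>: "\<kappa> > 2" using \<eta> by (simp add: \<kappa>_def field_simps power2_eq_square)
    \<comment> \<open>By \<open>joukowski_ellipse\<close>, \<open>|b| <= \<eta>\<close> describes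
      the outside of the ellipse \<open>|F - 1| + |F + 1| >= \<kappa>\<close>. Clearing
      \<open>Q\<close> makes this set closed in the plane and puts the poles into it.\<close>
    define S where "S = {w. cmod (poly P w - poly Q w) + cmod (poly P w + poly Q w) \<ge> \<kappa> * cmod (poly Q w)}"
    have S_iff: "w \<in> S \<longleftrightarrow> cmod (poly P w / poly Q w - 1) + cmod (poly P w / poly Q w + 1) \<ge> \<kappa>"
      if "poly Q w \<noteq> 0" for w
    proof -
      have "cmod (poly P w / poly Q w - 1) = cmod (poly P w - poly Q w) / cmod (poly Q w)"
        "cmod (poly P w / poly Q w + 1) = cmod (poly P w + poly Q w) / cmod (poly Q w)"
        using that by (simp_all add: diff_divide_distrib add_divide_distrib flip: norm_divide)
      then show ?thesis
        using that by (simp add: S_def pos_le_divide_eq flip: add_divide_distrib)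
    qed
    have seg: "cmod (of_real t - 1) + cmod (of_real t + 1) = 2" if "-1 \<le> t" "t \<le> 1" for t :: real
    proof -
      have "cmod (of_real t - 1) = \<bar>t - 1\<bar>" "cmod (of_real t + 1) = \<bar>t + 1\<bar>"
        by (metis norm_of_real of_real_1 of_real_diff) (metis norm_of_real of_real_1 of_real_add)
      then show ?thesis using that by simp
    qed
    have "closed S"
      unfolding S_def by (intro closed_Collect_le continuous_intros)
    \<comment> \<open>Infinity in the chart is the point \<open>a\<close>, where \<open>F\<close>
      has the value \<open>t\<close> in the segment and the focal sum is
      \<open>2 < \<kappa>\<close>.\<close>
    moreover have "bounded S"
    proof -
      have "((\<lambda>w. cmod (poly P w / poly Q w - 1) + cmod (poly P w / poly Q w + 1)) \<longlongrightarrow>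
          cmod (of_real t - 1) + cmod (of_real t + 1)) at_infinity"
        by (intro tendsto_intros limPQ)
      then have "\<forall>\<^sub>F w in at_infinity. cmod (poly P w / poly Q w - 1) + cmod (poly P w / poly Q w + 1) < \<kappa>"
        using \<kappa> seg[OF t(2,3)] by (intro order_tendstoD(2)) auto
      then have "\<forall>\<^sub>F w in at_infinity. w \<notin> S"
        using evQ by eventually_elim (simp add: S_iff)
      then obtain R where "\<And>w. cmod w \<ge> R \<Longrightarrow> w \<notin> S"
        unfolding eventually_at_infinity by blast
      then show ?thesis
        unfolding bounded_iff by (meson linorder_le_cases)
    qed
    ultimately have "compact S" by (simp add: compact_eq_bounded_closed)
    moreover have "S \<subseteq> U"
    proof
      fix w assume w: "w \<in> S"
      show "w \<in> U"
      proof (rule ccontr)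
        assume "w \<notin> U"
        then obtain t :: real where t: "-1 \<le> t" "t \<le> 1" "F (sphere_chart a w) = Some (of_real t)"
          using K_iff[of "sphere_chart a w"] by (auto simp: U_def)
        then have "poly Q w \<noteq> 0" "poly P w / poly Q w = of_real t"
          using FPQ[of w] by (auto split: if_splits)
        then show False using S_iff[of w] w seg[OF t(1,2)] \<kappa> by simp
      qed
    qed
    moreover have "\<bar>lb w\<bar> < \<epsilon>" if w: "w \<in> U - S" for w
    proof -
      have Q0: "poly Q w \<noteq> 0" using w by (auto simp: S_def)
      then have b0: "b w \<noteq> 0" using b0_iff w by simp
      have e: "cmod (b w) + 1 / cmod (b w) = cmod (poly P w / poly Q w - 1) + cmod (poly P w / poly Q w + 1)"
        using w by (intro joukowski_ellipse b0 b_v Q0) auto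
      have lt1: "cmod (b w) < 1" using b_lt_1 w by simp
      have "\<eta> < cmod (b w)"
      proof (rule ccontr)
        assume le: "\<not> \<eta> < cmod (b w)"
        define x where "x = cmod (b w)"
        have x: "0 < x" "x \<le> \<eta>" using b0 le by (simp_all add: x_def)
        \<comment> \<open>Encodes that \<open>x + 1 / x\<close> decreases on \<open>(0, 1)\<close>:
          the product equals \<open>(x^2 + 1) \<eta> - (\<eta>^2 + 1) x\<close>.\<close>
        then have "0 \<le> (\<eta> - x) * (1 - x * \<eta>)"
          using \<eta> by (intro mult_nonneg_nonneg) (auto simp: mult_le_one)
        then have "(\<eta>\<^sup>2 + 1) * x \<le> (x\<^sup>2 + 1) * \<eta>"
          by (simp add: power2_eq_square algebra_simps)
        then have "\<eta> + 1 / \<eta> \<le> x + 1 / x"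
          using x \<eta> by (simp add: field_simps power2_eq_square)
        then have "w \<in> S" using S_iff[OF Q0] e by (simp add: \<kappa>_def x_def)
        then show False using w by simp
      qed
      then have "ln \<eta> < ln (cmod (b w))" using \<eta>(1) b0 by simp
      moreover have "ln (cmod (b w)) < 0" using lt1 b0 by simp
      ultimately show ?thesis by (simp add: lb_def b0 \<eta>_def)
    qed
    ultimately show "\<exists>C. compact C \<and> C \<subseteq> U \<and> (\<forall>w\<in>U - C. \<bar>lb w\<bar> < \<epsilon>)" by blast
  qed

  \<comment> \<open>The Green functions of the poles and the formula for log|B|\<close>
  define S where "S = {c. polar_div F c \<noteq> 0}"
  have polar: "polar_div F c = 0 \<longleftrightarrow> F c \<noteq> None" for c by (rule polar_div_eq_0_iff[OF F])
  have S: "c \<noteq> Some a" "sphere_chart a (sphere_coord a c) = c" "sphere_coord a c \<in> U" "b (sphere_coord a c) = 0"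
    if "c \<in> S" for c
  proof -
    have Fc: "F c = None" using that polar by (auto simp: S_def)
    then show "c \<noteq> Some a" using t(1) by auto
    then show ch: "sphere_chart a (sphere_coord a c) = c" by (rule sphere_chart_coord)
    then show "sphere_coord a c \<in> U" using Fc by (simp add: U_def K_iff)
    show "b (sphere_coord a c) = 0" using Fc by (simp add: b_def ch B_None)
  qed
  have "\<forall>c\<in>S. \<exists>s. harmonic_in s U \<and>
      (\<forall>w\<in>U. w \<noteq> sphere_coord a c \<longrightarrow> green K c (sphere_chart a w) = s w - ln (cmod (w - sphere_coord a c))) \<and>
      (\<forall>w\<in>U. w \<noteq> sphere_coord a c \<longrightarrow> ln (cmod (w - sphere_coord a c)) \<le> s w) \<and>
      (\<forall>w\<in>U. b w \<noteq> 0 \<longrightarrow> s w - ln (cmod (w - sphere_coord a c)) \<le> - ln (cmod (b w)))"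
  proof
    fix c assume c: "c \<in> S"
    show "\<exists>s. harmonic_in s U \<and>
      (\<forall>w\<in>U. w \<noteq> sphere_coord a c \<longrightarrow> green K c (sphere_chart a w) = s w - ln (cmod (w - sphere_coord a c))) \<and>
      (\<forall>w\<in>U. w \<noteq> sphere_coord a c \<longrightarrow> ln (cmod (w - sphere_coord a c)) \<le> s w) \<and>
      (\<forall>w\<in>U. b w \<noteq> 0 \<longrightarrow> s w - ln (cmod (w - sphere_coord a c)) \<le> - ln (cmod (b w)))"
    proof (rule green_on_sphere[OF opU holb _ van[unfolded lb_def] finb S(3)[OF c] S(4)[OF c], where a = a])
      fix s
      assume s: "harmonic_in s U"
        "\<And>w. w \<in> U \<Longrightarrow> w \<noteq> sphere_coord a c \<Longrightarrow>
           green (- sphere_chart a ` U) (sphere_chart a (sphere_coord a c)) (sphere_chart a w) =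
             s w - ln (cmod (w - sphere_coord a c))"
        "\<And>w. w \<in> U \<Longrightarrow> w \<noteq> sphere_coord a c \<Longrightarrow> ln (cmod (w - sphere_coord a c)) \<le> s w"
        "\<And>w. w \<in> U \<Longrightarrow> b w \<noteq> 0 \<Longrightarrow> s w - ln (cmod (w - sphere_coord a c)) \<le> - ln (cmod (b w))"
      then show ?thesis
        unfolding K_eq S(2)[OF c] by (intro exI[of _ s] conjI ballI impI) simp_all
    qed (rule b_lt_1)
  qed
  then obtain s where harm_s: "\<And>c. c \<in> S \<Longrightarrow> harmonic_in (s c) U"
    and green_s: "\<And>c w. c \<in> S \<Longrightarrow> w \<in> U \<Longrightarrow> w \<noteq> sphere_coord a c \<Longrightarrow>
        green K c (sphere_chart a w) = s c w - ln (cmod (w - sphere_coord a c))"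
    and s_ge: "\<And>c w. c \<in> S \<Longrightarrow> w \<in> U \<Longrightarrow> w \<noteq> sphere_coord a c \<Longrightarrow> ln (cmod (w - sphere_coord a c)) \<le> s c w"
    and s_le: "\<And>c w. c \<in> S \<Longrightarrow> w \<in> U \<Longrightarrow> b w \<noteq> 0 \<Longrightarrow>
        s c w - ln (cmod (w - sphere_coord a c)) \<le> - ln (cmod (b w))"
    unfolding bchoice_iff by blast
  define m where "m c = real (polar_div F c)" for c
  \<comment> \<open>\<open>d\<close> extends \<open>\<Sum>c. m c * g c + ln |b|\<close> harmonically across the poles: the logarithms cancel\<close>
  define d where "d w = (\<Sum>c\<in>S. m c * s c w) + ln (cmod (C / (2 * poly P w - b w * poly Q w)))" for w
  have d_eq: "d w = (\<Sum>c\<in>S. m c * (s c w - ln (cmod (w - sphere_coord a c)))) + ln (cmod (b w))"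
    if w: "w \<in> U" "b w \<noteq> 0" for w
  proof -
    have ne: "w \<noteq> sphere_coord a c" if "c \<in> S" for c using S(4)[OF that] w by auto
    define u where "u = C / (2 * poly P w - b w * poly Q w)"
    have u: "u \<noteq> 0" using C(1) den[OF w(1)] by (simp add: u_def)
    \<comment> \<open>\<open>rel\<close> combined with the factorisation of \<open>Q\<close>: a
      zero-free factor times the product over the poles.\<close>
    have "b w = u * (\<Prod>c\<in>S. (w - sphere_coord a c) ^ polar_div F c)"
      using rel[OF w(1)] den[OF w(1)] prodQ[of w] by (simp add: u_def S_def field_simps)
    then have "cmod (b w) = cmod u * (\<Prod>c\<in>S. cmod (w - sphere_coord a c) ^ polar_div F c)"
      by (simp add: norm_mult norm_power flip: prod_norm)
    moreover have pos: "0 < (\<Prod>c\<in>S. cmod (w - sphere_coord a c) ^ polar_div F c)"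
      using ne by (intro prod_pos) simp
    ultimately have "ln (cmod (b w)) = ln (cmod u) + ln (\<Prod>c\<in>S. cmod (w - sphere_coord a c) ^ polar_div F c)"
      using u by (simp add: ln_mult)
    also have "ln (\<Prod>c\<in>S. cmod (w - sphere_coord a c) ^ polar_div F c) =
        (\<Sum>c\<in>S. m c * ln (cmod (w - sphere_coord a c)))"
      using fin ne by (subst ln_prod) (auto simp: S_def m_def ln_realpow)
    finally show ?thesis
      by (simp add: d_def u_def right_diff_distrib sum_subtractf)
  qed
  have "harmonic_in d U"
    unfolding d_def
    by (intro harmonic_in_add harmonic_in_sum harmonic_in_cmult harm_s harmonic_in_ln_norm opU holomorphic_intros holb den)
       (use C(1) den in auto)
  moreover have "vanishes_at_boundary d U"
  proof (rule vanishes_at_boundary_le[OF van, of "{w \<in> U. b w = 0}"])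
    show "compact {w \<in> U. b w = 0}" using finb by (rule finite_imp_compact)
    have m: "m c \<ge> 0" for c by (simp add: m_def)
    then show "0 \<le> (\<Sum>c\<in>S. m c) + 1" by (simp add: sum_nonneg add_nonneg_nonneg)
    fix w assume "w \<in> U - {w \<in> U. b w = 0}"
    then have w: "w \<in> U" "b w \<noteq> 0" by auto
    define g where "g c = s c w - ln (cmod (w - sphere_coord a c))" for c
    \<comment> \<open>This squeeze bounds \<open>|d|\<close> by \<open>\<Sum>c\<in>S. m c\<close>
      plus 1 times \<open>|ln |b||\<close>, so the boundary behaviour of \<open>d\<close> is that of
      \<open>b\<close>.\<close>
    have g: "0 \<le> g c" "g c \<le> - ln (cmod (b w))" if "c \<in> S" for c
      using s_ge[OF that w(1)] s_le[OF that w] S(4)[OF that] w(2) by (auto simp: g_def)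
    have neg: "ln (cmod (b w)) < 0" using b_lt_1[OF w(1)] w(2) by simp
    have "0 \<le> (\<Sum>c\<in>S. m c * g c)" using m g by (intro sum_nonneg) auto
    moreover have "(\<Sum>c\<in>S. m c * g c) \<le> (\<Sum>c\<in>S. m c * - ln (cmod (b w)))"
      using m g by (intro sum_mono mult_left_mono) auto
    moreover have "(\<Sum>c\<in>S. m c * - ln (cmod (b w))) = (\<Sum>c\<in>S. m c) * - ln (cmod (b w))"
      by (rule sum_distrib_right[symmetric])
    moreover have "d w = (\<Sum>c\<in>S. m c * g c) + ln (cmod (b w))"
      using d_eq[OF w] by (simp add: g_def)
    ultimately have "\<bar>d w\<bar> \<le> (\<Sum>c\<in>S. m c) * - ln (cmod (b w)) + - ln (cmod (b w))"
      using neg by linarith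
    then show "\<bar>d w\<bar> \<le> ((\<Sum>c\<in>S. m c) + 1) * \<bar>lb w\<bar>"
      using neg w(2) by (simp add: lb_def algebra_simps)
  qed auto
  ultimately have d0: "d w = 0" if "w \<in> U" for w
    using that by (rule harmonic_vanishing_eq_0)
  have chart: "sphere_coord a z \<in> U" "sphere_chart a (sphere_coord a z) = z" if "z \<notin> K" for z
    using that K_eq sphere_chart_image_iff[of z a U] sphere_chart_coord[of z a] by auto
  show ?thesis
  proof (intro exI[of _ B] conjI ballI impI)
    show "sphere_analytic_on B (- preim_interval F)"
      unfolding sphere_analytic_on_def K_def[symmetric]
    proof (intro conjI impI)
      have hol: "(\<lambda>z. 1 / (z - a)) holomorphic_on - {a}" by (intro holomorphic_intros) auto
      have eq: "{z. Some z \<in> - K} = {z \<in> - {a}. 1 / (z - a) \<in> U}"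
      proof -
        have "Some z \<notin> K \<longleftrightarrow> z \<noteq> a \<and> 1 / (z - a) \<in> U" for z
          using aK chart[of "Some z"] sphere_chart_coord[of "Some z" a]
          by (auto simp: sphere_coord_def U_def)
        then show ?thesis by auto
      qed
      show "open {z. Some z \<in> - K}"
        unfolding eq by (rule open_preimage_holomorphic[OF hol _ opU]) auto
      have "(b \<circ> (\<lambda>z. 1 / (z - a))) holomorphic_on {z. Some z \<in> - K}"
        unfolding eq by (rule holomorphic_on_compose_gen[OF holomorphic_on_subset[OF hol] holb]) auto
      then show "(\<lambda>z. B (Some z)) holomorphic_on {z. Some z \<in> - K}"
      proof (rule holomorphic_transform)
        fix z assume "z \<in> {z. Some z \<in> - K}"
        then show "(b \<circ> (\<lambda>z. 1 / (z - a))) z = B (Some z)"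
          using chart(2)[of "Some z"] by (simp add: b_def sphere_coord_def)
      qed
      assume "None \<in> - K"
      then have "0 \<in> U" using chart(1)[of None] by (simp add: sphere_coord_def)
      have opn1: "open {\<zeta>::complex. 1 - a * \<zeta> \<noteq> 0}" by (intro open_Collect_neq continuous_intros)
      have hol1: "(\<lambda>\<zeta>. \<zeta> / (1 - a * \<zeta>)) holomorphic_on {\<zeta>. 1 - a * \<zeta> \<noteq> 0}"
        by (intro holomorphic_intros) auto
      let ?T = "{\<zeta> \<in> {\<zeta>. 1 - a * \<zeta> \<noteq> 0}. \<zeta> / (1 - a * \<zeta>) \<in> U}"
      have T: "open ?T" by (rule open_preimage_holomorphic[OF hol1 opn1 opU])
      have "0 \<in> ?T" using \<open>0 \<in> U\<close> by simp
      then obtain r where r: "r > 0" "ball 0 r \<subseteq> ?T" by (rule openE[OF T])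
      have inT: "inf_chart \<zeta> = sphere_chart a (\<zeta> / (1 - a * \<zeta>))" if "\<zeta> \<in> ?T" for \<zeta>
        using that by (intro inf_chart_eq_sphere_chart) auto
      have "(b \<circ> (\<lambda>\<zeta>. \<zeta> / (1 - a * \<zeta>))) holomorphic_on ?T"
        by (rule holomorphic_on_compose_gen[OF holomorphic_on_subset[OF hol1] holb]) auto
      then have "(b \<circ> (\<lambda>\<zeta>. \<zeta> / (1 - a * \<zeta>))) holomorphic_on ball 0 r"
        using r(2) by (rule holomorphic_on_subset)
      then have "(\<lambda>\<zeta>. B (inf_chart \<zeta>)) holomorphic_on ball 0 r"
      proof (rule holomorphic_transform)
        fix \<zeta> :: complex assume "\<zeta> \<in> ball 0 r"
        then have "\<zeta> \<in> ?T" using r(2) by blast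
        then show "(b \<circ> (\<lambda>\<zeta>. \<zeta> / (1 - a * \<zeta>))) \<zeta> = B (inf_chart \<zeta>)"
          using inT[of \<zeta>] by (simp add: b_def)
      qed
      moreover have "\<forall>\<zeta>\<in>ball 0 r. inf_chart \<zeta> \<in> - K"
      proof
        fix \<zeta> :: complex assume "\<zeta> \<in> ball 0 r"
        then have "\<zeta> \<in> ?T" using r(2) by blast
        then show "inf_chart \<zeta> \<in> - K" using inT[of \<zeta>] by (simp add: U_def)
      qed
      ultimately show "\<exists>r>0. (\<forall>\<zeta>\<in>ball 0 r. inf_chart \<zeta> \<in> - K) \<and> (\<lambda>\<zeta>. B (inf_chart \<zeta>)) holomorphic_on ball 0 r"
        using r(1) by blast
    qed
  next
    fix z assume "z \<in> - preim_interval F" and z0: "polar_div F z = 0"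
    then have z: "z \<notin> K" by (simp add: K_def)
    define w where "w = sphere_coord a z"
    have w: "w \<in> U" "sphere_chart a w = z" using chart[OF z] by (simp_all add: w_def)
    obtain v where "F z = Some v" using z0 polar by auto
    then have bw: "b w \<noteq> 0" using B_Some(1) z by (simp add: b_def w(2))
    have "- ln (cmod (b w)) = (\<Sum>c\<in>S. m c * (s c w - ln (cmod (w - sphere_coord a c))))"
      using d_eq[OF w(1) bw] d0[OF w(1)] by simp
    also have "\<dots> = (\<Sum>c\<in>S. m c * green K c z)"
    proof (intro sum.cong refl)
      fix c assume c: "c \<in> S"
      then have "w \<noteq> sphere_coord a c" using S(4) bw by auto
      then show "m c * (s c w - ln (cmod (w - sphere_coord a c))) = m c * green K c z"
        using green_s[OF c w(1)] w(2) by simp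
    qed
    finally show "- ln (cmod (B z)) = (\<Sum>c\<in>{c. polar_div F c \<noteq> 0}.
        real (polar_div F c) * green (preim_interval F) c z)"
      by (simp add: b_def w(2) S_def m_def K_def)
  next

    \<comment> \<open>Positivity of the limit at \<open>xs\<close>\<close>
    have xs: "xs \<notin> E" "xs \<in> Rbar" using assms(10) by auto
    obtain l :: real where l: "l > 0" "D xs = 0 \<Longrightarrow> l \<ge> 1"
      "((\<lambda>z. fin (F (Some z)) / rr z xs ^ nat (D xs)) \<longlongrightarrow> of_real l) (sphere_filter xs)"
      using extremal_leading_limit[OF assms(2) xs assms(7,11) F] by blast
    define f where "f z = fin (F (Some z))" for z
    have l_nz: "complex_of_real l \<noteq> 0" using l(1) by simp
    have ev: "\<forall>\<^sub>F z in sphere_filter xs. f z / rr z xs ^ nat (D xs) \<noteq> 0"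
      using tendsto_imp_eventually_ne[OF l(3) l_nz] by (simp add: f_def)
    \<comment> \<open>\<open>fin\<close> sends a pole to 0, so a nonzero quotient certifies that
      \<open>F\<close> is finite at this point.\<close>
    have BF: "B (Some z) = joukowski_inv (Some (f z))" if "f z / rr z xs ^ nat (D xs) \<noteq> 0" for z
      using that by (cases "F (Some z)") (auto simp: B_def f_def fin_def)
    have "\<exists>L>0. ((\<lambda>z. B (Some z) * rr z xs ^ nat (D xs)) \<longlongrightarrow> complex_of_real L) (sphere_filter xs)"
    proof (cases "D xs = 0")
      case True
      \<comment> \<open>For \<open>l >= 1\<close> the Cayley transform of \<open>l\<close> lies in
        \<open>[0, 1)\<close>, so its root is real and less than 1 and the inverse Joukowski value
        is positive. The borderline \<open>l = 1\<close> gives the limit 1.\<close>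
      define \<sigma> where "\<sigma> = sqrt ((l - 1) / (l + 1))"
      have l1: "l \<ge> 1" using l(2) True by simp
      have m: "(complex_of_real l - 1) / (of_real l + 1) = of_real ((l - 1) / (l + 1))" by simp
      have "0 \<le> (l - 1) / (l + 1)" "(l - 1) / (l + 1) < 1" using l1 by simp_all
      then have \<sigma>: "0 \<le> \<sigma>" "\<sigma> < 1" by (simp_all add: \<sigma>_def)
      have "csqrt (of_real ((l - 1) / (l + 1))) = of_real \<sigma>"
        unfolding \<sigma>_def using \<open>0 \<le> (l - 1) / (l + 1)\<close> by (subst csqrt_of_real_nonneg) simp_all
      then have jl: "joukowski_inv (Some (of_real l)) = of_real ((1 - \<sigma>) / (1 + \<sigma>))"
        unfolding joukowski_inv_def option.case m by simp
      have "((\<lambda>z. joukowski_inv (Some (f z))) \<longlongrightarrow> joukowski_inv (Some (of_real l))) (sphere_filter xs)"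
      proof (rule joukowski_inv_tendsto)
        show "complex_of_real l \<noteq> -1"
          using l1 by (auto dest: arg_cong[of _ _ Re])
        show "complex_of_real l = 1" if "(complex_of_real l - 1) / (of_real l + 1) \<in> \<real>\<^sub>\<le>\<^sub>0"
          using that l1 unfolding m nonpos_Reals_of_real_iff by (simp add: divide_le_0_iff)
        show "(f \<longlongrightarrow> of_real l) (sphere_filter xs)"
          using l(3) True by (simp add: f_def[abs_def])
      qed
      moreover have "\<forall>\<^sub>F z in sphere_filter xs. joukowski_inv (Some (f z)) = B (Some z) * rr z xs ^ nat (D xs)"
        using ev by eventually_elim (simp add: BF True)
      ultimately have "((\<lambda>z. B (Some z) * rr z xs ^ nat (D xs)) \<longlongrightarrow> of_real ((1 - \<sigma>) / (1 + \<sigma>))) (sphere_filter xs)"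
        unfolding jl by (rule Lim_transform_eventually)
      moreover have "(1 - \<sigma>) / (1 + \<sigma>) > 0" using \<sigma> by simp
      ultimately show ?thesis by blast
    next
      case False
      then have d: "nat (D xs) \<noteq> 0" using spec[OF assms(7), of xs] by simp
      have "filterlim (\<lambda>z. rr z xs) at_infinity (sphere_filter xs)"
      proof (cases xs)
        case None
        then show ?thesis by (simp add: rr_def sphere_filter_def filterlim_ident)
      next
        case (Some x)
        have "filterlim (\<lambda>z. 1 / (x - z)) at_infinity (at x)"
          by (intro filterlim_divide_at_infinity[of _ 1] tendsto_const)
             (auto simp: filterlim_at intro!: tendsto_eq_intros eventually_at_topological[THEN iffD2])
        then show ?thesis by (simp add: Some rr_def sphere_filter_def)
      qed
      then have "filterlim (\<lambda>z. rr z xs ^ nat (D xs)) at_infinity (sphere_filter xs)"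
        by (rule filterlim_compose[OF filterlim_power_at_infinity[OF d]])
      then have "filterlim (\<lambda>z. f z / rr z xs ^ nat (D xs) * rr z xs ^ nat (D xs)) at_infinity (sphere_filter xs)"
        using l(3) l_nz unfolding f_def by (intro tendsto_mult_filterlim_at_infinity)
      moreover have "\<forall>\<^sub>F z in sphere_filter xs. f z / rr z xs ^ nat (D xs) * rr z xs ^ nat (D xs) = f z"
        using ev by eventually_elim auto
      ultimately have "filterlim f at_infinity (sphere_filter xs)"
        by (simp add: filterlim_cong)
      \<comment> \<open>\<open>B * rr ^ d\<close> is written as \<open>f * B\<close> divided by
        \<open>f / rr ^ d\<close>; the two limits are 1/2 and \<open>l\<close>, so the limit is
        \<open>1 / (2 l)\<close>.\<close>
      then have "((\<lambda>z. f z * joukowski_inv (Some (f z)) / (f z / rr z xs ^ nat (D xs))) \<longlongrightarrow>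
          1 / 2 / of_real l) (sphere_filter xs)"
        using l(3) l_nz unfolding f_def
        by (intro tendsto_divide joukowski_inv_at_infinity)
      moreover have "\<forall>\<^sub>F z in sphere_filter xs. f z * joukowski_inv (Some (f z)) / (f z / rr z xs ^ nat (D xs)) =
          B (Some z) * rr z xs ^ nat (D xs)"
        using ev by eventually_elim (auto simp: BF)
      ultimately have "((\<lambda>z. B (Some z) * rr z xs ^ nat (D xs)) \<longlongrightarrow> of_real (1 / 2 / l)) (sphere_filter xs)"
        by (auto dest: Lim_transform_eventually)
      then show ?thesis using l(1) by (intro exI[of _ "1 / 2 / l"]) simp
    qed
    then obtain L where L: "L > 0"
      "((\<lambda>z. B (Some z) * rr z xs ^ nat (D xs)) \<longlongrightarrow> complex_of_real L) (sphere_filter xs)" by blast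
    then show "\<exists>L>0. ((\<lambda>x::real. B (Some (of_real x)) * rr (of_real x) xs ^ nat (D xs))
        \<longlongrightarrow> complex_of_real L) (real_filter xs)"
      using filterlim_compose[OF L(2) filterlim_of_real_sphere[OF xs(2)]] by blast
  next
    fix z assume "z \<in> - preim_interval F"
    then have z: "z \<notin> K" by (simp add: K_def)
    show "F z = (if B z = 0 then None else Some ((B z + 1 / B z) / 2))"
    proof (cases "F z")
      case (Some v)
      then show ?thesis using B_Some[OF Some z] by simp
    qed (simp add: B_None)
  qed
qed

end
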